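(* Fix $\mu\in\mathbb{R}^{m+q}$, $s\in\mathcal{S}$, $\rho>0$, and $z^{(0)}\in\mathcal{Z}$. Let $(z^{(l)})_{l\ge0}$ be generated by infinitely many successive primal sweeps on $L_\rho(\cdot,\mu,s)$. Then $(z^{(l)})$ converges to a point $z^\infty\in\mathcal{Z}$ which is a critical point of $L_\rho(\cdot,\mu,s)+\iota_{\mathcal{Z}}$, i.e. $0\in\nabla_zL_\rho(z^\infty,\mu,s)+\mathcal{N}_{\mathcal{Z}}(z^\infty)$.
   Context: Setting: $P\ge1$, $z=(z_1,\dots,z_P)\in\mathbb{R}^{n_z}$, $z_i\in\mathbb{R}^{n_i}$, $n_z\ge2$; each $\mathcal{Z}_i\subset\mathbb{R}^{n_i}$ a nonempty bounded box, $\mathcal{Z}=\mathcal{Z}_1\times\cdots\times\mathcal{Z}_P$; $J(z)=\sum_iJ_i(z_i)$ with polynomials $J_i$ of degree $\ge2$; polynomial maps $Q_c:\mathbb{R}^{n_z}\to\mathbb{R}^m$, $g_i:\mathbb{R}^{n_i}\to\mathbb{R}^{q_i}$; matrices $T_i\in\mathbb{R}^{q_i\times p}$; $q=\sum q_i$; $\mathcal{S}\subseteq\mathbb{R}^p$; $G(z,s)=(Q_c(z),g_1(z_1)+T_1s,\dots,g_P(z_P)+T_Ps)$. Augmented Lagrangian: $L_\rho(z,\mu,s)=J(z)+\big(\mu+\tfrac{\rho}{2}G(z,s)\big)^\top G(z,s)$. $\iota_{\mathcal{Z}}$ is the indicator of $\mathcal{Z}$; $\mathcal{N}_{\mathcal{Z}}$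 its normal cone; $\pi_{\mathcal{Z}_i}$ the Euclidean projection onto $\mathcal{Z}_i$. Primal sweep on $f=L_\rho(\cdot,\mu,s)$: fix $\alpha_i>0$, $\beta>1$ and $c_i^0>0$. Given $z^{(l)}\in\mathcal{Z}$, for $i=1,\dots,P$ in order, let $f^{(i,l)}(x):=f(z_1^{(l+1)},\dots,z_{i-1}^{(l+1)},x,z_{i+1}^{(l)},\dots,z_P^{(l)})$, set $c_i:=c_i^0$ and repeat: compute $u:=\pi_{\mathcal{Z}_i}\big(z_i^{(l)}-\tfrac1{c_i}\nabla f^{(i,l)}(z_i^{(l)})\big)$; if $f^{(i,l)}(u)+\tfrac{\alpha_i}{2}\|u-z_i^{(l)}\|^2\le f^{(i,l)}(z_i^{(l)})+\nabla f^{(i,l)}(z_i^{(l)})^\top(u-z_i^{(l)})+\tfrac{c_i}{2}\|u-z_i^{(l)}\|^2$ stop and set $z_i^{(l+1)}:=u$, otherwise set $c_i:=\beta c_i$ and repeat. The sweep outputs $z^{(l+1)}$. *)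

theory Defs
  imports "HOL-Analysis.Analysis"
begin

inductive poly_deg_le :: "nat \<Rightarrow> (real^'n \<Rightarrow> real) \<Rightarrow> bool" where
  pconst: "poly_deg_le d (\<lambda>x. c)"
| pvar: "1 \<le> d \<Longrightarrow> poly_deg_le d (\<lambda>x. x $ j)"
| padd: "poly_deg_le d f \<Longrightarrow> poly_deg_le d g \<Longrightarrow> poly_deg_le d (\<lambda>x. f x + g x)"
| pmul: "poly_deg_le d1 f \<Longrightarrow> poly_deg_le d2 g \<Longrightarrow> poly_deg_le (d1 + d2) (\<lambda>x. f x * g x)"
| pmono: "poly_deg_le d f \<Longrightarrow> d \<le> e \<Longrightarrow> poly_deg_le e f"

definition polyfun :: "(real^'n \<Rightarrow> real) \<Rightarrow> bool" where
  "polyfun f \<longleftrightarrow> (\<exists>d. poly_deg_le d f)"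

definition poly_deg_ge2 :: "(real^'n \<Rightarrow> real) \<Rightarrow> bool" where
  "poly_deg_ge2 f \<longleftrightarrow> polyfun f \<and> \<not> poly_deg_le 1 f"

definition dep_block :: "('n \<Rightarrow> nat) \<Rightarrow> nat \<Rightarrow> (real^'n \<Rightarrow> real) \<Rightarrow> bool" where
  "dep_block blk i f \<longleftrightarrow> (\<forall>x y. (\<forall>j. blk j = i \<longrightarrow> x $ j = y $ j) \<longrightarrow> f x = f y)"

definition upd_blk :: "('n \<Rightarrow> nat) \<Rightarrow> nat \<Rightarrow> real^'n \<Rightarrow> real^'n \<Rightarrow> real^'n" where
  "upd_blk blk i w x = (\<chi> j. if blk j = i then x $ j else w $ j)"

definition aug_lag ::
  "nat \<Rightarrow> nat \<Rightarrow> (nat \<Rightarrow> nat) \<Rightarrow> (nat \<Rightarrow> real^'n \<Rightarrow> real) \<Rightarrow> (nat \<Rightarrow> real^'n \<Rightarrow> real)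
   \<Rightarrow> (nat \<Rightarrow> nat \<Rightarrow> real^'n \<Rightarrow> real) \<Rightarrow> (nat \<Rightarrow> nat \<Rightarrow> real^'p)
   \<Rightarrow> real \<Rightarrow> (nat \<Rightarrow> real) \<Rightarrow> (nat \<Rightarrow> nat \<Rightarrow> real) \<Rightarrow> real^'p \<Rightarrow> real^'n \<Rightarrow> real" where
  "aug_lag P m q J Q g T rho muQ mug s z =
     (\<Sum>i<P. J i z)
     + (\<Sum>k<m. (muQ k + rho / 2 * Q k z) * Q k z)
     + (\<Sum>i<P. \<Sum>r<q i. (mug i r + rho / 2 * (g i r z + T i r \<bullet> s)) * (g i r z + T i r \<bullet> s))"

definition block_step ::
  "(real^'n \<Rightarrow> real) \<Rightarrow> (real^'n) set \<Rightarrow> ('n \<Rightarrow> nat) \<Rightarrow> real \<Rightarrow> real \<Rightarrow> real \<Rightarrow> nat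
   \<Rightarrow> real^'n \<Rightarrow> real^'n \<Rightarrow> bool" where
  "block_step f Z blk alpha beta c0 i w w' \<longleftrightarrow>
     (\<exists>D. GDERIV (\<lambda>x. f (upd_blk blk i w x)) w :> D \<and>
        (let cand = (\<lambda>c. upd_blk blk i w (closest_point Z (w - (1 / c) *\<^sub>R D)));
             ok = (\<lambda>c. f (cand c) + alpha / 2 * (norm (cand c - w))\<^sup>2
                        \<le> f w + D \<bullet> (cand c - w) + c / 2 * (norm (cand c - w))\<^sup>2)
         in \<exists>k::nat. ok (beta ^ k * c0) \<and> (\<forall>k'<k. \<not> ok (beta ^ k' * c0))
                    \<and> w' = cand (beta ^ k * c0)))"

definition primal_sweep ::
  "(real^'n \<Rightarrow> real) \<Rightarrow> (real^'n) set \<Rightarrow> ('n \<Rightarrow> nat) \<Rightarrow> nat \<Rightarrow> (nat \<Rightarrow> real) \<Rightarrow> real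
   \<Rightarrow> (nat \<Rightarrow> real) \<Rightarrow> real^'n \<Rightarrow> real^'n \<Rightarrow> bool" where
  "primal_sweep f Z blk P alpha beta c0 z z' \<longleftrightarrow>
     (\<exists>w :: nat \<Rightarrow> real^'n. w 0 = z
        \<and> (\<forall>i<P. block_step f Z blk (alpha i) beta (c0 i) i (w i) (w (Suc i)))
        \<and> z' = w P)"

definition normal_cone :: "'a::real_inner set \<Rightarrow> 'a \<Rightarrow> 'a set" where
  "normal_cone Z x = {v. x \<in> Z \<and> (\<forall>y\<in>Z. v \<bullet> (y - x) \<le> 0)}"

end

theory Submission
  imports Defs "HOL-Computational_Algebra.Polynomial_Factorial"
    "HOL-Computational_Algebra.Field_as_Ring" "HOL-Real_Asymp.Real_Asymp"
begin

text \<open>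
  The objective is a polynomial \<open>f\<close>, and the sweeps decrease it by a multiple of the squared step
  length, while the projected gradient is bounded by the step length. Such a sequence has finite
  length, hence converges, as soon as \<open>f\<close> satisfies a Lojasiewicz inequality on the box: for \<open>f x\<close>
  slightly above a value \<open>v\<close>,
  \<open>(f x - v)\<^sup>2\<^sup>-\<^sup>\<delta> \<le> h x\<close>, where \<open>h x = \<Sum>j. (x\<^sub>j - a\<^sub>j) (b\<^sub>j - x\<^sub>j) (\<partial>\<^sub>j f x)\<^sup>2\<close>.
  The weights make faces of the box superfluous: \<open>h\<close> is the squared gradient after the
  substitution \<open>x\<^sub>j = cos t\<^sub>j\<close> (for the cube).

  The inequality is proved without quantifier elimination. On a level \<open>f = r\<close> a minimizer of \<open>h\<close> is
  obtained as a limit of minimizers of penalty functions whose critical equations have the form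
  \<open>e\<^sup>2 x\<^sub>j\<^sup>M = lower order\<close>; linear algebra over the ring of polynomials in \<open>(r, e)\<close> eliminates all
  other variables, and after division by a power of \<open>e\<close> the limit \<open>e \<longlongrightarrow> 0\<close> shows that every coordinate
  of the minimizer is a root of a fixed bivariate polynomial at \<open>r\<close>. Hence the minimizers lie on
  finitely many curves with continuous monotone coordinates, so in the variable \<open>t\<close> on curves
  of finite length. Since \<open>f\<close> grows with unit speed along them, \<open>h \<le> C r\<^sup>2\<close> would force
  infinite length; and \<open>h\<close>, being algebraic over \<open>r\<close>, then exceeds some \<open>r\<^sup>2\<^sup>-\<^sup>\<delta>\<close>.
\<close>

section \<open>Elimination\<close>

text \<open>Only one point of each level set has to be understood, a minimizer of \<open>h\<close>,
  and the penalty is built so that linear algebra finds it. Its terms have three orders in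
  \<open>e\<close>: feasibility dominates, then \<open>e * H\<close>, and the term with
  \<open>e\<^sup>2\<close> is negligible in the limit. That last term has the even power
  \<open>2 * d + 2\<close>, hence a gradient of degree \<open>2 * d + 1\<close>, above the degree
  \<open>2 * d\<close> of the rest of the critical equations. High powers of each variable can thus
  be lowered, and finitely many monomials suffice whatever the singularities of the level set;
  Lagrange multipliers would demand a constraint qualification. The exponent
  \<open>2 - \<delta>\<close> is twice a gradient exponent \<open>1 - \<delta> / 2\<close> below
  \<open>1\<close>. At exponent \<open>1\<close>, a curve with \<open>f = r\<close> would be at
  least as long as a multiple of the integral of \<open>1 / r\<close>, which diverges at
  \<open>0\<close>, whereas monotone coordinates in a bounded range bound the length. The weights of
  \<open>h\<close> vanish at both ends of an edge, which is where the projection leaves the partial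
  derivative uncontrolled; so the step length bounds \<open>h\<close> on all faces alike.\<close>

lemma idom_vectors_dependent:
  fixes c :: "nat \<Rightarrow> nat \<Rightarrow> 'c::idom"
  shows "\<exists>d. (\<exists>k\<le>B. d k \<noteq> 0) \<and> (\<forall>a<B. (\<Sum>k\<le>B. d k * c k a) = 0)"
proof (induction B arbitrary: c)
  case 0
  show ?case by (rule exI[of _ "\<lambda>_. 1"]) simp
next
  case (Suc B)
  show ?case
  proof (cases "\<forall>k\<le>Suc B. c k B = 0")
    case True
    from Suc.IH[of c] obtain d where d: "\<exists>k\<le>B. d k \<noteq> 0"
      "\<forall>a<B. (\<Sum>k\<le>B. d k * c k a) = 0" by blast
    have "\<forall>a<Suc B. (\<Sum>k\<le>Suc B. (d(Suc B := 0)) k * c k a) = 0"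
      using d(2) True by (auto simp: less_Suc_eq)
    moreover have "\<exists>k\<le>Suc B. (d(Suc B := 0)) k \<noteq> 0"
      using d(1) by (metis Suc_n_not_le_n fun_upd_other le_SucI)
    ultimately show ?thesis by blast
  next
    case False
    \<comment> \<open>Fraction-free elimination: a vector with nonzero last entry is the pivot, and
      cross-multiplication clears the last entry of the others, as a domain allows no
      division.\<close>
    then obtain p where p: "p \<le> Suc B" "c p B \<noteq> 0" by auto
    \<comment> \<open>\<open>s\<close> enumerates the indices other than \<open>p\<close>;
      \<open>t\<close> below inverts it.\<close>
    define s where "s k = (if k < p then k else Suc k)" for k :: nat
    have s_bij: "bij_betw s {..B} ({..Suc B} - {p})"
    proof (rule bij_betwI[where g = "\<lambda>k. if k < p then k else k - 1"])
    qed (use p in \<open>auto simp: s_def split: if_splits\<close>)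
    from Suc.IH[of "\<lambda>k a. c p B * c (s k) a - c (s k) B * c p a"]
    obtain d where d: "\<exists>k\<le>B. d k \<noteq> 0"
      "\<forall>a<B. (\<Sum>k\<le>B. d k * (c p B * c (s k) a - c (s k) B * c p a)) = 0" by blast
    define t where "t k = (if k < p then k else k - 1)" for k :: nat
    have ts: "t (s k) = k" for k by (auto simp: t_def s_def)
    have sp: "s k \<noteq> p" for k by (auto simp: s_def)
    \<comment> \<open>The cross-multiplied relation expanded: the pivot collects all subtracted
      terms.\<close>
    define e where "e k = (if k = p then - (\<Sum>k\<le>B. d k * c (s k) B) else c p B * d (t k))" for k
    have sum_eq: "(\<Sum>k\<le>Suc B. e k * c k a) = (\<Sum>k\<le>B. d k * (c p B * c (s k) a - c (s k) B * c p a))" for a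
    proof -
      have "(\<Sum>k\<le>Suc B. e k * c k a) = e p * c p a + (\<Sum>k\<in>{..Suc B} - {p}. e k * c k a)"
        using p by (subst sum.remove[of _ p]) auto
      also have "(\<Sum>k\<in>{..Suc B} - {p}. e k * c k a) = (\<Sum>k\<le>B. e (s k) * c (s k) a)"
        using sum.reindex_bij_betw[OF s_bij, of "\<lambda>k. e k * c k a"] by simp
      also have "e p * c p a + (\<Sum>k\<le>B. e (s k) * c (s k) a)
          = (\<Sum>k\<le>B. d k * (c p B * c (s k) a - c (s k) B * c p a))"
        by (simp add: e_def sp ts sum_distrib_left sum_distrib_right sum_negf sum_subtractf algebra_simps)
      finally show ?thesis .
    qed
    have "\<forall>a<Suc B. (\<Sum>k\<le>Suc B. e k * c k a) = 0"
      unfolding sum_eq using d(2) by (auto simp: less_Suc_eq mult.commute)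
    moreover have "\<exists>k\<le>Suc B. e k \<noteq> 0"
    proof -
      from d(1) obtain k where k: "k \<le> B" "d k \<noteq> 0" by blast
      have "e (s k) \<noteq> 0" using k p by (simp add: e_def sp ts)
      moreover have "s k \<le> Suc B" using k by (auto simp: s_def)
      ultimately show ?thesis by blast
    qed
    ultimately show ?thesis by blast
  qed
qed

lemma idom_family_dependent:
  fixes c :: "nat \<Rightarrow> 'b \<Rightarrow> 'c::idom"
  assumes "finite L"
  shows "\<exists>d. (\<exists>k\<le>card L. d k \<noteq> 0) \<and> (\<forall>a\<in>L. (\<Sum>k\<le>card L. d k * c k a) = 0)"
proof -
  from ex_bij_betw_nat_finite[OF assms] obtain h where h: "bij_betw h {0..<card L} L" by blast
  from idom_vectors_dependent[of "card L" "\<lambda>k a. c k (h a)"] obtain d where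
    d: "\<exists>k\<le>card L. d k \<noteq> 0" "\<forall>a<card L. (\<Sum>k\<le>card L. d k * c k (h a)) = 0" by blast
  have "\<forall>a\<in>L. (\<Sum>k\<le>card L. d k * c k a) = 0"
  proof
    fix a assume "a \<in> L"
    then obtain i where "i < card L" "a = h i" using h by (force simp: bij_betw_def)
    with d(2) show "(\<Sum>k\<le>card L. d k * c k a) = 0" by simp
  qed
  with d(1) show ?thesis by blast
qed

text \<open>The coefficients stay formal and are evaluated at a sample point \<open>s\<close>; the
  unknowns \<open>X i\<close> are functions of \<open>s\<close>. A relation with nonzero formal
  coefficients then holds at all sample points at once. The ring is used once as polynomials in
  \<open>(r, e)\<close> and once as polynomials in \<open>r\<close>.\<close>

locale elimination =
  fixes ev :: "'c::idom \<Rightarrow> 's \<Rightarrow> real" and X :: "'i::finite \<Rightarrow> 's \<Rightarrow> real"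
  assumes ev_0 [simp]: "ev 0 s = 0" and ev_1 [simp]: "ev 1 s = 1"
    and ev_add: "ev (c + d) s = ev c s + ev d s"
    and ev_mult: "ev (c * d) s = ev c s * ev d s"
begin

lemma ev_sum: "ev (sum c A) s = (\<Sum>a\<in>A. ev (c a) s)"
  by (induction A rule: infinite_finite_induct) (auto simp: ev_add)

lemma ev_power: "ev (c ^ k) s = ev c s ^ k"
  by (induction k) (auto simp: ev_mult)

definition mon :: "('i \<Rightarrow> nat) \<Rightarrow> 's \<Rightarrow> real" where
  "mon a s = (\<Prod>i\<in>UNIV. X i s ^ a i)"

text \<open>The module spanned by the monomials with exponents in \<open>B\<close>, built term by
  term so that closure properties are plain inductions; explicit coefficients are recovered in
  \<open>Sp_coeffs\<close> for finite \<open>B\<close>.\<close>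

inductive_set Sp :: "('i \<Rightarrow> nat) set \<Rightarrow> ('s \<Rightarrow> real) set" for B where
  Sp_0: "(\<lambda>s. 0) \<in> Sp B"
| Sp_step: "a \<in> B \<Longrightarrow> F \<in> Sp B \<Longrightarrow> (\<lambda>s. ev c s * mon a s + F s) \<in> Sp B"

lemma Sp_add: "F \<in> Sp B \<Longrightarrow> G \<in> Sp B \<Longrightarrow> (\<lambda>s. F s + G s) \<in> Sp B"
proof (induction rule: Sp.induct)
  case (Sp_step a F c)
  then have "(\<lambda>s. ev c s * mon a s + (F s + G s)) \<in> Sp B" by (intro Sp.Sp_step) auto
  then show ?case by (simp add: add.assoc)
qed auto

lemma Sp_scale: "F \<in> Sp B \<Longrightarrow> (\<lambda>s. ev c s * F s) \<in> Sp B"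
proof (induction rule: Sp.induct)
  case Sp_0
  show ?case by (simp add: Sp.Sp_0)
next
  case (Sp_step a F d)
  then have "(\<lambda>s. ev (c * d) s * mon a s + ev c s * F s) \<in> Sp B" by (intro Sp.Sp_step) auto
  then show ?case by (simp add: ev_mult algebra_simps)
qed

lemma Sp_mono: "F \<in> Sp B \<Longrightarrow> B \<subseteq> B' \<Longrightarrow> F \<in> Sp B'"
  by (induction rule: Sp.induct) (auto intro: Sp.intros)

lemma Sp_mon: "a \<in> B \<Longrightarrow> mon a \<in> Sp B"
  using Sp_step[of a B "\<lambda>s. 0" 1] Sp_0 by simp

lemma mon_add: "mon (\<lambda>i. a i + b i) s = mon a s * mon b s"
  by (simp add: mon_def power_add prod.distrib)

lemma Sp_mult_mon:
  assumes "F \<in> Sp B" "\<And>b. b \<in> B \<Longrightarrow> (\<lambda>i. a i + b i) \<in> B'"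
  shows "(\<lambda>s. mon a s * F s) \<in> Sp B'"
  using assms(1)
proof (induction rule: Sp.induct)
  case (Sp_step b F c)
  then have "(\<lambda>s. ev c s * mon (\<lambda>i. a i + b i) s + mon a s * F s) \<in> Sp B'"
    by (intro Sp.Sp_step assms(2)) auto
  then show ?case by (simp add: mon_add algebra_simps)
qed (simp add: Sp.Sp_0)

definition Mons :: "nat \<Rightarrow> ('i \<Rightarrow> nat) set" where
  "Mons d = {a. sum a UNIV \<le> d}"

lemma Mons_mono: "d \<le> e \<Longrightarrow> Mons d \<subseteq> Mons e"
  by (auto simp: Mons_def)

lemma Sp_mult:
  assumes "F \<in> Sp (Mons d)" "G \<in> Sp (Mons e)"
  shows "(\<lambda>s. F s * G s) \<in> Sp (Mons (d + e))"
  using assms(1)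
proof (induction rule: Sp.induct)
  case Sp_0
  show ?case by (simp add: Sp.Sp_0)
next
  case (Sp_step a F c)
  have "(\<lambda>s. ev c s * (mon a s * G s)) \<in> Sp (Mons (d + e))"
    using Sp_step by (intro Sp_scale Sp_mult_mon[OF assms(2)]) (auto simp: Mons_def sum.distrib)
  from Sp_add[OF this Sp_step.IH] show ?case by (simp add: algebra_simps)
qed

lemma Sp_const: "ev c \<in> Sp (Mons d)"
  using Sp_step[of "\<lambda>_. 0" "Mons d" "\<lambda>s. 0" c] Sp_0 by (simp add: mon_def Mons_def)

lemma Sp_var: "1 \<le> d \<Longrightarrow> X i \<in> Sp (Mons d)"
proof -
  assume "1 \<le> d"
  have "mon (\<lambda>j. if j = i then 1 else 0) = X i"
  proof
    fix s
    have "mon (\<lambda>j. if j = i then 1 else 0) s = (\<Prod>j\<in>UNIV. if j = i then X j s else 1)"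
      unfolding mon_def by (rule prod.cong) auto
    then show "mon (\<lambda>j. if j = i then 1 else 0) s = X i s" by simp
  qed
  with Sp_mon[of "\<lambda>j. if j = i then 1 else 0" "Mons d"] \<open>1 \<le> d\<close> show ?thesis
    by (simp add: Mons_def)
qed

lemma Sp_power: "F \<in> Sp (Mons d) \<Longrightarrow> (\<lambda>s. F s ^ k) \<in> Sp (Mons (k * d))"
proof (induction k)
  case 0
  have "ev 1 \<in> Sp (Mons 0)" by (rule Sp_const)
  moreover have "ev 1 = (\<lambda>s. 1)" by (rule ext) simp
  ultimately show ?case by simp
next
  case (Suc k)
  then show ?case using Sp_mult[of F d "\<lambda>s. F s ^ k" "k * d"] by simp
qed

lemma Sp_coeffs:
  assumes "F \<in> Sp B" "finite B"
  shows "\<exists>c. \<forall>s. F s = (\<Sum>a\<in>B. ev (c a) s * mon a s)"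
  using assms(1)
proof (induction rule: Sp.induct)
  case Sp_0
  show ?case by (rule exI[of _ "\<lambda>_. 0"]) simp
next
  case (Sp_step a F e)
  then obtain c where c: "\<And>s. F s = (\<Sum>a\<in>B. ev (c a) s * mon a s)" by blast
  show ?case
  proof (intro exI allI)
    fix s
    have "(\<Sum>b\<in>B. ev ((c(a := e + c a)) b) s * mon b s)
        = (\<Sum>b\<in>B. (if b = a then ev e s * mon a s else 0) + ev (c b) s * mon b s)"
      by (rule sum.cong) (auto simp: ev_add algebra_simps)
    also have "\<dots> = ev e s * mon a s + F s"
      using Sp_step assms(2) by (simp add: sum.distrib c)
    finally show "ev e s * mon a s + F s = (\<Sum>b\<in>B. ev ((c(a := e + c a)) b) s * mon b s)" by simp
  qed
qed

text \<open>A monomial outside the low range contains some \<open>X i ^ M\<close>; one factor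
  \<open>l\<close> exchanges this power for \<open>q i\<close>, which has smaller degree. Induction
  on the total degree therefore ends with all exponents below \<open>M\<close>.\<close>

lemma reduce_to_low:
  fixes l :: 'c
  assumes q: "\<And>i. q i \<in> Sp (Mons (M - 1))" and M: "M \<ge> 1"
    and rel: "\<And>i s. s \<in> S \<Longrightarrow> ev l s * X i s ^ M = q i s"
  shows "F \<in> Sp (Mons d) \<Longrightarrow> \<exists>k. \<exists>G\<in>Sp {a. \<forall>i. a i < M}. \<forall>s\<in>S. ev l s ^ k * F s = G s"
proof (induction d arbitrary: F rule: less_induct)
  case (less d)
  let ?Low = "{a. \<forall>i. a i < M} :: ('i \<Rightarrow> nat) set"
  have monomial: "\<exists>k. \<exists>G\<in>Sp ?Low. \<forall>s\<in>S. ev l s ^ k * mon a s = G s" if a: "a \<in> Mons d" for a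
  proof (cases "a \<in> ?Low")
    case True
    then show ?thesis by (intro exI[of _ 0] bexI[of _ "mon a"]) (auto simp: Sp_mon)
  next
    case False
    then obtain i where i: "M \<le> a i" by (auto simp: not_less)
    define a' where "a' = a(i := a i - M)"
    define m where "m = (\<lambda>j. if j = i then M else 0)"
    have a_split: "a = (\<lambda>j. m j + a' j)" using i by (auto simp: a'_def m_def)
    have sum_a: "sum a UNIV = M + sum a' UNIV"
      by (subst a_split) (simp add: sum.distrib m_def)
    have d: "d \<ge> M" and a'd: "a' \<in> Mons (d - M)" using a sum_a by (auto simp: Mons_def)
    have mon_m: "mon m s = X i s ^ M" for s
    proof -
      have "mon m s = (\<Prod>j\<in>UNIV. if j = i then X j s ^ M else 1)"
        unfolding mon_def m_def by (rule prod.cong) auto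
      then show ?thesis by simp
    qed
    \<comment> \<open>The exchange costs a degree: \<open>(M - 1) + (d - M) = d - 1\<close>.\<close>
    have "(\<lambda>s. q i s * mon a' s) \<in> Sp (Mons ((M - 1) + (d - M)))"
      by (intro Sp_mult q Sp_mon a'd)
    moreover have "(M - 1) + (d - M) < d" using d M by simp
    ultimately obtain k G where G: "G \<in> Sp ?Low"
        "\<forall>s\<in>S. ev l s ^ k * (q i s * mon a' s) = G s"
      using less.IH by blast
    have "\<forall>s\<in>S. ev l s ^ Suc k * mon a s = G s"
    proof
      fix s assume s: "s \<in> S"
      have "ev l s ^ Suc k * mon a s = ev l s ^ k * ((ev l s * X i s ^ M) * mon a' s)"
        by (subst a_split) (simp add: mon_add mon_m)
      also have "\<dots> = G s" using G(2) s rel by simp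
      finally show "ev l s ^ Suc k * mon a s = G s" .
    qed
    with G(1) show ?thesis by blast
  qed
  from less.prems show ?case
  proof (induction rule: Sp.induct)
    case Sp_0
    show ?case by (intro exI[of _ 0] bexI[of _ "\<lambda>_. 0"]) (auto simp: Sp.Sp_0)
  next
    case (Sp_step a F c)
    from monomial[OF Sp_step.hyps(1)] obtain k1 G1 where 1: "G1 \<in> Sp ?Low"
      "\<And>s. s \<in> S \<Longrightarrow> ev l s ^ k1 * mon a s = G1 s" by blast
    from Sp_step.IH obtain k2 G2 where 2: "G2 \<in> Sp ?Low"
      "\<And>s. s \<in> S \<Longrightarrow> ev l s ^ k2 * F s = G2 s" by blast
    have "(\<lambda>s. ev (l ^ k2 * c) s * G1 s + ev (l ^ k1) s * G2 s) \<in> Sp ?Low"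
      by (intro Sp_add Sp_scale 1 2)
    moreover have "\<forall>s\<in>S. ev l s ^ (k1 + k2) * (ev c s * mon a s + F s)
        = ev (l ^ k2 * c) s * G1 s + ev (l ^ k1) s * G2 s"
      by (simp add: 1(2)[symmetric] 2(2)[symmetric] ev_mult ev_power power_add algebra_simps)
    ultimately show ?case by (intro exI[of _ "k1 + k2"] bexI)
  qed
qed

text \<open>Up to powers of \<open>l\<close>, all powers of \<open>F\<close> lie in the span of the
  finitely many low monomials, so one more power than there are low monomials must be dependent over
  the ring.\<close>

theorem eliminate:
  fixes l :: 'c
  assumes q: "\<And>i. q i \<in> Sp (Mons (M - 1))" and M: "M \<ge> 1"
    and rel: "\<And>i s. s \<in> S \<Longrightarrow> ev l s * X i s ^ M = q i s"
    and F: "F \<in> Sp (Mons d)"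
  obtains B :: nat and c :: "nat \<Rightarrow> 'c" where "\<exists>k\<le>B. c k \<noteq> 0"
    "\<And>s. s \<in> S \<Longrightarrow> ev l s \<noteq> 0 \<Longrightarrow> (\<Sum>k\<le>B. ev (c k) s * F s ^ k) = 0"
proof -
  let ?Low = "{a. \<forall>i. a i < M} :: ('i \<Rightarrow> nat) set"
  have "?Low = Pi UNIV (\<lambda>_. {..<M})" by (auto simp: Pi_def)
  then have fin: "finite ?Low"
    using finite_PiE[of "UNIV :: 'i set" "\<lambda>_. {..<M}"] by (simp add: PiE_UNIV_domain)
  have "\<forall>k. \<exists>p. \<forall>s\<in>S. ev l s ^ fst p * F s ^ k = (\<Sum>a\<in>?Low. ev (snd p a) s * mon a s)"
  proof
    fix k
    from reduce_to_low[OF q M rel Sp_power[OF F, of k]] obtain e G where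
      G: "G \<in> Sp ?Low" "\<forall>s\<in>S. ev l s ^ e * F s ^ k = G s" by blast
    from Sp_coeffs[OF G(1) fin] obtain b where "\<forall>s. G s = (\<Sum>a\<in>?Low. ev (b a) s * mon a s)" by blast
    with G(2) show "\<exists>p. \<forall>s\<in>S. ev l s ^ fst p * F s ^ k = (\<Sum>a\<in>?Low. ev (snd p a) s * mon a s)"
      by (intro exI[of _ "(e, b)"]) simp
  qed
  from choice[OF this] obtain p where p: "\<And>k s. s \<in> S \<Longrightarrow>
      ev l s ^ fst (p k) * F s ^ k = (\<Sum>a\<in>?Low. ev (snd (p k) a) s * mon a s)" by blast
  define e b where "e = fst \<circ> p" and "b = snd \<circ> p"
  have eb: "\<And>k s. s \<in> S \<Longrightarrow>
      ev l s ^ e k * F s ^ k = (\<Sum>a\<in>?Low. ev (b k a) s * mon a s)"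
    using p by (simp add: e_def b_def)
  define B where "B = card ?Low"
  \<comment> \<open>The representations of \<open>F ^ k\<close> carry different powers of
    \<open>l\<close>; the factors \<open>l ^ (E - e k)\<close> raise them to the common power
    \<open>E\<close>, which is cancelled at the end.\<close>
  define E where "E = (\<Sum>k\<le>B. e k)"
  have eE: "e k \<le> E" if "k \<le> B" for k
    unfolding E_def by (rule member_le_sum) (use that in auto)
  from idom_family_dependent[OF fin, of "\<lambda>k a. l ^ (E - e k) * b k a"] obtain c where
    c: "\<exists>k\<le>B. c k \<noteq> 0" "\<And>a. a \<in> ?Low \<Longrightarrow> (\<Sum>k\<le>B. c k * (l ^ (E - e k) * b k a)) = 0"
    unfolding B_def by blast
  have "(\<Sum>k\<le>B. ev (c k) s * F s ^ k) = 0" if s: "s \<in> S" and l: "ev l s \<noteq> 0" for s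
  proof -
    have "ev l s ^ E * (\<Sum>k\<le>B. ev (c k) s * F s ^ k)
        = (\<Sum>k\<le>B. ev (c k) s * ev l s ^ (E - e k) * (ev l s ^ e k * F s ^ k))"
      unfolding sum_distrib_left
    proof (rule sum.cong[OF refl])
      fix k assume "k \<in> {..B}"
      then have "ev l s ^ E = ev l s ^ (E - e k) * ev l s ^ e k"
        using eE by (simp add: power_add[symmetric])
      then show "ev l s ^ E * (ev (c k) s * F s ^ k)
          = ev (c k) s * ev l s ^ (E - e k) * (ev l s ^ e k * F s ^ k)" by simp
    qed
    also have "\<dots> = (\<Sum>k\<le>B. \<Sum>a\<in>?Low. ev (c k * (l ^ (E - e k) * b k a)) s * mon a s)"
      by (simp add: eb[OF s] sum_distrib_left ev_mult ev_power mult.assoc)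
    also have "\<dots> = (\<Sum>a\<in>?Low. ev (\<Sum>k\<le>B. c k * (l ^ (E - e k) * b k a)) s * mon a s)"
      by (subst sum.swap) (simp add: ev_sum sum_distrib_right)
    also have "\<dots> = 0" using c(2) by simp
    finally show ?thesis using l by simp
  qed
  with c(1) that show thesis by blast
qed

end

section \<open>Algebraic minimizers\<close>

text \<open>A bivariate polynomial is a polynomial in \<open>y\<close> whose coefficients are polynomials in \<open>r\<close>;
  \<open>bev R y r\<close> is its value.\<close>

definition bev :: "real poly poly \<Rightarrow> real \<Rightarrow> real \<Rightarrow> real" where
  "bev R y r = poly (poly R [:y:]) r"

lemma bev_0 [simp]: "bev 0 y r = 0"
  and bev_1 [simp]: "bev 1 y r = 1"
  and bev_add [simp]: "bev (R + S) y r = bev R y r + bev S y r"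
  and bev_mult [simp]: "bev (R * S) y r = bev R y r * bev S y r"
  and bev_pCons [simp]: "bev (pCons c R) y r = poly c r + y * bev R y r"
  by (simp_all add: bev_def)

lemma bev_altdef: "bev R y r = (\<Sum>k\<le>degree R. poly (coeff R k) r * y ^ k)"
  by (simp add: bev_def poly_altdef[of R] poly_sum)

lemma bev_sum: "bev (\<Sum>a\<in>A. R a) y r = (\<Sum>a\<in>A. bev (R a) y r)"
  by (simp add: bev_def poly_sum)

lemma bev_monom: "bev (monom c k) y r = poly c r * y ^ k"
  by (simp add: bev_def poly_monom)

lemma tendsto_bev [tendsto_intros]:
  assumes "(f \<longlongrightarrow> y) F" "(g \<longlongrightarrow> r) F"
  shows "((\<lambda>x. bev R (f x) (g x)) \<longlongrightarrow> bev R y r) F"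
  unfolding bev_altdef by (intro tendsto_intros assms)

lemma continuous_on_bev [continuous_intros]:
  assumes "continuous_on S f" "continuous_on S g"
  shows "continuous_on S (\<lambda>x. bev R (f x) (g x))"
  using assms by (auto simp: continuous_on_def intro!: tendsto_intros)

text \<open>Removing the largest common power of the variable keeps a relation nontrivial when the
  variable is afterwards set to \<open>0\<close>.\<close>

lemma poly_family_divide_X:
  fixes c :: "nat \<Rightarrow> 'a::idom poly"
  assumes "\<exists>k\<le>B. c k \<noteq> 0"
  shows "\<exists>t e. (\<forall>k\<le>B. c k = monom 1 t * e k) \<and> (\<exists>k\<le>B. coeff (e k) 0 \<noteq> 0)"
proof -
  define P where "P t \<longleftrightarrow> (\<exists>k\<le>B. coeff (c k) t \<noteq> 0)" for t
  define t where "t = (LEAST t. P t)"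
  have "\<exists>t. P t" using assms unfolding P_def by (metis poly_eqI coeff_0)
  then have t: "P t" and least: "\<And>u. u < t \<Longrightarrow> \<not> P u"
    unfolding t_def by (auto intro: LeastI dest: not_less_Least)
  have 1: "c k = monom 1 t * poly_shift t (c k)" if "k \<le> B" for k
    using least that by (intro poly_eqI) (auto simp: coeff_monom_mult coeff_poly_shift P_def)
  have 2: "\<exists>k\<le>B. coeff (poly_shift t (c k)) 0 \<noteq> 0"
    using t by (simp add: P_def coeff_poly_shift)
  show ?thesis by (rule exI[of _ t], rule exI[of _ "\<lambda>k. poly_shift t (c k)"]) (use 1 2 in auto)
qed

section \<open>Polynomial functions: closure properties, gradients, continuity\<close>

lemma polyfun_const [intro]: "polyfun (\<lambda>x. c)"
  and polyfun_var [intro]: "polyfun (\<lambda>x. x $ j)"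
  unfolding polyfun_def by (blast intro: poly_deg_le.intros)+

lemma polyfun_add [intro]:
  assumes "polyfun f" "polyfun g" shows "polyfun (\<lambda>x. f x + g x)"
proof -
  obtain d e where "poly_deg_le d f" "poly_deg_le e g" using assms by (auto simp: polyfun_def)
  then have "poly_deg_le (d + e) f" "poly_deg_le (d + e) g" by (auto intro: pmono)
  from padd[OF this] show ?thesis by (auto simp: polyfun_def)
qed

lemma polyfun_mult [intro]: "polyfun f \<Longrightarrow> polyfun g \<Longrightarrow> polyfun (\<lambda>x. f x * g x)"
  unfolding polyfun_def by (blast intro: poly_deg_le.intros)

lemma polyfun_diff [intro]:
  assumes "polyfun f" "polyfun g" shows "polyfun (\<lambda>x. f x - g x)"
  using polyfun_add[OF assms(1) polyfun_mult[OF polyfun_const[of "-1"] assms(2)]] by simp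

lemma polyfun_power [intro]: "polyfun f \<Longrightarrow> polyfun (\<lambda>x. f x ^ k)"
  by (induction k) auto

lemma polyfun_sum [intro]: "(\<And>a. a \<in> A \<Longrightarrow> polyfun (f a)) \<Longrightarrow> polyfun (\<lambda>x. \<Sum>a\<in>A. f a x)"
  by (induction A rule: infinite_finite_induct) auto

lemma polyfun_induct [consumes 1, case_names const var add mult]:
  assumes "polyfun f"
    and "\<And>c. Q (\<lambda>x. c)" and "\<And>j. Q (\<lambda>x. x $ j)"
    and "\<And>f g. polyfun f \<Longrightarrow> polyfun g \<Longrightarrow> Q f \<Longrightarrow> Q g \<Longrightarrow> Q (\<lambda>x. f x + g x)"
    and "\<And>f g. polyfun f \<Longrightarrow> polyfun g \<Longrightarrow> Q f \<Longrightarrow> Q g \<Longrightarrow> Q (\<lambda>x. f x * g x)"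
  shows "Q f"
proof -
  obtain d where "poly_deg_le d f" using assms(1) by (auto simp: polyfun_def)
  then show ?thesis
  proof (induction rule: poly_deg_le.induct)
    case (padd d f g)
    then show ?case by (intro assms(4)) (auto simp: polyfun_def)
  next
    case (pmul d1 f d2 g)
    then show ?case by (intro assms(5)) (auto simp: polyfun_def)
  qed (use assms(2,3) in auto)
qed

lemma polyfun_compose:
  assumes "polyfun f" "\<And>j. polyfun (\<lambda>x. g x $ j)"
  shows "polyfun (\<lambda>x. f (g x))"
  using assms(1) by (induction rule: polyfun_induct) (auto intro: assms(2))

lemma GDERIV_nth: "GDERIV (\<lambda>x. x $ j) x :> axis j 1"
  unfolding gderiv_def by (simp add: inner_axis bounded_linear_imp_has_derivative[OF bounded_linear_vec_nth])

lemma polyfun_GDERIV: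
  fixes f :: "real^'n \<Rightarrow> real"
  assumes "polyfun f"
  shows "\<exists>D. (\<forall>x. GDERIV f x :> D x) \<and> (\<forall>j. polyfun (\<lambda>x. D x $ j))"
  using assms
proof (induction rule: polyfun_induct)
  case (const c)
  show ?case by (rule exI[of _ "\<lambda>x. 0"]) (auto intro: GDERIV_const)
next
  case (var j)
  show ?case by (rule exI[of _ "\<lambda>x. axis j 1"]) (auto intro: GDERIV_nth)
next
  case (add f g)
  then obtain Df Dg where "\<forall>x. GDERIV f x :> Df x" "\<forall>j. polyfun (\<lambda>x. Df x $ j)"
    "\<forall>x. GDERIV g x :> Dg x" "\<forall>j. polyfun (\<lambda>x. Dg x $ j)" by blast
  then show ?case by (intro exI[of _ "\<lambda>x. Df x + Dg x"]) (auto intro: GDERIV_add)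
next
  case (mult f g)
  then obtain Df Dg where "\<forall>x. GDERIV f x :> Df x" "\<forall>j. polyfun (\<lambda>x. Df x $ j)"
    "\<forall>x. GDERIV g x :> Dg x" "\<forall>j. polyfun (\<lambda>x. Dg x $ j)" by blast
  with mult show ?case
    by (intro exI[of _ "\<lambda>x. f x *\<^sub>R Dg x + g x *\<^sub>R Df x"]) (auto intro!: GDERIV_mult polyfun_add polyfun_mult)
qed

lemma GDERIV_continuous_on:
  assumes "\<And>x. GDERIV f x :> D x"
  shows "continuous_on S f"
  using assms unfolding gderiv_def
  by (meson continuous_at_imp_continuous_on has_derivative_continuous)

lemma polyfun_continuous_on: "polyfun f \<Longrightarrow> continuous_on S f"
  using polyfun_GDERIV GDERIV_continuous_on by metis

lemma polyfun_continuous_on_compose [continuous_intros]: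
  "polyfun f \<Longrightarrow> continuous_on S g \<Longrightarrow> continuous_on S (\<lambda>x. f (g x))"
  using continuous_on_compose2[OF polyfun_continuous_on[of f UNIV]] by auto

lemma tendsto_polyfun:
  "polyfun f \<Longrightarrow> (g \<longlongrightarrow> l) F \<Longrightarrow> ((\<lambda>x. f (g x)) \<longlongrightarrow> f l) F"
  using polyfun_continuous_on[of f UNIV] continuous_on_tendsto_compose[of UNIV f g l F] by auto

lemma polyfun_uniform_degree:
  assumes "finite A" "\<And>a. a \<in> A \<Longrightarrow> polyfun (f a)"
  shows "\<exists>d. \<forall>a\<in>A. poly_deg_le d (f a)"
proof -
  from assms(2) obtain d where d: "\<And>a. a \<in> A \<Longrightarrow> poly_deg_le (d a) (f a)"
    unfolding polyfun_def by metis
  have "poly_deg_le (\<Sum>a\<in>A. d a) (f a)" if "a \<in> A" for a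
    using pmono[OF d[OF that]] member_le_sum[OF that, of d] assms(1) by auto
  then show ?thesis by blast
qed

text \<open>\<open>scalars\<close> says that real constants are values of ring elements; it turns a
  polynomial function of the unknowns into an element of the span with the same degree
  bound.\<close>

lemma (in elimination) Sp_poly_deg_le:
  fixes f :: "real^'i \<Rightarrow> real"
  assumes "poly_deg_le d f" and scalars: "\<And>c. \<exists>e. \<forall>s. ev e s = c"
  shows "(\<lambda>s. f (\<chi> i. X i s)) \<in> Sp (Mons d)"
  using assms(1)
proof (induction rule: poly_deg_le.induct)
  case (pconst d c)
  from scalars[of c] obtain e where "ev e = (\<lambda>s. c)" by auto
  then show ?case using Sp_const[of e d] by simp
next
  case (pvar d j)
  then show ?case using Sp_var[of d j] by simp
next
  case (pmono d f e)
  then show ?case using Sp_mono Mons_mono by blast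
qed (auto intro: Sp_add Sp_mult)

section \<open>Penalty minimizers and their limits\<close>

text \<open>The even power makes the penalty coercive, because its other terms are nonnegative; so a
  global minimizer exists. The equations are the vanishing gradient, solved for the highest power of
  each coordinate.\<close>

lemma penalty_minimizer:
  fixes F G H :: "real^'m \<Rightarrow> real"
  assumes F: "\<And>x. GDERIV F x :> DF x" and G: "\<And>x. GDERIV G x :> DG x"
    and H: "\<And>x. GDERIV H x :> DH x"
    and nonneg: "\<And>x. 0 \<le> G x" "\<And>x. 0 \<le> H x" and e: "e > 0"
  obtains x where
    "\<And>y. e * H x + (F x - r)\<^sup>2 + G x + e\<^sup>2 * (\<Sum>j\<in>UNIV. (x $ j) ^ (2 * Suc d))
      \<le> e * H y + (F y - r)\<^sup>2 + G y + e\<^sup>2 * (\<Sum>j\<in>UNIV. (y $ j) ^ (2 * Suc d))"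
    "\<And>j. e\<^sup>2 * real (2 * Suc d) * (x $ j) ^ (2 * d + 1)
      = - (e * DH x $ j + 2 * (F x - r) * DF x $ j + DG x $ j)"
proof -
  define T where "T x = (\<Sum>j\<in>UNIV. (x $ j) ^ (2 * Suc d))" for x :: "real^'m"
  define \<Psi> where "\<Psi> x = e * H x + (F x - r)\<^sup>2 + G x + e\<^sup>2 * T x" for x
  have cont: "continuous_on S \<Psi>" for S
    unfolding \<Psi>_def T_def by (intro continuous_intros GDERIV_continuous_on[OF F]
        GDERIV_continuous_on[OF G] GDERIV_continuous_on[OF H])
  have pow_nonneg: "0 \<le> (t::real) ^ (2 * Suc d)" for t
    by (rule zero_le_even_power) simp
  have T_nonneg: "0 \<le> T x" for x
    unfolding T_def by (intro sum_nonneg pow_nonneg)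
  let ?K = "{x. \<Psi> x \<le> \<Psi> 0}"
  have "bounded ?K"
  proof (rule boundedI)
    fix x assume "x \<in> ?K"
    then have "\<Psi> x \<le> \<Psi> 0" by simp
    moreover have "0 \<le> e * H x" "0 \<le> (F x - r)\<^sup>2" "0 \<le> G x" using nonneg e by simp_all
    ultimately have "e\<^sup>2 * T x \<le> \<Psi> 0" unfolding \<Psi>_def[of x] by linarith
    then have sum_le: "T x \<le> \<Psi> 0 / e\<^sup>2"
      using e by (simp add: field_simps)
    \<comment> \<open>A coordinate of modulus above \<open>1\<close> is at most its even power;
      adding \<open>1\<close> covers the other coordinates.\<close>
    have comp: "\<bar>x $ j\<bar> \<le> 1 + \<Psi> 0 / e\<^sup>2" for j
    proof (cases "\<bar>x $ j\<bar> \<le> 1")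
      case True
      have "0 \<le> \<Psi> 0 / e\<^sup>2" using sum_le T_nonneg[of x] by linarith
      with True show ?thesis by linarith
    next
      case False
      then have "\<bar>x $ j\<bar> ^ 1 \<le> \<bar>x $ j\<bar> ^ (2 * Suc d)" by (intro power_increasing) auto
      also have "\<dots> = (x $ j) ^ (2 * Suc d)" by (rule power_even_abs) simp
      also have "\<dots> \<le> T x"
        unfolding T_def by (rule member_le_sum) (use pow_nonneg in auto)
      finally have "\<bar>x $ j\<bar> \<le> T x" by simp
      with sum_le show ?thesis by linarith
    qed
    have "norm x \<le> (\<Sum>j\<in>UNIV. \<bar>x $ j\<bar>)" by (rule norm_le_l1_cart)
    also have "\<dots> \<le> (\<Sum>j\<in>(UNIV::'m set). 1 + \<Psi> 0 / e\<^sup>2)" by (intro sum_mono comp)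
    finally show "norm x \<le> (\<Sum>j\<in>(UNIV::'m set). 1 + \<Psi> 0 / e\<^sup>2)" .
  qed
  moreover have "closed ?K"
    by (intro closed_Collect_le cont continuous_intros)
  ultimately have "compact ?K" by (simp add: compact_eq_bounded_closed)
  moreover have "?K \<noteq> {}" by blast
  ultimately obtain x where x: "x \<in> ?K" "\<And>y. y \<in> ?K \<Longrightarrow> \<Psi> x \<le> \<Psi> y"
    using continuous_attains_inf[of ?K \<Psi>] cont by blast
  have min: "\<Psi> x \<le> \<Psi> y" for y
  proof (cases "y \<in> ?K")
    case False
    then have "\<Psi> 0 < \<Psi> y" by simp
    moreover have "\<Psi> x \<le> \<Psi> 0" using x(1) by simp
    ultimately show ?thesis by linarith
  qed (rule x(2))
  define D where "D = e *\<^sub>R DH x + (2 * (F x - r)) *\<^sub>R DF x + DG x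
      + (\<chi> j. e\<^sup>2 * (real (2 * Suc d) * (x $ j) ^ (2 * d + 1)))"
  have T: "(T has_derivative (\<lambda>h. \<Sum>j\<in>UNIV. real (2 * Suc d) * (x $ j) ^ (2 * d + 1) * h $ j)) (at x)"
    unfolding T_def
  proof (intro has_derivative_sum)
    fix j :: 'm
    have "((\<lambda>x. x $ j) has_derivative (\<lambda>h. h $ j)) (at x)"
      by (rule bounded_linear_imp_has_derivative[OF bounded_linear_vec_nth])
    from has_derivative_power[OF this, of "2 * Suc d"]
    have "((\<lambda>x. (x $ j) ^ (2 * Suc d)) has_derivative
        (\<lambda>h. real (2 * Suc d) * h $ j * (x $ j) ^ (2 * Suc d - 1))) (at x)" .
    moreover have "2 * Suc d - 1 = 2 * d + 1" by simp
    ultimately show "((\<lambda>x. (x $ j) ^ (2 * Suc d)) has_derivative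
        (\<lambda>h. real (2 * Suc d) * (x $ j) ^ (2 * d + 1) * h $ j)) (at x)"
      by (simp only: mult_ac)
  qed
  have F2: "((\<lambda>x. (F x - r)\<^sup>2) has_derivative (\<lambda>h. 2 * (F x - r) * (h \<bullet> DF x))) (at x)"
    using has_derivative_power[OF has_derivative_diff[OF F[of x, unfolded gderiv_def]
          has_derivative_const[of r]], of 2]
    by (simp add: algebra_simps)
  have "(\<Psi> has_derivative (\<lambda>h. e * (h \<bullet> DH x) + 2 * (F x - r) * (h \<bullet> DF x) + h \<bullet> DG x
      + e\<^sup>2 * (\<Sum>j\<in>UNIV. real (2 * Suc d) * (x $ j) ^ (2 * d + 1) * h $ j))) (at x)"
    unfolding \<Psi>_def
    by (rule has_derivative_add[OF has_derivative_add[OF has_derivative_add[OF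
            has_derivative_mult_right[OF H[unfolded gderiv_def]] F2] G[unfolded gderiv_def]]
          has_derivative_mult_right[OF T]])
  also have "(\<lambda>h. e * (h \<bullet> DH x) + 2 * (F x - r) * (h \<bullet> DF x) + h \<bullet> DG x
      + e\<^sup>2 * (\<Sum>j\<in>UNIV. real (2 * Suc d) * (x $ j) ^ (2 * d + 1) * h $ j)) = (\<lambda>h. h \<bullet> D)"
    by (simp add: D_def fun_eq_iff inner_add_right inner_vec_def[of _ "vec_lambda _"] sum_distrib_left mult_ac)
  finally have "(\<Psi> has_derivative (\<lambda>h. h \<bullet> D)) (at x)" .
  then have "(\<lambda>h. h \<bullet> D) = (\<lambda>h. 0)"
    by (intro differential_zero_maxmin[of x UNIV \<Psi>]) (use min in simp_all)
  from fun_cong[OF this, of D] have "D = 0" by simp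
  then have "D $ j = 0" for j by simp
  then have D0: "e * DH x $ j + 2 * (F x - r) * DF x $ j + DG x $ j
      + e\<^sup>2 * (real (2 * Suc d) * (x $ j) ^ (2 * d + 1)) = 0" for j
    unfolding D_def vector_add_component vector_scaleR_component vec_lambda_beta real_scaleR_def .
  have "e\<^sup>2 * real (2 * Suc d) * (x $ j) ^ (2 * d + 1)
      = - (e * DH x $ j + 2 * (F x - r) * DF x $ j + DG x $ j)" for j
    using D0[of j] unfolding mult.assoc by linarith
  moreover have "e * H x + (F x - r)\<^sup>2 + G x + e\<^sup>2 * (\<Sum>j\<in>UNIV. (x $ j) ^ (2 * Suc d))
      \<le> e * H y + (F y - r)\<^sup>2 + G y + e\<^sup>2 * (\<Sum>j\<in>UNIV. (y $ j) ^ (2 * Suc d))" for y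
    using min[of y] unfolding \<Psi>_def T_def .
  ultimately show thesis using that by blast
qed

text \<open>Penalty minimizers for \<open>e\<close> tending to \<open>0\<close> stay in a compact
  set, and a limit point is feasible and minimizes \<open>H\<close>. Their coordinates satisfy one
  relation with coefficients in \<open>(r, e)\<close>; divided by a power of \<open>e\<close> it
  survives the limit. Since \<open>r\<close> stays formal, \<open>R\<close> does not depend on the
  level.\<close>

theorem algebraic_minimizer:
  fixes F G H :: "real^'m \<Rightarrow> real"
  assumes poly: "polyfun F" "polyfun G" "polyfun H"
    and nonneg: "\<And>x. 0 \<le> G x" "\<And>x. 0 \<le> H x"
    and bdd: "bounded {x. G x \<le> 1}"
  obtains R :: "'m \<Rightarrow> real poly poly" where "\<And>j. R j \<noteq> 0"
    "\<And>r x0. F x0 = r \<Longrightarrow> G x0 = 0 \<Longrightarrow> \<exists>x. F x = r \<and> G x = 0 \<and> (\<forall>j. bev (R j) (x $ j) r = 0) \<and>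
      (\<forall>x'. F x' = r \<longrightarrow> G x' = 0 \<longrightarrow> H x \<le> H x')"
proof -
  obtain DF where DF: "\<And>x. GDERIV F x :> DF x" "\<And>j. polyfun (\<lambda>x. DF x $ j)"
    using polyfun_GDERIV[OF poly(1)] by blast
  obtain DG where DG: "\<And>x. GDERIV G x :> DG x" "\<And>j. polyfun (\<lambda>x. DG x $ j)"
    using polyfun_GDERIV[OF poly(2)] by blast
  obtain DH where DH: "\<And>x. GDERIV H x :> DH x" "\<And>j. polyfun (\<lambda>x. DH x $ j)"
    using polyfun_GDERIV[OF poly(3)] by blast
  have "\<exists>d. \<forall>f \<in> insert F (\<Union>j. {\<lambda>x. DF x $ j, \<lambda>x. DG x $ j, \<lambda>x. DH x $ j}). poly_deg_le d f"
    by (rule polyfun_uniform_degree) (use poly DF DG DH in auto)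
  then obtain d where d: "poly_deg_le d F" "\<And>j. poly_deg_le d (\<lambda>x. DF x $ j)"
    "\<And>j. poly_deg_le d (\<lambda>x. DG x $ j)" "\<And>j. poly_deg_le d (\<lambda>x. DH x $ j)"
    by auto
  \<comment> \<open>A sample is a triple \<open>(x, r, e)\<close>. The outer polynomial variable is
    \<open>e\<close>, so that \<open>poly_family_divide_X\<close> divides by a power of
    \<open>e\<close>.\<close>
  define ev :: "real poly poly \<Rightarrow> (real^'m) \<times> real \<times> real \<Rightarrow> real"
    where "ev c s = bev c (snd (snd s)) (fst (snd s))" for c s
  define X :: "'m \<Rightarrow> (real^'m) \<times> real \<times> real \<Rightarrow> real" where "X j s = fst s $ j" for j s
  interpret elimination ev X
    by unfold_locales (simp_all add: ev_def)
  define M where "M = 2 * d + 1"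
  \<comment> \<open>This is \<open>2 * (d + 1) * e\<^sup>2\<close>, nonzero exactly for
    \<open>e\<close> nonzero.\<close>
  define l :: "real poly poly" where "l = [:0, 0, [:real (2 * Suc d):]:]"
  define q where "q j s = - (snd (snd s) * DH (fst s) $ j
      + 2 * (F (fst s) - fst (snd s)) * DF (fst s) $ j + DG (fst s) $ j)" for j s
  define S where "S = {s. \<forall>j. ev l s * X j s ^ M = q j s}"
  have scalars: "\<exists>e. \<forall>s. ev e s = c" for c
    by (rule exI[of _ "[:[:c:]:]"]) (simp add: ev_def)
  have X_vec: "(\<chi> i. X i s) = fst s" for s by (simp add: X_def vec_eq_iff)
  have pd: "(\<lambda>s. f (fst s)) \<in> Sp (Mons e)" if "poly_deg_le e f" for f e
    using Sp_poly_deg_le[OF that scalars] by (simp add: X_vec)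
  have q_Sp: "q j \<in> Sp (Mons (M - 1))" for j
  proof -
    have e: "(\<lambda>s. snd (snd s)) = ev [:0, 1:]" by (simp add: ev_def fun_eq_iff)
    have r: "(\<lambda>s. F (fst s) - fst (snd s)) = (\<lambda>s. F (fst s) + ev [:[:0, -1:]:] s)"
      by (simp add: ev_def fun_eq_iff)
    have A: "(\<lambda>s. F (fst s) - fst (snd s)) \<in> Sp (Mons d)"
      unfolding r by (intro Sp_add pd d Sp_const)
    have B: "(\<lambda>s. (F (fst s) - fst (snd s)) * DF (fst s) $ j) \<in> Sp (Mons (d + d))"
      by (rule Sp_mult[OF A pd[OF d(2)]])
    have C: "(\<lambda>s. ev [:0, [:-1:]:] s * DH (fst s) $ j) \<in> Sp (Mons (d + d))"
      by (rule Sp_mono[OF Sp_scale[OF pd[OF d(4)]] Mons_mono]) simp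
    have D: "(\<lambda>s. ev [:[:-1:]:] s * DG (fst s) $ j) \<in> Sp (Mons (d + d))"
      by (rule Sp_mono[OF Sp_scale[OF pd[OF d(3)]] Mons_mono]) simp
    have "(\<lambda>s. ev [:0, [:-1:]:] s * DH (fst s) $ j + (ev [:[:-2:]:] s
        * ((F (fst s) - fst (snd s)) * DF (fst s) $ j) + ev [:[:-1:]:] s * DG (fst s) $ j)) \<in> Sp (Mons (d + d))"
      by (intro Sp_add Sp_scale[OF B] C D)
    also have "(\<lambda>s. ev [:0, [:-1:]:] s * DH (fst s) $ j + (ev [:[:-2:]:] s
        * ((F (fst s) - fst (snd s)) * DF (fst s) $ j) + ev [:[:-1:]:] s * DG (fst s) $ j)) = q j"
      by (simp add: fun_eq_iff q_def ev_def algebra_simps)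
    finally show ?thesis by (simp add: M_def mult_2)
  qed
  have "\<exists>R. R \<noteq> 0 \<and> (\<forall>x e r xl. (\<forall>n::nat. (x n, r, e n) \<in> S \<and> e n \<noteq> 0) \<longrightarrow> e \<longlonglongrightarrow> 0 \<longrightarrow>
      x \<longlonglongrightarrow> xl \<longrightarrow> bev R (xl $ j) r = 0)" for j
  proof -
    have XS: "X j \<in> Sp (Mons 1)" by (rule Sp_var) simp
    obtain B c where c: "\<exists>k\<le>B. c k \<noteq> 0"
      "\<And>s. s \<in> S \<Longrightarrow> ev l s \<noteq> 0 \<Longrightarrow> (\<Sum>k\<le>B. ev (c k) s * X j s ^ k) = 0"
      by (rule eliminate[OF q_Sp _ _ XS, where S = S and l = l]) (auto simp: S_def M_def)
    obtain t e where te: "\<And>k. k \<le> B \<Longrightarrow> c k = monom 1 t * e k" "\<exists>k\<le>B. coeff (e k) 0 \<noteq> 0"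
      using poly_family_divide_X[OF c(1)] by blast
    \<comment> \<open>Setting \<open>e = 0\<close> leaves coefficients in \<open>r\<close> alone;
      the outer variable of \<open>R\<close> now stands for the coordinate.\<close>
    define R where "R = (\<Sum>k\<le>B. monom (coeff (e k) 0) k)"
    have "coeff R k = coeff (e k) 0" if "k \<le> B" for k
      using that by (simp add: R_def coeff_sum)
    with te(2) have "R \<noteq> 0" by (metis coeff_0)
    moreover have "bev R (xl $ j) r = 0"
      if *: "\<forall>n. (x n, r, f n) \<in> S \<and> f n \<noteq> 0" "f \<longlonglongrightarrow> 0" "x \<longlonglongrightarrow> xl" for x f r xl
    proof -
      have zero: "(\<Sum>k\<le>B. bev (e k) (f n) r * (x n $ j) ^ k) = 0" for n
      proof -
        have "(x n, r, f n) \<in> S" and f: "f n \<noteq> 0" using *(1) by auto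
        moreover have "ev l (x n, r, f n) \<noteq> 0" using f by (simp add: ev_def l_def)
        ultimately have "0 = (\<Sum>k\<le>B. ev (c k) (x n, r, f n) * X j (x n, r, f n) ^ k)"
          using c(2) by simp
        also have "\<dots> = f n ^ t * (\<Sum>k\<le>B. bev (e k) (f n) r * (x n $ j) ^ k)"
          unfolding sum_distrib_left
          by (rule sum.cong) (simp_all add: te(1) ev_def X_def bev_monom)
        finally show ?thesis using f by simp
      qed
      have "(\<lambda>n. \<Sum>k\<le>B. bev (e k) (f n) r * (x n $ j) ^ k)
          \<longlonglongrightarrow> (\<Sum>k\<le>B. bev (e k) 0 r * (xl $ j) ^ k)"
        by (intro tendsto_intros *)
      then have "(\<Sum>k\<le>B. bev (e k) 0 r * (xl $ j) ^ k) = 0"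
        unfolding zero by (simp add: LIMSEQ_const_iff)
      then show ?thesis
        by (simp add: R_def bev_sum bev_monom) (simp add: bev_def poly_0_coeff_0)
    qed
    ultimately show ?thesis by blast
  qed
  then obtain R where R: "\<And>j. R j \<noteq> 0"
    "\<And>j x e r xl. (\<And>n::nat. (x n, r, e n) \<in> S) \<Longrightarrow> (\<And>n. e n \<noteq> 0) \<Longrightarrow> e \<longlonglongrightarrow> 0 \<Longrightarrow> x \<longlonglongrightarrow> xl \<Longrightarrow>
      bev (R j) (xl $ j) r = 0"
    by metis
  have "\<exists>x. F x = r \<and> G x = 0 \<and> (\<forall>j. bev (R j) (x $ j) r = 0) \<and>
      (\<forall>x'. F x' = r \<longrightarrow> G x' = 0 \<longrightarrow> H x \<le> H x')" if x0: "F x0 = r" "G x0 = 0" for r x0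
  proof -
    define T where "T x = (\<Sum>j\<in>UNIV. (x $ j) ^ (2 * Suc d))" for x :: "real^'m"
    have T_nonneg: "0 \<le> T x" for x
      unfolding T_def by (intro sum_nonneg zero_le_even_power) simp
    define K where "K = H x0 + T x0"
    have K: "0 \<le> K" unfolding K_def using nonneg T_nonneg by (simp add: add_nonneg_nonneg)
    \<comment> \<open>Beside tending to \<open>0\<close>, this gives \<open>e n * K \<le> 1\<close>,
      which keeps the minimizers in the sublevel set of \<open>G\<close> at \<open>1\<close>, and
      \<open>e n \<le> 1\<close>, which bounds \<open>(e n)\<^sup>2 * T x0\<close> by
      \<open>e n * T x0\<close>.\<close>
    define e where "e n = inverse (K + real (Suc n))" for n
    have e_pos: "e n > 0" for n using K by (simp add: e_def)
    have e_le: "e n \<le> 1" for n using K by (simp add: e_def field_simps)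
    have eK: "e n * K \<le> 1" for n using K by (simp add: e_def field_simps)
    have e_lim: "e \<longlonglongrightarrow> 0"
      unfolding e_def by real_asymp
    have "\<exists>x. (\<forall>y. e n * H x + (F x - r)\<^sup>2 + G x + (e n)\<^sup>2 * T x
        \<le> e n * H y + (F y - r)\<^sup>2 + G y + (e n)\<^sup>2 * T y) \<and> (x, r, e n) \<in> S" for n
    proof -
      obtain x where x: "\<And>y. e n * H x + (F x - r)\<^sup>2 + G x + (e n)\<^sup>2 * (\<Sum>j\<in>UNIV. (x $ j) ^ (2 * Suc d))
          \<le> e n * H y + (F y - r)\<^sup>2 + G y + (e n)\<^sup>2 * (\<Sum>j\<in>UNIV. (y $ j) ^ (2 * Suc d))"
        "\<And>j. (e n)\<^sup>2 * real (2 * Suc d) * (x $ j) ^ (2 * d + 1)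
          = - (e n * DH x $ j + 2 * (F x - r) * DF x $ j + DG x $ j)"
        by (rule penalty_minimizer[OF DF(1) DG(1) DH(1) nonneg e_pos]) blast
      have "ev l (x, r, e n) = (e n)\<^sup>2 * real (2 * Suc d)"
        by (simp add: ev_def l_def power2_eq_square)
      then have "(x, r, e n) \<in> S"
        using x(2) by (simp add: S_def X_def M_def q_def)
      with x(1) show ?thesis unfolding T_def by blast
    qed
    then obtain x where min: "\<And>n y. e n * H (x n) + (F (x n) - r)\<^sup>2 + G (x n) + (e n)\<^sup>2 * T (x n)
        \<le> e n * H y + (F y - r)\<^sup>2 + G y + (e n)\<^sup>2 * T y" and xS: "\<And>n. (x n, r, e n) \<in> S"
      by metis
    have bound: "(F (x n) - r)\<^sup>2 + G (x n) \<le> e n * K" for n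
    proof -
      have "0 \<le> e n * H (x n)" "0 \<le> (e n)\<^sup>2 * T (x n)"
        using e_pos[of n] nonneg T_nonneg by simp_all
      moreover have "(e n)\<^sup>2 * T x0 \<le> e n * T x0"
        using e_pos[of n] e_le[of n] T_nonneg[of x0]
        by (intro mult_right_mono) (auto simp: power2_eq_square mult_left_le)
      ultimately show ?thesis using min[of n x0] x0 by (simp add: K_def algebra_simps)
    qed
    have "x n \<in> {x. G x \<le> 1}" for n
      using bound[of n] eK[of n] zero_le_power2[of "F (x n) - r"] unfolding mem_Collect_eq by linarith
    moreover have "compact {x. G x \<le> 1}"
      using bdd polyfun_continuous_on[OF poly(2), of UNIV]
      by (auto simp: compact_eq_bounded_closed intro!: closed_Collect_le)
    ultimately obtain xl \<phi> where xl: "strict_mono (\<phi> :: nat \<Rightarrow> nat)" "(x \<circ> \<phi>) \<longlonglongrightarrow> xl"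
      unfolding compact_def by meson
    have e\<phi>: "(\<lambda>n. e (\<phi> n)) \<longlonglongrightarrow> 0"
      using LIMSEQ_subseq_LIMSEQ[OF e_lim xl(1)] by (simp add: o_def)
    have x\<phi>: "(\<lambda>n. x (\<phi> n)) \<longlonglongrightarrow> xl" using xl(2) by (simp add: o_def)
    have "(\<lambda>n. (F (x (\<phi> n)) - r)\<^sup>2 + G (x (\<phi> n))) \<longlonglongrightarrow> (F xl - r)\<^sup>2 + G xl"
      by (intro tendsto_intros tendsto_polyfun poly x\<phi>)
    moreover have "(\<lambda>n. e (\<phi> n) * K) \<longlonglongrightarrow> 0 * K" by (intro tendsto_intros e\<phi>)
    ultimately have "(F xl - r)\<^sup>2 + G xl \<le> 0 * K"
      by (rule LIMSEQ_le) (use bound in blast)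
    then have "(F xl - r)\<^sup>2 = 0" "G xl = 0"
      using nonneg(1)[of xl] zero_le_power2[of "F xl - r"] by linarith+
    then have feas: "F xl = r" "G xl = 0" by simp_all
    have "bev (R j) (xl $ j) r = 0" for j
      using xS e_pos by (intro R(2)[OF _ _ e\<phi> x\<phi>]) (simp_all add: less_imp_neq[symmetric])
    moreover have "H xl \<le> H x'" if x': "F x' = r" "G x' = 0" for x'
    proof -
      \<comment> \<open>Comparison with the feasible \<open>x'\<close>, divided by
        \<open>e n\<close>: the square on \<open>e\<close> in the coercive term leaves a factor that
        tends to \<open>0\<close>.\<close>
      have *: "H (x n) \<le> H x' + e n * T x'" for n
      proof -
        have "0 \<le> (e n)\<^sup>2 * T (x n)" "0 \<le> (F (x n) - r)\<^sup>2" using T_nonneg by simp_all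
        then have "e n * H (x n) \<le> e n * (H x' + e n * T x')"
          using min[of n x'] x' nonneg(1)[of "x n"] by (simp add: power2_eq_square algebra_simps)
        then show ?thesis using e_pos[of n] by simp
      qed
      have "(\<lambda>n. H (x (\<phi> n))) \<longlonglongrightarrow> H xl" by (intro tendsto_polyfun poly x\<phi>)
      moreover have "(\<lambda>n. H x' + e (\<phi> n) * T x') \<longlonglongrightarrow> H x' + 0 * T x'"
        by (intro tendsto_intros e\<phi>)
      ultimately have "H xl \<le> H x' + 0 * T x'" by (rule LIMSEQ_le) (use * in blast)
      then show ?thesis by simp
    qed
    ultimately show ?thesis using feas by blast
  qed
  with R(1) that show thesis by blast
qed

section \<open>Roots of bivariate polynomials\<close>

lemma eventually_at_right_0E:
  fixes P :: "real \<Rightarrow> bool"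
  assumes "\<forall>\<^sub>F r in at_right 0. P r"
  obtains \<epsilon> where "\<epsilon> > 0" "\<And>r. r \<in> {0<..<\<epsilon>} \<Longrightarrow> P r"
  using assms that unfolding eventually_at_right_field by (metis greaterThanLessThan_iff)

lemma eventually_poly_nonzero:
  fixes p :: "real poly"
  assumes "p \<noteq> 0"
  shows "\<forall>\<^sub>F r in at_right 0. poly p r \<noteq> 0"
proof -
  have "finite ({r. poly p r = 0} - {0})" using poly_roots_finite[OF assms] by simp
  then have "open (- ({r. poly p r = 0} - {0}))" by (intro open_Compl finite_imp_closed)
  then have "\<forall>\<^sub>F r in nhds 0. r \<in> - ({r. poly p r = 0} - {0})"
    by (intro eventually_nhds_in_open) auto
  then show ?thesis by (auto simp: eventually_at_filter elim: eventually_mono)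
qed

text \<open>A Bezout identity up to a constant of the coefficient ring, without its field of
  fractions: pseudo-division replaces division in the usual argument with a combination
  \<open>T\<close> of least degree.\<close>

lemma prime_elem_bezout:
  fixes R S :: "'a::idom_divide poly"
  assumes "prime_elem R" "degree R > 0" "\<not> R dvd S"
  shows "\<exists>U V d. d \<noteq> 0 \<and> U * R + V * S = [:d:]"
proof -
  define I where "I T \<longleftrightarrow> T \<noteq> 0 \<and> (\<exists>U V. T = U * R + V * S)" for T
  have "I R" unfolding I_def using assms(2) by (auto intro: exI[of _ 1] exI[of _ 0])
  then obtain T where T: "I T" "\<And>T'. I T' \<Longrightarrow> degree T \<le> degree T'"
    using ex_has_least_nat[of I R degree] by auto
  have T0: "T \<noteq> 0" using T(1) by (simp add: I_def)
  obtain U V where UV: "T = U * R + V * S" using T(1) by (auto simp: I_def)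
  \<comment> \<open>The pseudo-remainder is again a combination of \<open>R\<close> and
    \<open>S\<close>, so it vanishes by minimality of \<open>T\<close>.\<close>
  have dvd: "\<exists>a q. a \<noteq> 0 \<and> smult a W = T * q" if W: "W = A * R + B * S" for W A B
  proof -
    obtain a q where aq: "a \<noteq> 0" "smult a W = T * q + pseudo_mod W T"
      using pseudo_mod(1)[OF T0, of W] by blast
    have "pseudo_mod W T = smult a W - T * q" using aq(2) by simp
    also have "\<dots> = (smult a A - U * q) * R + (smult a B - V * q) * S"
      unfolding W UV by (simp add: algebra_simps smult_add_right)
    finally have "pseudo_mod W T \<noteq> 0 \<Longrightarrow> I (pseudo_mod W T)" unfolding I_def by blast
    then have "pseudo_mod W T = 0"
      using T(2)[of "pseudo_mod W T"] pseudo_mod(2)[OF T0, of W] by fastforce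
    with aq show ?thesis by auto
  qed
  obtain a q where aq: "a \<noteq> 0" "smult a R = T * q" using dvd[of R 1 0] by auto
  obtain b p where bp: "b \<noteq> 0" "smult b S = T * p" using dvd[of S 0 1] by auto
  have "R dvd smult a R" by (simp add: dvd_smult)
  then have "R dvd T * q" unfolding aq .
  then have "R dvd T \<or> R dvd q" using assms(1) prime_elem_dvd_mult_iff by blast
  moreover have "\<not> R dvd T"
  proof
    assume "R dvd T"
    then have "R dvd T * p" by (rule dvd_mult2)
    then have "R dvd [:b:] * S" using bp(2) by simp
    then have "R dvd [:b:]" using assms prime_elem_dvd_mult_iff by blast
    then have "degree R \<le> degree [:b:]" using bp(1) by (intro dvd_imp_degree_le) auto
    with assms(2) show False by simp
  qed
  \<comment> \<open>\<open>R\<close> must divide the cofactor \<open>q\<close>; cancelling it from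
    \<open>smult a R = T * q\<close> leaves the constant \<open>[:a:] = T * w\<close>.\<close>
  ultimately obtain w where w: "q = R * w" by (auto elim: dvdE)
  have R0: "R \<noteq> 0" using assms(2) by auto
  have "R * ([:a:] - T * w) = 0" using aq(2) w by (simp add: algebra_simps)
  then have "[:a:] = T * w" using R0 by simp
  moreover from this have "w \<noteq> 0" using aq(1) by auto
  ultimately have "degree T = 0" using T0 degree_mult_eq[of T w] by (metis add_is_0 degree_pCons_0)
  then obtain d where "T = [:d:]" by (rule degree_eq_zeroE)
  with T0 UV show ?thesis by (intro exI[of _ U] exI[of _ V] exI[of _ d]) auto
qed

text \<open>At a common zero the Bezout constant \<open>d\<close> vanishes, and a nonzero polynomial
  in \<open>r\<close> has no zeros just to the right of \<open>0\<close>.\<close>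

lemma eventually_no_common_zero:
  assumes "prime_elem R" "degree R > 0" "\<not> R dvd S"
  shows "\<forall>\<^sub>F r in at_right 0. \<forall>y. bev R y r = 0 \<longrightarrow> bev S y r \<noteq> 0"
proof -
  obtain U V d where d: "d \<noteq> 0" "U * R + V * S = [:d:]" using prime_elem_bezout[OF assms] by blast
  from eventually_poly_nonzero[OF d(1)] show ?thesis
  proof eventually_elim
    case (elim r)
    have "bev U y r * bev R y r + bev V y r * bev S y r = poly d r" for y
      using arg_cong[OF d(2), of "\<lambda>W. bev W y r"] by simp
    with elim show ?case by (metis add_0 mult_zero_right)
  qed
qed

lemma not_dvd_pderiv:
  fixes R :: "real poly poly"
  assumes "degree R > 0"
  shows "\<not> R dvd pderiv R"
proof
  assume "R dvd pderiv R"
  moreover have "pderiv R \<noteq> 0" using assms by (simp add: pderiv_eq_0_iff)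
  ultimately have "degree R \<le> degree (pderiv R)" by (rule dvd_imp_degree_le)
  with assms show False by (simp add: degree_pderiv)
qed

text \<open>\<open>map_poly pderiv R\<close> is the derivative in \<open>r\<close>. Its degree in
  \<open>y\<close> does not exceed that of \<open>R\<close>, so the cofactor is constant in
  \<open>y\<close>; each coefficient then divides its own derivative, which has smaller degree
  unless it is zero.\<close>

lemma dvd_map_pderiv_imp_zero:
  fixes R :: "real poly poly"
  assumes "R dvd map_poly pderiv R"
  shows "map_poly pderiv R = 0"
proof (rule ccontr)
  assume nz: "map_poly pderiv R \<noteq> 0"
  obtain w where w: "map_poly pderiv R = R * w" using assms by (auto elim: dvdE)
  have "R \<noteq> 0" "w \<noteq> 0" using nz w by auto
  then have "degree R + degree w = degree (map_poly pderiv R)" by (simp add: w degree_mult_eq)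
  also have "\<dots> \<le> degree R" by (intro degree_le) (simp add: coeff_map_poly coeff_eq_0)
  finally have "degree w = 0" by simp
  then obtain c where c: "w = [:c:]" by (rule degree_eq_zeroE)
  obtain k where k: "coeff (map_poly pderiv R) k \<noteq> 0" using nz by (metis poly_eqI coeff_0)
  have eq: "pderiv (coeff R k) = coeff R k * c"
    using arg_cong[OF w, of "\<lambda>p. coeff p k"] by (simp add: c coeff_map_poly)
  have nz': "pderiv (coeff R k) \<noteq> 0" using k by (simp add: coeff_map_poly)
  then have "degree (coeff R k) \<noteq> 0" by (simp add: pderiv_eq_0_iff)
  moreover have "degree (coeff R k) \<le> degree (pderiv (coeff R k))"
    using dvd_imp_degree_le[of "coeff R k" "pderiv (coeff R k)"] nz' unfolding eq by simp
  ultimately show False by (simp add: degree_pderiv)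
qed

lemma bev_smult [simp]: "bev (smult c R) y r = poly c r * bev R y r"
  by (simp add: bev_def)

lemma bev_pderiv_fst: "((\<lambda>y. bev R y r) has_real_derivative bev (pderiv R) y r) (at y)"
proof (induction R)
  case (pCons c R)
  have "((\<lambda>y. poly c r + y * bev R y r) has_real_derivative
      (bev R y r + y * bev (pderiv R) y r)) (at y)"
    by (rule derivative_eq_intros pCons.IH refl | simp)+
  then show ?case by (simp add: pderiv_pCons)
qed simp

lemma bev_pderiv_snd: "(bev R y has_real_derivative bev (map_poly pderiv R) y r) (at r)"
proof (induction R)
  case 0
  have "bev 0 y = (\<lambda>r. 0)" by (simp add: fun_eq_iff)
  then show ?case by simp
next
  case (pCons c R)
  have "((\<lambda>r. poly c r + y * bev R y r) has_real_derivative
      (poly (pderiv c) r + y * bev (map_poly pderiv R) y r)) (at r)"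
    by (rule derivative_eq_intros pCons.IH poly_DERIV refl | simp)+
  moreover have "bev (pCons c R) y = (\<lambda>r. poly c r + y * bev R y r)" by (simp add: fun_eq_iff)
  moreover have "map_poly pderiv (pCons c R) = pCons (pderiv c) (map_poly pderiv R)"
    by (rule map_poly_pCons) simp
  ultimately show ?case by simp
qed

section \<open>Stability and continuation of simple roots\<close>

lemma bev_nonzero_nbhd:
  assumes "bev S y0 r0 \<noteq> 0"
  obtains e where "e > 0" "\<And>y r. \<bar>y - y0\<bar> < e \<Longrightarrow> \<bar>r - r0\<bar> < e \<Longrightarrow> bev S y r \<noteq> 0"
proof -
  have "open {p. bev S (fst p) (snd p) \<noteq> 0}"
    by (intro open_Collect_neq continuous_intros)
  moreover have "(y0, r0) \<in> {p. bev S (fst p) (snd p) \<noteq> 0}" using assms by simp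
  ultimately obtain A B where AB: "open A" "open B" "(y0, r0) \<in> A \<times> B"
    "A \<times> B \<subseteq> {p. bev S (fst p) (snd p) \<noteq> 0}" by (rule open_prod_elim)
  obtain e1 where e1: "e1 > 0" "\<And>y. \<bar>y - y0\<bar> < e1 \<Longrightarrow> y \<in> A"
    using AB(1,3) by (auto simp: open_dist dist_real_def)
  obtain e2 where e2: "e2 > 0" "\<And>r. \<bar>r - r0\<bar> < e2 \<Longrightarrow> r \<in> B"
    using AB(2,3) by (auto simp: open_dist dist_real_def)
  have "bev S y r \<noteq> 0" if "\<bar>y - y0\<bar> < min e1 e2" "\<bar>r - r0\<bar> < min e1 e2" for y r
  proof -
    have "(y, r) \<in> A \<times> B" using that e1(2) e2(2) by simp
    with AB(4) show ?thesis by auto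
  qed
  with e1(1) e2(1) show thesis by (intro that[of "min e1 e2"]) auto
qed

text \<open>Synthetic division gives \<open>R(y, r) = (y - y0) * A(y, r) + R(y0, r)\<close> with
  \<open>A(y0, r0)\<close> the derivative in \<open>y\<close>. Along a root the difference quotient
  is therefore explicit, and continuity of \<open>\<xi>\<close> is enough to pass to the
  limit.\<close>

lemma implicit_function_DERIV:
  assumes root: "\<And>r. r \<in> I \<Longrightarrow> bev R (\<xi> r) r = 0" and I: "open I" "r0 \<in> I"
    and cont: "continuous_on I \<xi>" and nz: "bev (pderiv R) (\<xi> r0) r0 \<noteq> 0"
  shows "(\<xi> has_real_derivative
      - bev (map_poly pderiv R) (\<xi> r0) r0 / bev (pderiv R) (\<xi> r0) r0) (at r0)"
proof -
  define y0 where "y0 = \<xi> r0"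
  define A where "A = synthetic_div R [:y0:]"
  have R_split: "[:-[:y0:], 1:] * A + [:poly R [:y0:]:] = R"
    unfolding A_def by (rule synthetic_div_correct')
  have eq: "bev R y r = (y - y0) * bev A y r + bev R y0 r" for y r
    using arg_cong[OF R_split, of "\<lambda>W. bev W y r"] by (simp add: bev_def algebra_simps)
  have "pderiv R = A + [:-[:y0:], 1:] * pderiv A"
    by (subst R_split[symmetric], simp only: pderiv_add pderiv_mult) (simp add: pderiv_pCons)
  then have A0: "bev A y0 r0 = bev (pderiv R) y0 r0" by simp
  have cont0: "\<xi> \<midarrow>r0\<rightarrow> y0"
    using cont I unfolding y0_def by (metis at_within_open continuous_on)
  have lim_R: "((\<lambda>r. (bev R y0 r - bev R y0 r0) / (r - r0)) \<longlongrightarrow> bev (map_poly pderiv R) y0 r0) (at r0)"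
    using bev_pderiv_snd[of R y0 r0] by (simp add: has_field_derivative_iff)
  have lim_A: "((\<lambda>r. bev A (\<xi> r) r) \<longlongrightarrow> bev A y0 r0) (at r0)"
    by (intro tendsto_intros cont0)
  have lim: "((\<lambda>r. - ((bev R y0 r - bev R y0 r0) / (r - r0)) / bev A (\<xi> r) r)
      \<longlongrightarrow> - bev (map_poly pderiv R) y0 r0 / bev A y0 r0) (at r0)"
    by (rule tendsto_divide[OF tendsto_minus[OF lim_R] lim_A]) (use nz A0 in \<open>simp add: y0_def\<close>)
  have "\<forall>\<^sub>F r in at r0. bev A (\<xi> r) r \<noteq> 0"
    using tendsto_imp_eventually_ne[OF lim_A] nz A0 by (simp add: y0_def)
  moreover have "\<forall>\<^sub>F r in at r0. r \<in> I" using I by (rule eventually_at_in_open')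
  ultimately have "\<forall>\<^sub>F r in at r0. - ((bev R y0 r - bev R y0 r0) / (r - r0)) / bev A (\<xi> r) r
      = (\<xi> r - \<xi> r0) / (r - r0)"
  proof eventually_elim
    case (elim r)
    have "(\<xi> r - y0) * bev A (\<xi> r) r + bev R y0 r = 0"
      using eq[of "\<xi> r" r] root elim by simp
    moreover have "bev R y0 r0 = 0" using root I by (simp add: y0_def)
    ultimately have "- (bev R y0 r - bev R y0 r0) = (\<xi> r - y0) * bev A (\<xi> r) r" by simp
    then have "- ((bev R y0 r - bev R y0 r0) / (r - r0)) = (\<xi> r - y0) * bev A (\<xi> r) r / (r - r0)"
      by (simp only: minus_divide_left)
    with elim show ?case by (simp add: y0_def)
  qed
  with lim have "((\<lambda>r. (\<xi> r - \<xi> r0) / (r - r0))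
      \<longlongrightarrow> - bev (map_poly pderiv R) y0 r0 / bev A y0 r0) (at r0)"
    by (rule Lim_transform_eventually)
  then show ?thesis unfolding has_field_derivative_iff A0 unfolding y0_def .
qed

text \<open>Within radius \<open>e\<close> the derivative in \<open>y\<close> has no zero, so Rolle
  excludes a second root; a sign change around \<open>y0\<close> persists for nearby
  \<open>r\<close> and supplies one. The radius \<open>e\<close> precedes \<eta>, so that \<eta> can
  later be shrunk freely.\<close>

lemma simple_root_continues:
  assumes root: "bev R y0 r0 = 0" and nz: "bev (pderiv R) y0 r0 \<noteq> 0"
  obtains e where "e > 0" "\<And>\<eta>. 0 < \<eta> \<Longrightarrow> \<eta> \<le> e \<Longrightarrow>
    \<exists>\<delta>>0. \<forall>r. \<bar>r - r0\<bar> < \<delta> \<longrightarrow> (\<exists>!y. \<bar>y - y0\<bar> < \<eta> \<and> bev R y r = 0)"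
proof -
  obtain e where e: "e > 0" "\<And>y r. \<bar>y - y0\<bar> < e \<Longrightarrow> \<bar>r - r0\<bar> < e \<Longrightarrow> bev (pderiv R) y r \<noteq> 0"
    using bev_nonzero_nbhd[OF nz] by metis
  show thesis
  proof (rule that[OF e(1)])
    fix \<eta> assume \<eta>: "0 < \<eta>" "\<eta> \<le> e"
    have unique: "y = y'" if "\<bar>r - r0\<bar> < e" "\<bar>y - y0\<bar> < \<eta>" "bev R y r = 0" "\<bar>y' - y0\<bar> < \<eta>" "bev R y' r = 0"
      for r y y'
    proof -
      have "\<not> y < y'" if *: "\<bar>y - y0\<bar> < \<eta>" "bev R y r = 0" "\<bar>y' - y0\<bar> < \<eta>" "bev R y' r = 0" for y y'
      proof
        assume "y < y'"
        then obtain z where "y < z" "z < y'"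
            "(*) (bev (pderiv R) z r) = (\<lambda>v. 0)"
          using Rolle_deriv[of y y' "\<lambda>y. bev R y r" "\<lambda>z. (*) (bev (pderiv R) z r)"] *
            bev_pderiv_fst[of R r, unfolded has_field_derivative_def]
            continuous_on_bev[OF continuous_on_id continuous_on_const, of "{y..y'}" R r]
          by auto
        then have "bev (pderiv R) z r * 1 = 0" by (metis (no_types))
        moreover have "\<bar>z - y0\<bar> < e" using * \<eta> \<open>y < z\<close> \<open>z < y'\<close> by (simp add: abs_less_iff)
        ultimately show False using e(2)[of z r] \<open>\<bar>r - r0\<bar> < e\<close> by simp
      qed
      then show ?thesis using that by (meson linorder_neqE)
    qed
    obtain h where h: "0 < h" "h < \<eta>" "bev R (y0 - h) r0 * bev R (y0 + h) r0 < 0"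
    proof -
      \<comment> \<open>The factor \<open>?s\<close> makes the slope \<open>?s * ?s\<close> positive
        whichever sign \<open>?s\<close> has.\<close>
      let ?s = "bev (pderiv R) y0 r0"
      have D: "((\<lambda>y. ?s * bev R y r0) has_real_derivative ?s * ?s) (at y0)"
        by (rule DERIV_cmult[OF bev_pderiv_fst])
      have "0 < ?s * ?s" using nz by (simp add: zero_less_mult_iff linorder_neq_iff) linarith
      obtain d1 where d1: "d1 > 0" "\<And>h. 0 < h \<Longrightarrow> h < d1 \<Longrightarrow> 0 < ?s * bev R (y0 + h) r0"
        using DERIV_pos_inc_right[OF D \<open>0 < ?s * ?s\<close>] root by auto
      obtain d2 where d2: "d2 > 0" "\<And>h. 0 < h \<Longrightarrow> h < d2 \<Longrightarrow> ?s * bev R (y0 - h) r0 < 0"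
        using DERIV_pos_inc_left[OF D \<open>0 < ?s * ?s\<close>] root by auto
      define h where "h = min \<eta> (min d1 d2) / 2"
      have h: "0 < h" "h < \<eta>" "h < d1" "h < d2" using \<eta> d1(1) d2(1) by (auto simp: h_def)
      have "(?s * bev R (y0 - h) r0) * (?s * bev R (y0 + h) r0) < 0"
        by (rule mult_neg_pos[OF d2(2)[OF h(1,4)] d1(2)[OF h(1,3)]])
      then have "(?s * ?s) * (bev R (y0 - h) r0 * bev R (y0 + h) r0) < 0" by (simp add: mult_ac)
      then have "bev R (y0 - h) r0 * bev R (y0 + h) r0 < 0"
        using \<open>0 < ?s * ?s\<close> by (simp add: mult_less_0_iff)
      with h that show thesis by blast
    qed
    have "open {r. bev R (y0 - h) r * bev R (y0 + h) r < 0}"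
      by (intro open_Collect_less continuous_intros)
    then obtain d where d: "d > 0" "\<And>r. \<bar>r - r0\<bar> < d \<Longrightarrow> bev R (y0 - h) r * bev R (y0 + h) r < 0"
      using h(3) by (auto simp: open_dist dist_real_def)
    have exist: "\<exists>y. \<bar>y - y0\<bar> < \<eta> \<and> bev R y r = 0" if "\<bar>r - r0\<bar> < d" for r
    proof -
      have cont: "\<forall>y. y0 - h \<le> y \<and> y \<le> y0 + h \<longrightarrow> isCont (\<lambda>y. bev R y r) y"
        using bev_pderiv_fst DERIV_isCont by blast
      have "bev R (y0 - h) r * bev R (y0 + h) r < 0" using d(2) that .
      then consider "bev R (y0 - h) r \<le> 0" "0 \<le> bev R (y0 + h) r"
        | "bev R (y0 + h) r \<le> 0" "0 \<le> bev R (y0 - h) r"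
        by (auto simp: mult_less_0_iff)
      then have "\<exists>y. y0 - h \<le> y \<and> y \<le> y0 + h \<and> bev R y r = 0"
        using h(1) cont IVT[of "\<lambda>y. bev R y r" "y0 - h" 0 "y0 + h"]
          IVT2[of "\<lambda>y. bev R y r" "y0 + h" 0 "y0 - h"] by cases auto
      then obtain y where y: "y0 - h \<le> y" "y \<le> y0 + h" "bev R y r = 0" by blast
      then have "\<bar>y - y0\<bar> < \<eta>" using h(2) by (simp add: abs_less_iff)
      with y(3) show ?thesis by blast
    qed
    show "\<exists>\<delta>>0. \<forall>r. \<bar>r - r0\<bar> < \<delta> \<longrightarrow> (\<exists>!y. \<bar>y - y0\<bar> < \<eta> \<and> bev R y r = 0)"
    proof (intro exI[of _ "min d e"] conjI allI impI)
      fix r assume r: "\<bar>r - r0\<bar> < min d e"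
      then obtain y where "\<bar>y - y0\<bar> < \<eta>" "bev R y r = 0" using exist by auto
      moreover have "\<bar>r - r0\<bar> < e" using r by simp
      ultimately show "\<exists>!y. \<bar>y - y0\<bar> < \<eta> \<and> bev R y r = 0" using unique by blast
    qed (use d(1) e(1) in simp)
  qed
qed

text \<open>Cauchy's bound. It is continuous in \<open>r\<close> where the leading coefficient is
  nonzero, which keeps roots from escaping to infinity.\<close>

lemma root_bound:
  assumes "bev R y r = 0" "poly (lead_coeff R) r \<noteq> 0"
  shows "\<bar>y\<bar> \<le> 1 + (\<Sum>k<degree R. \<bar>poly (coeff R k) r\<bar>) / \<bar>poly (lead_coeff R) r\<bar>"
proof (cases "\<bar>y\<bar> \<le> 1")
  case True
  have "0 \<le> (\<Sum>k<degree R. \<bar>poly (coeff R k) r\<bar>) / \<bar>poly (lead_coeff R) r\<bar>"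
    by (intro divide_nonneg_nonneg sum_nonneg) auto
  with True show ?thesis by linarith
next
  case False
  let ?D = "degree R" and ?C = "\<Sum>k<degree R. \<bar>poly (coeff R k) r\<bar>"
  have "poly (lead_coeff R) r * y ^ ?D = - (\<Sum>k<?D. poly (coeff R k) r * y ^ k)"
    using assms(1) by (simp add: bev_altdef lessThan_Suc_atMost[symmetric] eq_neg_iff_add_eq_0 add.commute)
  then have "\<bar>poly (lead_coeff R) r\<bar> * \<bar>y\<bar> ^ ?D = \<bar>\<Sum>k<?D. poly (coeff R k) r * y ^ k\<bar>"
    by (metis abs_minus_cancel abs_mult power_abs)
  also have "\<dots> \<le> (\<Sum>k<?D. \<bar>poly (coeff R k) r\<bar> * \<bar>y\<bar> ^ k)"
    by (rule order_trans[OF sum_abs]) (simp add: abs_mult power_abs)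
  also have "\<dots> \<le> (\<Sum>k<?D. \<bar>poly (coeff R k) r\<bar> * \<bar>y\<bar> ^ (?D - 1))"
    using False by (intro sum_mono mult_left_mono power_increasing) auto
  also have "\<dots> = ?C * \<bar>y\<bar> ^ (?D - 1)" by (simp add: sum_distrib_right)
  finally have *: "\<bar>poly (lead_coeff R) r\<bar> * \<bar>y\<bar> ^ ?D \<le> ?C * \<bar>y\<bar> ^ (?D - 1)" .
  have "?D \<noteq> 0"
  proof
    assume "?D = 0"
    then show False using assms by (simp add: bev_altdef)
  qed
  then have "\<bar>y\<bar> ^ ?D = \<bar>y\<bar> * \<bar>y\<bar> ^ (?D - 1)" by (metis power_eq_if)
  with * have "(\<bar>poly (lead_coeff R) r\<bar> * \<bar>y\<bar>) * \<bar>y\<bar> ^ (?D - 1) \<le> ?C * \<bar>y\<bar> ^ (?D - 1)"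
    by (simp add: mult.assoc)
  moreover have "0 < \<bar>y\<bar> ^ (?D - 1)" using False by (intro zero_less_power) linarith
  ultimately have "\<bar>poly (lead_coeff R) r\<bar> * \<bar>y\<bar> \<le> ?C" by (rule mult_right_le_imp_le)
  then have "\<bar>y\<bar> \<le> ?C / \<bar>poly (lead_coeff R) r\<bar>"
    using assms(2) by (simp add: field_simps)
  then show ?thesis by simp
qed

lemma finite_roots:
  assumes "poly (lead_coeff R) r \<noteq> 0"
  shows "finite {y. bev R y r = 0}"
proof -
  have bev_eq: "bev R y r = poly (\<Sum>k\<le>degree R. monom (poly (coeff R k) r) k) y" for y
    by (simp add: bev_altdef poly_sum poly_monom)
  have "coeff (\<Sum>k\<le>degree R. monom (poly (coeff R k) r) k) (degree R) \<noteq> 0"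
    using assms by (simp add: coeff_sum)
  then have "(\<Sum>k\<le>degree R. monom (poly (coeff R k) r) k) \<noteq> 0" by (metis coeff_0)
  from poly_roots_finite[OF this] show ?thesis by (simp add: bev_eq)
qed

text \<open>Roots that stay \<eta> away from all roots at \<open>r0\<close> while \<open>r\<close>
  tends to \<open>r0\<close> are bounded by \<open>root_bound\<close>; a limit point of them is a
  root at \<open>r0\<close>, a contradiction.\<close>

lemma roots_upper_semicontinuous:
  assumes lc: "poly (lead_coeff R) r0 \<noteq> 0" and \<eta>: "\<eta> > 0"
  shows "\<exists>\<delta>>0. \<forall>r. \<bar>r - r0\<bar> < \<delta> \<longrightarrow> (\<forall>y. bev R y r = 0 \<longrightarrow> (\<exists>y0. bev R y0 r0 = 0 \<and> \<bar>y - y0\<bar> < \<eta>))"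
proof (rule ccontr)
  assume neg: "\<not> ?thesis"
  have "\<exists>r y. \<bar>r - r0\<bar> < inverse (real (Suc n)) \<and> bev R y r = 0 \<and>
      (\<forall>y0. bev R y0 r0 = 0 \<longrightarrow> \<not> \<bar>y - y0\<bar> < \<eta>)" for n
    using neg[simplified, rule_format, of "inverse (real (Suc n))"] by fastforce
  then obtain r y where ry: "\<And>n. \<bar>r n - r0\<bar> < inverse (real (Suc n))" "\<And>n. bev R (y n) (r n) = 0"
    "\<And>n y0. bev R y0 r0 = 0 \<Longrightarrow> \<not> \<bar>y n - y0\<bar> < \<eta>" by metis
  have r_lim: "r \<longlonglongrightarrow> r0"
  proof (rule LIM_zero_cancel, rule tendsto_rabs_zero_cancel)
    show "(\<lambda>n. \<bar>r n - r0\<bar>) \<longlonglongrightarrow> 0"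
      by (rule tendsto_sandwich[OF _ _ tendsto_const LIMSEQ_inverse_real_of_nat])
        (use ry(1) in \<open>auto intro!: always_eventually less_imp_le\<close>)
  qed
  let ?b = "\<lambda>r. 1 + (\<Sum>k<degree R. \<bar>poly (coeff R k) r\<bar>) / \<bar>poly (lead_coeff R) r\<bar>"
  have "(\<lambda>n. ?b (r n)) \<longlonglongrightarrow> ?b r0" using lc by (intro tendsto_intros r_lim) auto
  then have "\<forall>\<^sub>F n in sequentially. ?b (r n) < ?b r0 + 1"
    by (rule order_tendstoD) simp
  moreover have "\<forall>\<^sub>F n in sequentially. poly (lead_coeff R) (r n) \<noteq> 0"
    by (rule tendsto_imp_eventually_ne[OF _ lc]) (intro tendsto_intros r_lim)
  ultimately have "\<forall>\<^sub>F n in sequentially. y n \<in> {- (?b r0 + 1)..?b r0 + 1}"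
  proof eventually_elim
    case (elim n)
    then have "\<bar>y n\<bar> \<le> ?b r0 + 1" using root_bound[OF ry(2), of n] by linarith
    then show ?case by (simp add: abs_le_iff)
  qed
  then obtain N where N: "\<And>n. n \<ge> N \<Longrightarrow> y n \<in> {- (?b r0 + 1)..?b r0 + 1}"
    by (auto simp: eventually_sequentially)
  then have "\<forall>n. y (n + N) \<in> {- (?b r0 + 1)..?b r0 + 1}" by simp
  then obtain l \<phi> where l: "strict_mono (\<phi> :: nat \<Rightarrow> nat)" "((\<lambda>n. y (n + N)) \<circ> \<phi>) \<longlonglongrightarrow> l"
    using compact_Icc[of "- (?b r0 + 1)" "?b r0 + 1"] unfolding compact_def by metis
  have y_lim: "(\<lambda>n. y (\<phi> n + N)) \<longlonglongrightarrow> l" using l(2) by (simp add: o_def)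
  have "(\<lambda>n. r (\<phi> n + N)) \<longlonglongrightarrow> r0"
    using LIMSEQ_subseq_LIMSEQ[OF LIMSEQ_ignore_initial_segment[OF r_lim, of N] l(1)] by (simp add: o_def)
  from tendsto_bev[OF y_lim this, of R] have "bev R l r0 = 0"
    by (simp add: ry(2) LIMSEQ_const_iff)
  moreover have "\<forall>\<^sub>F n in sequentially. \<bar>y (\<phi> n + N) - l\<bar> < \<eta>"
    using tendstoD[OF y_lim \<eta>] by (simp add: dist_real_def)
  then obtain n where "\<bar>y (\<phi> n + N) - l\<bar> < \<eta>" by (auto simp: eventually_sequentially)
  ultimately show False using ry(3) by blast
qed

text \<open>Around each root at \<open>r0\<close> a small interval holds exactly one root at
  \<open>r\<close>, and \<open>roots_upper_semicontinuous\<close> excludes roots elsewhere. As the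
  intervals are disjoint, the correspondence preserves the order.\<close>

lemma roots_stable:
  assumes lc: "poly (lead_coeff R) r0 \<noteq> 0"
    and simple: "\<And>y. bev R y r0 = 0 \<Longrightarrow> bev (pderiv R) y r0 \<noteq> 0" and \<eta>: "\<eta> > 0"
  shows "\<exists>\<delta>>0. \<forall>r. \<bar>r - r0\<bar> < \<delta> \<longrightarrow> (\<exists>h. bij_betw h {y. bev R y r0 = 0} {y. bev R y r = 0} \<and>
    strict_mono_on {y. bev R y r0 = 0} h \<and> (\<forall>y. bev R y r0 = 0 \<longrightarrow> \<bar>h y - y\<bar> < \<eta>))"
proof -
  let ?Z = "{y. bev R y r0 = 0}"
  have fin: "finite ?Z" by (rule finite_roots[OF lc])
  have "\<forall>y\<in>?Z. \<exists>e>0. \<forall>\<eta>. 0 < \<eta> \<longrightarrow> \<eta> \<le> e \<longrightarrow>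
    (\<exists>\<delta>>0. \<forall>r. \<bar>r - r0\<bar> < \<delta> \<longrightarrow> (\<exists>!z. \<bar>z - y\<bar> < \<eta> \<and> bev R z r = 0))"
  proof
    fix y assume "y \<in> ?Z"
    then have y: "bev R y r0 = 0" by simp
    show "\<exists>e>0. \<forall>\<eta>. 0 < \<eta> \<longrightarrow> \<eta> \<le> e \<longrightarrow>
      (\<exists>\<delta>>0. \<forall>r. \<bar>r - r0\<bar> < \<delta> \<longrightarrow> (\<exists>!z. \<bar>z - y\<bar> < \<eta> \<and> bev R z r = 0))"
      by (rule simple_root_continues[OF y simple[OF y]]) blast
  qed
  then obtain e where e: "\<And>y. y \<in> ?Z \<Longrightarrow> e y > 0"
    "\<And>y \<eta>. y \<in> ?Z \<Longrightarrow> 0 < \<eta> \<Longrightarrow> \<eta> \<le> e y \<Longrightarrow>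
      \<exists>\<delta>>0. \<forall>r. \<bar>r - r0\<bar> < \<delta> \<longrightarrow> (\<exists>!z. \<bar>z - y\<bar> < \<eta> \<and> bev R z r = 0)"
    unfolding bchoice_iff by blast
  \<comment> \<open>The radius \<zeta> must respect the target \<eta>, every uniqueness radius, and
    half of every gap between roots.\<close>
  define A where "A = insert \<eta> (e ` ?Z \<union> (\<lambda>p. \<bar>fst p - snd p\<bar> / 2) ` {p \<in> ?Z \<times> ?Z. fst p \<noteq> snd p})"
  have finA: "finite A" unfolding A_def using fin by (auto intro: finite_subset[OF _ finite_cartesian_product])
  define \<zeta> where "\<zeta> = Min A"
  have "\<zeta> > 0" unfolding \<zeta>_def using finA e(1) \<eta> by (subst Min_gr_iff) (auto simp: A_def)
  have \<zeta>_le: "\<zeta> \<le> a" if "a \<in> A" for a unfolding \<zeta>_def using finA that by simp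
  have \<zeta>_\<eta>: "\<zeta> \<le> \<eta>" by (rule \<zeta>_le) (simp add: A_def)
  have gap: "2 * \<zeta> \<le> y' - y" if "y \<in> ?Z" "y' \<in> ?Z" "y < y'" for y y'
  proof -
    have "(y, y') \<in> {p \<in> ?Z \<times> ?Z. fst p \<noteq> snd p}" using that by simp
    then have "\<bar>fst (y, y') - snd (y, y')\<bar> / 2 \<in> A" unfolding A_def by blast
    from \<zeta>_le[OF this] that(3) show ?thesis by simp
  qed
  have "\<forall>y\<in>?Z. \<exists>\<delta>>0. \<forall>r. \<bar>r - r0\<bar> < \<delta> \<longrightarrow> (\<exists>!z. \<bar>z - y\<bar> < \<zeta> \<and> bev R z r = 0)"
  proof
    fix y assume y: "y \<in> ?Z"
    have "\<zeta> \<le> e y" by (rule \<zeta>_le) (use y in \<open>simp add: A_def\<close>)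
    with y \<open>\<zeta> > 0\<close> show "\<exists>\<delta>>0. \<forall>r. \<bar>r - r0\<bar> < \<delta> \<longrightarrow> (\<exists>!z. \<bar>z - y\<bar> < \<zeta> \<and> bev R z r = 0)"
      by (intro e(2))
  qed
  then obtain \<delta> where \<delta>: "\<And>y. y \<in> ?Z \<Longrightarrow> \<delta> y > 0"
    "\<And>y r. y \<in> ?Z \<Longrightarrow> \<bar>r - r0\<bar> < \<delta> y \<Longrightarrow> \<exists>!z. \<bar>z - y\<bar> < \<zeta> \<and> bev R z r = 0"
    unfolding bchoice_iff by blast
  obtain d where d: "d > 0" "\<And>r y. \<bar>r - r0\<bar> < d \<Longrightarrow> bev R y r = 0 \<Longrightarrow>
      \<exists>y0. bev R y0 r0 = 0 \<and> \<bar>y - y0\<bar> < \<zeta>"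
    using roots_upper_semicontinuous[OF lc \<open>\<zeta> > 0\<close>] by blast
  define m where "m = Min (insert d (\<delta> ` ?Z))"
  have m: "m > 0" "m \<le> d" "\<And>y. y \<in> ?Z \<Longrightarrow> m \<le> \<delta> y"
    unfolding m_def using fin d(1) \<delta>(1) by auto
  show ?thesis
  proof (intro exI[of _ m] conjI allI impI m(1))
    fix r assume r: "\<bar>r - r0\<bar> < m"
    define h where "h y = (THE z. \<bar>z - y\<bar> < \<zeta> \<and> bev R z r = 0)" for y
    have ex1: "\<exists>!z. \<bar>z - y\<bar> < \<zeta> \<and> bev R z r = 0" if "y \<in> ?Z" for y
      by (rule \<delta>(2)[OF that]) (use m(3)[OF that] r in linarith)
    have h: "\<bar>h y - y\<bar> < \<zeta>" "bev R (h y) r = 0" if "y \<in> ?Z" for y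
      using theI'[OF ex1[OF that]] unfolding h_def by auto
    have h_eq: "h y = z" if "y \<in> ?Z" "\<bar>z - y\<bar> < \<zeta>" "bev R z r = 0" for y z
      using ex1[OF that(1)] h[OF that(1)] that by blast
    have smono: "strict_mono_on ?Z h"
    proof (rule strict_mono_onI)
      fix y y' assume "y \<in> ?Z" "y' \<in> ?Z" "y < y'"
      then show "h y < h y'" using gap[of y y'] h(1)[of y] h(1)[of y'] by linarith
    qed
    moreover have "bij_betw h ?Z {y. bev R y r = 0}"
      unfolding bij_betw_def
    proof
      show "inj_on h ?Z" using smono by (rule strict_mono_on_imp_inj_on)
      show "h ` ?Z = {y. bev R y r = 0}"
      proof (intro equalityI subsetI)
        fix z assume "z \<in> {y. bev R y r = 0}"
        then have z: "bev R z r = 0" by simp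
        obtain y0 where "bev R y0 r0 = 0" "\<bar>z - y0\<bar> < \<zeta>"
          using d(2)[OF _ z] r m(2) by force
        then show "z \<in> h ` ?Z" using h_eq[of y0 z] z by force
      qed (use h(2) in auto)
    qed
    moreover have "\<bar>h y - y\<bar> < \<eta>" if "bev R y r0 = 0" for y
      using h(1)[of y] that \<zeta>_\<eta> by simp
    ultimately show "\<exists>h. bij_betw h ?Z {y. bev R y r = 0} \<and> strict_mono_on ?Z h \<and>
        (\<forall>y. bev R y r0 = 0 \<longrightarrow> \<bar>h y - y\<bar> < \<eta>)" by blast
  qed
qed

text \<open>The branches are the \<open>i\<close>-th smallest roots. By \<open>roots_stable\<close>
  the number of roots is locally constant, hence constant, and each ranked root moves
  continuously.\<close>

lemma continuous_root_branches:
  assumes lc: "\<And>r. r \<in> {0<..<\<epsilon>} \<Longrightarrow> poly (lead_coeff R) r \<noteq> 0"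
    and simple: "\<And>r y. r \<in> {0<..<\<epsilon>} \<Longrightarrow> bev R y r = 0 \<Longrightarrow> bev (pderiv R) y r \<noteq> 0"
  shows "\<exists>\<Xi>. finite \<Xi> \<and> (\<forall>\<xi>\<in>\<Xi>. continuous_on {0<..<\<epsilon>} \<xi> \<and> (\<forall>r\<in>{0<..<\<epsilon>}. bev R (\<xi> r) r = 0)) \<and>
    (\<forall>r\<in>{0<..<\<epsilon>}. \<forall>y. bev R y r = 0 \<longrightarrow> (\<exists>\<xi>\<in>\<Xi>. y = \<xi> r))"
proof -
  let ?I = "{0<..<\<epsilon>}"
  define Z where "Z r = {y. bev R y r = 0}" for r
  define L where "L r = sorted_list_of_set (Z r)" for r
  have finZ: "finite (Z r)" if "r \<in> ?I" for r
    unfolding Z_def by (rule finite_roots[OF lc[OF that]])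
  have setL: "set (L r) = Z r" if "r \<in> ?I" for r
    using finZ[OF that] by (simp add: L_def)
  have stable: "\<exists>\<delta>>0. \<forall>r\<in>?I. \<bar>r - r0\<bar> < \<delta> \<longrightarrow> length (L r) = length (L r0) \<and>
      (\<forall>i<length (L r0). \<bar>L r ! i - L r0 ! i\<bar> < \<eta>)" if r0: "r0 \<in> ?I" and \<eta>: "\<eta> > 0" for r0 \<eta>
  proof -
    obtain \<delta> where \<delta>: "\<delta> > 0" "\<And>r. \<bar>r - r0\<bar> < \<delta> \<Longrightarrow> \<exists>h. bij_betw h (Z r0) (Z r) \<and>
        strict_mono_on (Z r0) h \<and> (\<forall>y. bev R y r0 = 0 \<longrightarrow> \<bar>h y - y\<bar> < \<eta>)"
      using roots_stable[OF lc[OF r0] simple[OF r0] \<eta>] unfolding Z_def by blast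
    have "length (L r) = length (L r0) \<and> (\<forall>i<length (L r0). \<bar>L r ! i - L r0 ! i\<bar> < \<eta>)"
      if r: "r \<in> ?I" "\<bar>r - r0\<bar> < \<delta>" for r
    proof -
      obtain h where h: "bij_betw h (Z r0) (Z r)" "strict_mono_on (Z r0) h"
        "\<And>y. y \<in> Z r0 \<Longrightarrow> \<bar>h y - y\<bar> < \<eta>"
        using \<delta>(2)[OF r(2)] unfolding Z_def by blast
      \<comment> \<open>An increasing bijection carries the sorted list of roots to the sorted list
        of roots, so ranks match.\<close>
      have "L r = map h (L r0)"
      proof (rule sorted_distinct_set_unique)
        show "set (L r) = set (map h (L r0))"
          using h(1) setL[OF r(1)] setL[OF r0] by (simp add: bij_betw_def)
        have "sorted_wrt (<) (L r0)" unfolding L_def by (rule strict_sorted_list_of_set)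
        then have "sorted_wrt (<) (map h (L r0))"
          unfolding sorted_wrt_map
          by (rule sorted_wrt_mono_rel[rotated])
            (use h(2) setL[OF r0] in \<open>auto intro: strict_mono_onD\<close>)
        then show "sorted (map h (L r0))" "distinct (map h (L r0))"
          by (simp_all add: strict_sorted_iff)
      qed (simp_all add: L_def)
      then show ?thesis using h(3) setL[OF r0] nth_mem[of _ "L r0"] by auto
    qed
    with \<delta>(1) show ?thesis by blast
  qed
  have len: "length (L r) = length (L r')" if "r \<in> ?I" "r' \<in> ?I" "r \<le> r'" for r r'
  proof -
    \<comment> \<open>Bisection turns local constancy into equality at the end points.\<close>
    have "(\<lambda>a b. length (L a) = length (L b)) r r'"
      using \<open>r \<le> r'\<close>
    proof (induction rule: Bolzano)
      case (trans a b c)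
      then show ?case by simp
    next
      case (local x)
      then have x: "x \<in> ?I" using that by auto
      obtain \<delta> where \<delta>: "\<delta> > 0" "\<And>r. r \<in> ?I \<Longrightarrow> \<bar>r - x\<bar> < \<delta> \<Longrightarrow> length (L r) = length (L x)"
        using stable[OF x, of 1] by auto
      have "length (L a) = length (L b)" if "a \<le> x" "x \<le> b" "b - a < min \<delta> (min x (\<epsilon> - x))" for a b
        using \<delta>(2)[of a] \<delta>(2)[of b] that by auto
      moreover have "min \<delta> (min x (\<epsilon> - x)) > 0" using \<delta>(1) x by auto
      ultimately show ?case by blast
    qed
    then show ?thesis .
  qed
  define N where "N = length (L (\<epsilon> / 2))"
  have lenN: "length (L r) = N" if "r \<in> ?I" for r
  proof -
    have "\<epsilon> / 2 \<in> ?I" using that by auto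
    then show ?thesis unfolding N_def using len[of r "\<epsilon> / 2"] len[of "\<epsilon> / 2" r] that
      by (cases "r \<le> \<epsilon> / 2") auto
  qed
  define \<Xi> where "\<Xi> = (\<lambda>i r. L r ! i) ` {..<N}"
  have "continuous_on ?I (\<lambda>r. L r ! i)" if i: "i < N" for i
    unfolding continuous_on_iff
  proof (intro ballI allI impI)
    fix r0 \<eta> :: real assume r0: "r0 \<in> ?I" and \<eta>: "0 < \<eta>"
    show "\<exists>d>0. \<forall>r\<in>?I. dist r r0 < d \<longrightarrow> dist (L r ! i) (L r0 ! i) < \<eta>"
      using stable[OF r0 \<eta>] lenN[OF r0] i by (auto simp: dist_real_def)
  qed
  moreover have "bev R (L r ! i) r = 0" if "i < N" "r \<in> ?I" for r i
    using nth_mem[of i "L r"] setL[OF that(2)] lenN[OF that(2)] that(1) by (simp add: Z_def)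
  moreover have "\<exists>i<N. y = L r ! i" if "r \<in> ?I" "bev R y r = 0" for r y
  proof -
    have "y \<in> set (L r)" using setL[OF that(1)] that(2) by (simp add: Z_def)
    then show ?thesis using lenN[OF that(1)] by (auto simp: in_set_conv_nth)
  qed
  ultimately show ?thesis by (intro exI[of _ \<Xi>]) (force simp: \<Xi>_def)
qed

section \<open>Monotone branches\<close>

lemma continuous_nonzero_sign:
  fixes f :: "real \<Rightarrow> real"
  assumes "continuous_on {a<..<b} f" "\<And>x. x \<in> {a<..<b} \<Longrightarrow> f x \<noteq> 0"
  shows "(\<forall>x\<in>{a<..<b}. f x > 0) \<or> (\<forall>x\<in>{a<..<b}. f x < 0)"
proof (rule ccontr)
  assume "\<not> ?thesis"
  then obtain x y where xy: "x \<in> {a<..<b}" "f x \<le> 0" "y \<in> {a<..<b}" "f y \<ge> 0" by force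
  have "connected (f ` {a<..<b})" using assms(1) by (rule connected_continuous_image) simp
  then have "0 \<in> f ` {a<..<b}" by (rule connectedD_interval) (use xy in auto)
  with assms(2) show False by auto
qed

text \<open>Branches have to cover the roots and may meet each other; a product of polynomials is
  therefore served by the union of the branches of its factors.\<close>

definition root_branches :: "real poly poly \<Rightarrow> real \<Rightarrow> (real \<Rightarrow> real) set \<Rightarrow> bool" where
  "root_branches R \<epsilon> \<Xi> \<longleftrightarrow> finite \<Xi> \<and>
    (\<forall>\<xi>\<in>\<Xi>. continuous_on {0<..<\<epsilon>} \<xi> \<and> (mono_on {0<..<\<epsilon>} \<xi> \<or> mono_on {0<..<\<epsilon>} (\<lambda>r. - \<xi> r)) \<and>
      (\<forall>r\<in>{0<..<\<epsilon>}. bev R (\<xi> r) r = 0)) \<and>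
    (\<forall>r\<in>{0<..<\<epsilon>}. \<forall>y. bev R y r = 0 \<longrightarrow> (\<exists>\<xi>\<in>\<Xi>. y = \<xi> r))"

lemma root_branches_shrink:
  assumes "root_branches R \<epsilon> \<Xi>" "\<epsilon>' \<le> \<epsilon>"
  shows "root_branches R \<epsilon>' \<Xi>"
proof -
  have sub: "{0<..<\<epsilon>'} \<subseteq> {0<..<\<epsilon>}" using assms(2) by auto
  have "mono_on {0<..<\<epsilon>'} f" if "mono_on {0<..<\<epsilon>} f" for f :: "real \<Rightarrow> real"
    using that sub by (rule mono_on_subset)
  moreover have "continuous_on {0<..<\<epsilon>'} f" if "continuous_on {0<..<\<epsilon>} f" for f :: "real \<Rightarrow> real"
    using that sub by (rule continuous_on_subset)
  moreover have "r \<in> {0<..<\<epsilon>}" if "r \<in> {0<..<\<epsilon>'}" for r using sub that by blast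
  ultimately show ?thesis using assms(1) unfolding root_branches_def by blast
qed

lemma DERIV_nonneg_mono_on:
  assumes "\<And>r. r \<in> {0<..<\<epsilon>} \<Longrightarrow> (\<xi> has_real_derivative \<xi>' r) (at r)"
    "\<And>r. r \<in> {0<..<\<epsilon>} \<Longrightarrow> 0 \<le> \<xi>' r"
  shows "mono_on {0<..<\<epsilon>} \<xi>"
proof (rule mono_onI)
  fix r s assume rs: "r \<in> {0<..<\<epsilon>}" "s \<in> {0<..<\<epsilon>}" "r \<le> s"
  show "\<xi> r \<le> \<xi> s"
  proof (rule DERIV_nonneg_imp_nondecreasing[OF rs(3)])
    fix x assume "r \<le> x" "x \<le> s"
    then have "x \<in> {0<..<\<epsilon>}" using rs by simp
    with assms show "\<exists>y. (\<xi> has_real_derivative y) (at x) \<and> 0 \<le> y" by blast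
  qed
qed

text \<open>A prime of positive degree in \<open>y\<close> divides neither its
  \<open>y\<close>-derivative nor its \<open>r\<close>-derivative, unless the latter is zero. For
  small \<open>r\<close> the slope of a branch, a quotient of the two, is thus defined and of
  constant sign.\<close>

lemma prime_root_branches:
  assumes "prime_elem R"
  shows "\<exists>\<epsilon>>0. \<exists>\<Xi>. root_branches R \<epsilon> \<Xi>"
proof (cases "degree R = 0")
  case True
  then obtain d where d: "R = [:d:]" by (rule degree_eq_zeroE)
  then have "d \<noteq> 0" using assms by auto
  from eventually_poly_nonzero[OF this] obtain \<epsilon> where "\<epsilon> > 0" "\<forall>r\<in>{0<..<\<epsilon>}. poly d r \<noteq> 0"
    unfolding eventually_at_right_field by auto
  then show ?thesis by (intro exI[of _ \<epsilon>] exI[of _ "{}"]) (auto simp: root_branches_def d)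
next
  case False
  then have deg: "degree R > 0" by simp
  let ?Rr = "map_poly pderiv R"
  have "\<forall>\<^sub>F r in at_right 0. poly (lead_coeff R) r \<noteq> 0"
    by (rule eventually_poly_nonzero) (use deg in auto)
  moreover have "\<forall>\<^sub>F r in at_right 0. \<forall>y. bev R y r = 0 \<longrightarrow> bev (pderiv R) y r \<noteq> 0"
    by (rule eventually_no_common_zero[OF assms deg not_dvd_pderiv[OF deg]])
  \<comment> \<open>If the \<open>r\<close>-derivative is zero, the branches have slope
    zero.\<close>
  moreover have "\<forall>\<^sub>F r in at_right 0. ?Rr = 0 \<or> (\<forall>y. bev R y r = 0 \<longrightarrow> bev ?Rr y r \<noteq> 0)"
  proof (cases "?Rr = 0")
    case False
    then have "\<not> R dvd ?Rr" using dvd_map_pderiv_imp_zero by blast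
    from eventually_no_common_zero[OF assms deg this] show ?thesis by (rule eventually_mono) blast
  qed simp
  ultimately have "\<forall>\<^sub>F r in at_right 0. poly (lead_coeff R) r \<noteq> 0 \<and>
      (\<forall>y. bev R y r = 0 \<longrightarrow> bev (pderiv R) y r \<noteq> 0) \<and>
      (?Rr = 0 \<or> (\<forall>y. bev R y r = 0 \<longrightarrow> bev ?Rr y r \<noteq> 0))"
    by eventually_elim blast
  then obtain \<epsilon> where "\<epsilon> > 0" and all: "\<And>r. r \<in> {0<..<\<epsilon>} \<Longrightarrow> poly (lead_coeff R) r \<noteq> 0 \<and>
      (\<forall>y. bev R y r = 0 \<longrightarrow> bev (pderiv R) y r \<noteq> 0) \<and>
      (?Rr = 0 \<or> (\<forall>y. bev R y r = 0 \<longrightarrow> bev ?Rr y r \<noteq> 0))"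
    using eventually_at_right_0E by blast
  have lc: "poly (lead_coeff R) r \<noteq> 0" if "r \<in> {0<..<\<epsilon>}" for r using all[OF that] by blast
  have simple: "bev (pderiv R) y r \<noteq> 0" if "r \<in> {0<..<\<epsilon>}" "bev R y r = 0" for r y
    using all[OF that(1)] that(2) by blast
  have Rr_nz: "bev ?Rr y r \<noteq> 0" if "r \<in> {0<..<\<epsilon>}" "?Rr \<noteq> 0" "bev R y r = 0" for r y
    using all[OF that(1)] that(2,3) by blast
  from continuous_root_branches[OF lc simple] obtain \<Xi> where \<Xi>0: "finite \<Xi> \<and>
    (\<forall>\<xi>\<in>\<Xi>. continuous_on {0<..<\<epsilon>} \<xi> \<and> (\<forall>r\<in>{0<..<\<epsilon>}. bev R (\<xi> r) r = 0)) \<and>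
    (\<forall>r\<in>{0<..<\<epsilon>}. \<forall>y. bev R y r = 0 \<longrightarrow> (\<exists>\<xi>\<in>\<Xi>. y = \<xi> r))" ..
  then have \<Xi>: "finite \<Xi>" "\<And>\<xi>. \<xi> \<in> \<Xi> \<Longrightarrow> continuous_on {0<..<\<epsilon>} \<xi>"
    "\<And>\<xi> r. \<xi> \<in> \<Xi> \<Longrightarrow> r \<in> {0<..<\<epsilon>} \<Longrightarrow> bev R (\<xi> r) r = 0" by simp_all
  have "mono_on {0<..<\<epsilon>} \<xi> \<or> mono_on {0<..<\<epsilon>} (\<lambda>r. - \<xi> r)" if \<xi>: "\<xi> \<in> \<Xi>" for \<xi>
  proof -
    define D where "D r = - bev ?Rr (\<xi> r) r / bev (pderiv R) (\<xi> r) r" for r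
    have der: "(\<xi> has_real_derivative D r) (at r)" if "r \<in> {0<..<\<epsilon>}" for r
      unfolding D_def by (rule implicit_function_DERIV[of "{0<..<\<epsilon>}"]) (use \<Xi>(2,3)[OF \<xi>] simple that in auto)
    have "(\<forall>r\<in>{0<..<\<epsilon>}. D r \<ge> 0) \<or> (\<forall>r\<in>{0<..<\<epsilon>}. D r \<le> 0)"
    proof (cases "?Rr = 0")
      case True
      then show ?thesis by (simp add: D_def)
    next
      case False
      have "continuous_on {0<..<\<epsilon>} D"
        unfolding D_def using \<Xi>(2,3)[OF \<xi>] simple by (intro continuous_intros) auto
      moreover have "D r \<noteq> 0" if "r \<in> {0<..<\<epsilon>}" for r
        using simple[OF that] Rr_nz[OF that False] \<Xi>(3)[OF \<xi> that] by (simp add: D_def)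
      ultimately have "(\<forall>r\<in>{0<..<\<epsilon>}. D r > 0) \<or> (\<forall>r\<in>{0<..<\<epsilon>}. D r < 0)"
        by (rule continuous_nonzero_sign)
      then show ?thesis by (meson less_imp_le)
    qed
    then show ?thesis
    proof
      assume "\<forall>r\<in>{0<..<\<epsilon>}. D r \<ge> 0"
      then have "mono_on {0<..<\<epsilon>} \<xi>" using DERIV_nonneg_mono_on der by blast
      then show ?thesis ..
    next
      assume "\<forall>r\<in>{0<..<\<epsilon>}. D r \<le> 0"
      then have "mono_on {0<..<\<epsilon>} (\<lambda>r. - \<xi> r)"
        by (intro DERIV_nonneg_mono_on[of \<epsilon> "\<lambda>r. - \<xi> r" "\<lambda>r. - D r"] DERIV_minus der) auto
      then show ?thesis ..
    qed
  qed
  with \<Xi>0 have "root_branches R \<epsilon> \<Xi>" unfolding root_branches_def by simp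
  with \<open>\<epsilon> > 0\<close> show ?thesis by blast
qed

theorem exists_root_branches:
  assumes "R \<noteq> 0"
  shows "\<exists>\<epsilon>>0. \<exists>\<Xi>. root_branches R \<epsilon> \<Xi>"
  using assms
proof (induction R rule: prime_divisors_induct)
  case (unit R)
  then obtain S where "1 = R * S" by (auto elim: dvdE)
  then have "bev R y r * bev S y r = 1" for y r by (metis bev_1 bev_mult)
  then have "bev R y r \<noteq> 0" for y r by (metis mult_zero_left zero_neq_one)
  then show ?case by (intro exI[of _ 1] conjI exI[of _ "{}"]) (auto simp: root_branches_def)
next
  case (factor p S)
  then obtain \<epsilon>1 \<Xi>1 where 1: "\<epsilon>1 > 0" "root_branches S \<epsilon>1 \<Xi>1" by auto
  obtain \<epsilon>2 \<Xi>2 where 2: "\<epsilon>2 > 0" "root_branches p \<epsilon>2 \<Xi>2"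
    using prime_root_branches factor.hyps prime_imp_prime_elem by blast
  let ?e = "min \<epsilon>1 \<epsilon>2"
  have "root_branches S ?e \<Xi>1" "root_branches p ?e \<Xi>2"
    using root_branches_shrink[OF 1(2)] root_branches_shrink[OF 2(2)] by simp_all
  then have "root_branches (p * S) ?e (\<Xi>1 \<union> \<Xi>2)"
    unfolding root_branches_def bev_mult mult_eq_0_iff finite_Un by blast
  with 1(1) 2(1) show ?case by (intro exI[of _ ?e]) auto
qed simp

section \<open>The Lojasiewicz inequality on a box\<close>

lemma poly_poly_eq_bev: "poly (poly S q) r = bev S (poly q r) r"
  by (induction S) (simp_all add: bev_def)

text \<open>Substituting \<open>y + c\<close> for \<open>y\<close>. It serves to compare an
  algebraic germ with a polynomial \<open>c\<close> in \<open>r\<close>.\<close>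

lemma exists_shift_relation:
  assumes "S \<noteq> 0"
  shows "\<exists>S'. S' \<noteq> 0 \<and> (\<forall>y r. bev S y r = 0 \<longrightarrow> bev S' (y - poly c r) r = 0)"
proof (intro exI conjI allI impI)
  show "pcompose S [:c, 1:] \<noteq> 0" using assms by (simp add: pcompose_eq_0_iff)
  fix y r assume "bev S y r = 0"
  then show "bev (pcompose S [:c, 1:]) (y - poly c r) r = 0"
    by (simp add: bev_def[of "pcompose S [:c, 1:]"] poly_pcompose poly_poly_eq_bev)
qed

lemma (in elimination) Sp_sum:
  "(\<And>a. a \<in> A \<Longrightarrow> F a \<in> Sp B) \<Longrightarrow> (\<lambda>s. \<Sum>a\<in>A. F a s) \<in> Sp B"
  by (induction A rule: infinite_finite_induct) (auto intro: Sp_0 Sp_add)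

text \<open>The equation of \<open>\<xi> j\<close> expresses the leading coefficient times
  \<open>\<xi> j ^ D j\<close> by lower powers, so the branches satisfy the hypotheses of
  \<open>eliminate\<close> once exponents and leading factors agree.\<close>

lemma algebraic_germ:
  fixes p :: "real^'n \<Rightarrow> real" and \<xi> :: "'n \<Rightarrow> real \<Rightarrow> real"
  assumes R: "\<And>j. R j \<noteq> 0" and root: "\<And>j. \<forall>\<^sub>F r in at_right 0. bev (R j) (\<xi> j r) r = 0"
    and p: "polyfun p"
  shows "\<exists>S. S \<noteq> 0 \<and> (\<forall>\<^sub>F r in at_right 0. bev S (p (\<chi> j. \<xi> j r)) r = 0)"
proof -
  interpret elimination "poly :: real poly \<Rightarrow> real \<Rightarrow> real" \<xi>
    by unfold_locales simp_all
  define D where "D j = degree (R j)" for j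
  \<comment> \<open>A common exponent above all degrees: each equation is multiplied by
    \<open>\<xi> j ^ (M - D j)\<close> and by the leading coefficients of the others, whose product
    with its own is \<open>l\<close>.\<close>
  define M where "M = Suc (\<Sum>j\<in>UNIV. D j)"
  have DM: "D j < M" for j
    unfolding M_def using member_le_sum[of j UNIV D] by simp
  define l where "l = (\<Prod>j\<in>UNIV. lead_coeff (R j))"
  define q where "q j r = poly (- (\<Prod>i\<in>UNIV - {j}. lead_coeff (R i))) r
      * (\<Sum>k<D j. poly (coeff (R j) k) r * \<xi> j r ^ (k + (M - D j)))" for j r
  define S0 where "S0 = {r. \<forall>j. bev (R j) (\<xi> j r) r = 0}"
  have q: "q j \<in> Sp (Mons (M - 1))" for j
    unfolding q_def
  proof (intro Sp_scale Sp_sum)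
    fix k assume "k \<in> {..<D j}"
    then have "(k + (M - D j)) * 1 \<le> M - 1" using DM[of j] by simp
    from Sp_mono[OF Sp_power[OF Sp_var[OF order_refl]] Mons_mono[OF this]]
    show "(\<lambda>s. \<xi> j s ^ (k + (M - D j))) \<in> Sp (Mons (M - 1))" .
  qed
  have rel: "poly l r * \<xi> j r ^ M = q j r" if "r \<in> S0" for j r
  proof -
    let ?P = "\<Prod>i\<in>UNIV - {j}. lead_coeff (R i)"
    have l: "l = lead_coeff (R j) * ?P" unfolding l_def by (simp add: prod.remove[of UNIV j])
    have "0 = bev (R j) (\<xi> j r) r" using that by (simp add: S0_def)
    also have "\<dots> = (\<Sum>k<D j. poly (coeff (R j) k) r * \<xi> j r ^ k) + poly (lead_coeff (R j)) r * \<xi> j r ^ D j"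
      by (simp add: bev_altdef D_def lessThan_Suc_atMost[symmetric])
    finally have top: "poly (lead_coeff (R j)) r * \<xi> j r ^ D j = - (\<Sum>k<D j. poly (coeff (R j) k) r * \<xi> j r ^ k)"
      by simp
    have "poly l r * \<xi> j r ^ M = poly ?P r * ((poly (lead_coeff (R j)) r * \<xi> j r ^ D j) * \<xi> j r ^ (M - D j))"
      using DM[of j] by (simp add: l power_add[symmetric] mult_ac)
    also have "\<dots> = q j r"
      unfolding top q_def by (simp add: sum_distrib_left sum_negf power_add mult_ac)
    finally show ?thesis .
  qed
  obtain d where d: "poly_deg_le d p" using p by (auto simp: polyfun_def)
  have pS: "(\<lambda>r. p (\<chi> j. \<xi> j r)) \<in> Sp (Mons d)"
    by (rule Sp_poly_deg_le[OF d]) (rule exI[of _ "[:_:]"], simp)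
  obtain B c where c: "\<exists>k\<le>B. c k \<noteq> 0"
    "\<And>r. r \<in> S0 \<Longrightarrow> poly l r \<noteq> 0 \<Longrightarrow> (\<Sum>k\<le>B. poly (c k) r * p (\<chi> j. \<xi> j r) ^ k) = 0"
    by (rule eliminate[OF q _ rel pS, where S = S0]) (auto simp: M_def)
  define S where "S = (\<Sum>k\<le>B. monom (c k) k)"
  have "coeff S k = c k" if "k \<le> B" for k using that by (simp add: S_def coeff_sum)
  with c(1) have "S \<noteq> 0" by (metis coeff_0)
  have "\<forall>\<^sub>F r in at_right 0. poly l r \<noteq> 0"
    by (rule eventually_poly_nonzero) (simp add: l_def R)
  moreover have "\<forall>\<^sub>F r in at_right 0. r \<in> S0"
    using eventually_ball_finite[of "UNIV :: 'n set" "\<lambda>r j. bev (R j) (\<xi> j r) r = 0"] root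
    by (simp add: S0_def)
  ultimately have "\<forall>\<^sub>F r in at_right 0. bev S (p (\<chi> j. \<xi> j r)) r = 0"
    by eventually_elim (simp add: S_def bev_sum bev_monom c(2))
  with \<open>S \<noteq> 0\<close> show ?thesis by blast
qed

text \<open>With \<open>S\<close> equal to \<open>y ^ t\<close> times \<open>S'\<close>, and
  \<open>S'\<close> nonzero at \<open>y = 0\<close>, the zeros of \<open>k\<close> and the zeros of
  \<open>S'\<close> along \<open>k\<close> are disjoint closed sets that cover an interval. By
  connectedness \<open>k\<close> vanishes everywhere or nowhere.\<close>

lemma algebraic_trichotomy:
  assumes "\<epsilon> > 0" "continuous_on {0<..<\<epsilon>} k" "S \<noteq> 0" "\<forall>\<^sub>F r in at_right 0. bev S (k r) r = 0"
  shows "(\<forall>\<^sub>F r in at_right 0. k r > 0) \<or> (\<forall>\<^sub>F r in at_right 0. k r = 0) \<or> (\<forall>\<^sub>F r in at_right 0. k r < 0)"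
proof -
  obtain t S' where S': "S = monom 1 t * S'" "coeff S' 0 \<noteq> 0"
    using poly_family_divide_X[of 0 "\<lambda>_. S"] assms(3) by auto
  have "\<forall>\<^sub>F r in at_right 0. bev S (k r) r = 0 \<and> poly (coeff S' 0) r \<noteq> 0 \<and> r \<in> {0<..<\<epsilon>}"
    by (intro eventually_conj assms eventually_poly_nonzero S' eventually_at_right_real)
  then obtain \<epsilon>' where \<epsilon>': "\<epsilon>' > 0" and all: "\<And>r. r \<in> {0<..<\<epsilon>'} \<Longrightarrow>
      bev S (k r) r = 0 \<and> poly (coeff S' 0) r \<noteq> 0 \<and> r \<in> {0<..<\<epsilon>}"
    using eventually_at_right_0E by blast
  let ?I = "{0<..<\<epsilon>'}"
  have ev: "\<forall>\<^sub>F r in at_right 0. P r" if "\<forall>r\<in>?I. P r" for P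
    by (rule eventually_mono[OF eventually_at_right_real[OF \<epsilon>']]) (use that in blast)
  have "?I \<subseteq> {0<..<\<epsilon>}" using all by blast
  then have cont: "continuous_on ?I k" by (rule continuous_on_subset[OF assms(2)])
  let ?A = "{r \<in> ?I. k r = 0}" and ?B = "{r \<in> ?I. bev S' (k r) r = 0}"
  have A: "closedin (top_of_set ?I) ?A" by (rule continuous_closedin_preimage_constant[OF cont])
  have B: "closedin (top_of_set ?I) ?B"
    by (rule continuous_closedin_preimage_constant) (intro continuous_intros cont)
  have disj: "?A \<inter> ?B = {}"
  proof -
    have "bev S' 0 r = poly (coeff S' 0) r" for r by (simp add: bev_def poly_0_coeff_0)
    then show ?thesis using all by auto
  qed
  have "?I \<subseteq> ?A \<union> ?B"
  proof
    fix r assume r: "r \<in> ?I"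
    then have "bev S (k r) r = 0" using all by blast
    then have "k r = 0 \<or> bev S' (k r) r = 0" by (auto simp: S'(1) bev_monom)
    with r show "r \<in> ?A \<union> ?B" by blast
  qed
  moreover have "connected ?I" by simp
  ultimately have "?A = {} \<or> ?B = {}"
    using A B disj unfolding connected_closedin by blast
  then show ?thesis
  proof
    assume "?B = {}"
    with \<open>?I \<subseteq> ?A \<union> ?B\<close> have "\<forall>r\<in>?I. k r = 0" by blast
    from ev[OF this] show ?thesis by blast
  next
    assume "?A = {}"
    then have "\<And>r. r \<in> ?I \<Longrightarrow> k r \<noteq> 0" by blast
    from continuous_nonzero_sign[OF cont this] show ?thesis using ev by blast
  qed
qed

text \<open>A one-sided substitute for a Puiseux expansion: after division by a power of
  \<open>r\<close> the relation reads \<open>y ^ m * g(y) = - r * w\<close> with \<open>g(0)\<close>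
  nonzero and \<open>w\<close> bounded, so \<open>y ^ m\<close> is at most a multiple of
  \<open>r\<close>.\<close>

lemma algebraic_small_imp_power_bound:
  assumes "S \<noteq> 0" "(y \<longlongrightarrow> 0) (at_right 0)" "\<forall>\<^sub>F r in at_right 0. bev S (y r) r = 0"
  shows "\<exists>\<delta>>0. \<forall>\<^sub>F r in at_right 0. \<bar>y r\<bar> \<le> r powr \<delta>"
proof -
  let ?F = "at_right (0::real)"
  define B where "B = degree S"
  have "\<exists>k\<le>B. coeff S k \<noteq> 0" using assms(1) by (intro exI[of _ B]) (simp add: B_def)
  from poly_family_divide_X[OF this] obtain t e where
    e: "\<And>k. k \<le> B \<Longrightarrow> coeff S k = monom 1 t * e k" "\<exists>k\<le>B. coeff (e k) 0 \<noteq> 0" by blast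
  \<comment> \<open>\<open>p\<close> is the divided relation at \<open>r = 0\<close>, and
    \<open>r * w\<close> is the rest.\<close>
  define p where "p = (\<Sum>k\<le>B. monom (coeff (e k) 0) k)"
  define w where "w r = (\<Sum>k\<le>B. poly (poly_shift 1 (e k)) r * y r ^ k)" for r
  have "coeff p k = coeff (e k) 0" if "k \<le> B" for k using that by (simp add: p_def coeff_sum)
  with e(2) have "p \<noteq> 0" by (metis coeff_0)
  then obtain m g where g: "p = monom 1 m * g" "coeff g 0 \<noteq> 0"
    using poly_family_divide_X[of 0 "\<lambda>_. p"] by auto
  have e_split: "poly (e k) r = coeff (e k) 0 + r * poly (poly_shift 1 (e k)) r" for k r
  proof -
    have "e k = pCons (coeff (e k) 0) (poly_shift 1 (e k))"
      by (rule poly_eqI) (simp add: coeff_pCons coeff_poly_shift split: nat.split)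
    then show ?thesis by (metis poly_pCons)
  qed
  have rel: "\<forall>\<^sub>F r in ?F. y r ^ m * poly g (y r) = - r * w r"
    using assms(3) eventually_at_right_less[of 0]
  proof eventually_elim
    case (elim r)
    have "0 = (\<Sum>k\<le>B. poly (coeff S k) r * y r ^ k)" using elim(1) by (simp add: bev_altdef B_def)
    also have "\<dots> = r ^ t * (\<Sum>k\<le>B. poly (e k) r * y r ^ k)"
      by (simp add: e(1) poly_monom sum_distrib_left mult.assoc)
    finally have "0 = (\<Sum>k\<le>B. poly (e k) r * y r ^ k)" using elim(2) by simp
    also have "\<dots> = poly p (y r) + r * w r"
      by (simp add: e_split p_def w_def poly_sum poly_monom sum_distrib_left sum.distrib algebra_simps)
    finally show ?case by (simp add: g(1) poly_monom)
  qed
  have r_lim: "((\<lambda>r. r) \<longlongrightarrow> 0) ?F" by (rule tendsto_ident_at)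
  have w_lim: "(w \<longlongrightarrow> (\<Sum>k\<le>B. poly (poly_shift 1 (e k)) 0 * 0 ^ k)) ?F"
    unfolding w_def by (intro tendsto_intros assms(2) r_lim)
  then obtain W where W: "W > 0" "\<forall>\<^sub>F r in ?F. \<bar>w r\<bar> \<le> W"
  proof -
    let ?l = "\<Sum>k\<le>B. poly (poly_shift 1 (e k)) 0 * 0 ^ k"
    have "\<forall>\<^sub>F r in ?F. dist (w r) ?l < 1" by (rule tendstoD[OF w_lim]) simp
    then have "\<forall>\<^sub>F r in ?F. \<bar>w r\<bar> \<le> \<bar>?l\<bar> + 1" by eventually_elim (auto simp: dist_real_def)
    then show ?thesis by (intro that[of "\<bar>?l\<bar> + 1"]) auto
  qed
  have "((\<lambda>r. \<bar>poly g (y r)\<bar>) \<longlongrightarrow> \<bar>poly g 0\<bar>) ?F" by (intro tendsto_intros assms(2))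
  moreover have "\<bar>poly g 0\<bar> / 2 < \<bar>poly g 0\<bar>" using g(2) by (simp add: poly_0_coeff_0)
  ultimately have g_ge: "\<forall>\<^sub>F r in ?F. \<bar>poly g 0\<bar> / 2 < \<bar>poly g (y r)\<bar>" by (rule order_tendstoD)
  define c where "c = \<bar>poly g 0\<bar> / 2"
  have c: "c > 0" using g(2) by (simp add: c_def poly_0_coeff_0)
  have bound: "\<forall>\<^sub>F r in ?F. \<bar>y r\<bar> ^ m \<le> W / c * r"
    using rel W(2) g_ge eventually_at_right_less[of 0]
  proof eventually_elim
    case (elim r)
    have "\<bar>y r\<bar> ^ m * c \<le> \<bar>y r\<bar> ^ m * \<bar>poly g (y r)\<bar>"
      using elim(3) by (intro mult_left_mono) (auto simp: c_def)
    also have "\<dots> = r * \<bar>w r\<bar>"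
      using arg_cong[OF elim(1), of abs] elim(4) by (simp add: abs_mult power_abs)
    also have "\<dots> \<le> r * W" using elim by (intro mult_left_mono) auto
    finally show ?case using c by (simp add: field_simps)
  qed
  \<comment> \<open>Half of the exponent is given up to absorb the constant; hence
    \<open>1 / (2 * m)\<close> at the end.\<close>
  have small: "\<forall>\<^sub>F r in ?F. W / c * r < r powr (1 / 2)"
    using W(1) c by real_asymp
  have m: "m \<noteq> 0"
  proof
    assume "m = 0"
    have "\<forall>\<^sub>F r in ?F. r powr (1 / 2) < 1" by real_asymp
    with bound small have "\<forall>\<^sub>F r in ?F. False"
      by eventually_elim (simp add: \<open>m = 0\<close>)
    then show False by simp
  qed
  have "\<forall>\<^sub>F r in ?F. \<bar>y r\<bar> \<le> r powr (1 / (2 * real m))"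
    using bound small eventually_at_right_less[of 0]
  proof eventually_elim
    case (elim r)
    then have "\<bar>y r\<bar> ^ m \<le> r powr (1 / 2)" by linarith
    also have "\<dots> = (r powr (1 / (2 * real m))) ^ m"
      using m elim by (simp add: powr_power)
    finally show ?case using m by (simp add: power_mono_iff)
  qed
  then show ?thesis using m by (intro exI[of _ "1 / (2 * real m)"]) simp
qed

text \<open>\<open>large\<close> says that \<open>r\<^sup>2 / k r\<close> tends to \<open>0\<close>.
  This quotient is algebraic too, hence at most \<open>r powr \<delta>\<close>.\<close>

lemma algebraic_lower_bound:
  assumes "S \<noteq> 0" "\<forall>\<^sub>F r in at_right 0. bev S (k r) r = 0"
    and large: "\<And>C. \<forall>\<^sub>F r in at_right 0. k r > C * r\<^sup>2"
  shows "\<exists>\<delta>>0. \<forall>\<^sub>F r in at_right 0. r powr (2 - \<delta>) \<le> k r"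
proof -
  let ?F = "at_right (0::real)"
  define D where "D = degree S"
  \<comment> \<open>The polynomial \<open>y ^ D * S(r\<^sup>2 / y, r)\<close>; its constant
    coefficient comes from the leading coefficient of \<open>S\<close>.\<close>
  define S' where "S' = (\<Sum>j\<le>D. monom (coeff S j * monom 1 (2 * j)) (D - j))"
  have "coeff S' 0 = (\<Sum>j\<le>D. if j = D then coeff S j * monom 1 (2 * j) else 0)"
    unfolding S'_def coeff_sum by (rule sum.cong) auto
  then have "coeff S' 0 \<noteq> 0" using assms(1) by (simp add: D_def)
  then have "S' \<noteq> 0" by auto
  have pos: "\<forall>\<^sub>F r in ?F. k r > 0" using large[of 0] by simp
  have "\<forall>\<^sub>F r in ?F. bev S' (r\<^sup>2 / k r) r = 0"
    using assms(2) pos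
  proof eventually_elim
    case (elim r)
    have "k r ^ D * bev S' (r\<^sup>2 / k r) r = (\<Sum>j\<le>D. r ^ (2 * D) * (poly (coeff S j) r * k r ^ j))"
      unfolding S'_def bev_sum bev_monom sum_distrib_left
    proof (rule sum.cong[OF refl])
      fix j assume "j \<in> {..D}"
      then have j: "k r ^ D = k r ^ j * k r ^ (D - j)" "r ^ (2 * D) = r ^ (2 * j) * (r\<^sup>2) ^ (D - j)"
        by (simp_all add: power_add[symmetric] power_mult[symmetric] flip: distrib_left)
      show "k r ^ D * (poly (coeff S j * monom 1 (2 * j)) r * (r\<^sup>2 / k r) ^ (D - j))
          = r ^ (2 * D) * (poly (coeff S j) r * k r ^ j)"
        unfolding j using elim(2) by (simp add: poly_monom power_divide)
    qed
    also have "\<dots> = r ^ (2 * D) * bev S (k r) r"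
      by (simp add: bev_altdef D_def sum_distrib_left)
    finally show ?case using elim by simp
  qed
  moreover have "((\<lambda>r. r\<^sup>2 / k r) \<longlongrightarrow> 0) ?F"
  proof (rule tendstoI)
    fix e :: real assume e: "e > 0"
    show "\<forall>\<^sub>F r in ?F. dist (r\<^sup>2 / k r) 0 < e"
      using large[of "1 / e"] pos
    proof eventually_elim
      case (elim r)
      then show ?case using e by (simp add: dist_real_def field_simps)
    qed
  qed
  ultimately obtain \<delta> where \<delta>: "\<delta> > 0" "\<forall>\<^sub>F r in ?F. \<bar>r\<^sup>2 / k r\<bar> \<le> r powr \<delta>"
    using algebraic_small_imp_power_bound[OF \<open>S' \<noteq> 0\<close>] by blast
  have "\<forall>\<^sub>F r in ?F. r powr (2 - \<delta>) \<le> k r"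
    using \<delta>(2) pos eventually_at_right_less[of 0]
  proof eventually_elim
    case (elim r)
    then have "r\<^sup>2 \<le> r powr \<delta> * k r" by (simp add: field_simps)
    moreover have "r powr (2 - \<delta>) * r powr \<delta> = r\<^sup>2"
      using elim(3) by (simp add: powr_add[symmetric])
    ultimately have "r powr (2 - \<delta>) * r powr \<delta> \<le> k r * r powr \<delta>" by (simp add: mult.commute)
    then show ?case using elim(3) by simp
  qed
  with \<delta>(1) show ?thesis by blast
qed

section \<open>Gradient bounds along branches, on the cube and on the box\<close>

text \<open>In the variables \<open>t\<close>, the function \<open>E\<close> has the weighted sum as
  squared gradient, so \<open>r\<close> grows by at most about \<open>K * r\<close> per unit of
  length. Then \<open>ln r\<close> is controlled by the total variation of \<open>t\<close>, which
  monotonicity and the range of \<open>arccos\<close> bound, although \<open>ln r\<close> is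
  unbounded at \<open>0\<close>.\<close>

lemma no_quadratic_gradient_decay:
  fixes f :: "real^'n \<Rightarrow> real" and \<xi> :: "'n \<Rightarrow> real \<Rightarrow> real"
  assumes "\<epsilon> > 0" and f: "\<And>x. GDERIV f x :> D x"
    and cont: "\<And>j. continuous_on {0<..<\<epsilon>} (\<xi> j)"
    and mono: "\<And>j. mono_on {0<..<\<epsilon>} (\<xi> j) \<or> mono_on {0<..<\<epsilon>} (\<lambda>r. - \<xi> j r)"
    and unit: "\<And>j r. r \<in> {0<..<\<epsilon>} \<Longrightarrow> \<bar>\<xi> j r\<bar> \<le> 1"
    and level: "\<And>r. r \<in> {0<..<\<epsilon>} \<Longrightarrow> f (\<chi> j. \<xi> j r) = r"
    and decay: "\<And>r. r \<in> {0<..<\<epsilon>} \<Longrightarrow>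
      (\<Sum>j\<in>UNIV. (1 - (\<xi> j r)\<^sup>2) * (D (\<chi> j. \<xi> j r) $ j)\<^sup>2) \<le> C * r\<^sup>2"
  shows False
proof -
  let ?I = "{0<..<\<epsilon>}"
  define t where "t r = (\<chi> j. arccos (\<xi> j r))" for r
  define E where "E x = f (\<chi> j. cos (x $ j))" for x :: "real^'n"
  have cos_t: "cos (t r $ j) = \<xi> j r" if "r \<in> ?I" for r j
    using unit[OF that, of j] by (simp add: t_def cos_arccos_abs)
  have E_t: "E (t r) = r" if "r \<in> ?I" for r
    using cos_t[OF that] level[OF that] by (simp add: E_def)
  have sin_t: "(sin (t r $ j))\<^sup>2 = 1 - (\<xi> j r)\<^sup>2" if "r \<in> ?I" for r j
    using cos_t[OF that, of j] by (simp add: sin_squared_eq)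
  have t_cont: "continuous_on ?I t"
    unfolding t_def using unit cont by (intro continuous_intros) (auto simp: abs_le_iff)
  \<comment> \<open>The summand \<open>1\<close> pays for the error of the linearization, taken with
    tolerance \<open>r0\<close>.\<close>
  define K where "K = sqrt (max C 0) + 1"
  have K: "K \<ge> 1" by (simp add: K_def)
  have E_der: "(E has_derivative (\<lambda>h. (\<chi> j. - sin (x $ j) * h $ j) \<bullet> D (\<chi> j. cos (x $ j)))) (at x)" for x
  proof -
    have "((\<lambda>x::real^'n. \<chi> j. cos (x $ j)) has_derivative (\<lambda>h. \<chi> j. - sin (x $ j) * h $ j)) (at x)"
    proof (subst has_derivative_componentwise_within, intro ballI)
      fix i :: "real^'n" assume "i \<in> Basis"
      then obtain j where i: "i = axis j 1" by (auto simp: Basis_vec_def)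
      have "((\<lambda>x::real^'n. x $ j) has_derivative (\<lambda>h. h $ j)) (at x)"
        by (rule bounded_linear_imp_has_derivative[OF bounded_linear_vec_nth])
      then have "((\<lambda>x::real^'n. cos (x $ j)) has_derivative (\<lambda>h. - sin (x $ j) * h $ j)) (at x)"
        by (auto intro!: derivative_eq_intros simp: mult.commute)
      then show "((\<lambda>x. (\<chi> j. cos (x $ j)) \<bullet> i) has_derivative (\<lambda>h. (\<chi> j. - sin (x $ j) * h $ j) \<bullet> i)) (at x)"
        by (simp add: i inner_axis)
    qed
    from has_derivative_compose[OF this, of f] f show ?thesis
      unfolding E_def gderiv_def by blast
  qed
  \<comment> \<open>Only \<open>E\<close> is differentiated: \<open>t\<close> is merely continuous,
    since \<open>arccos\<close> has infinite slope at the end points.\<close>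
  have local_bound: "\<exists>d>0. \<forall>r\<in>?I. \<bar>r - r0\<bar> < d \<longrightarrow> \<bar>r - r0\<bar> \<le> K * r0 * norm (t r - t r0)"
    if r0: "r0 \<in> ?I" for r0
  proof -
    let ?L = "\<lambda>h. (\<chi> j. - sin (t r0 $ j) * h $ j) \<bullet> D (\<chi> j. cos (t r0 $ j))"
    have "r0 > 0" using r0 by simp
    then obtain d where d: "d > 0" "\<And>x. norm (x - t r0) < d \<Longrightarrow>
        norm (E x - E (t r0) - ?L (x - t r0)) \<le> r0 * norm (x - t r0)"
      using E_der[of "t r0"] unfolding has_derivative_at_alt by blast
    have L: "\<bar>?L h\<bar> \<le> sqrt (max C 0) * r0 * norm h" for h
    proof -
      define G where "G = (\<chi> j. - sin (t r0 $ j) * D (\<chi> j. cos (t r0 $ j)) $ j)"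
      have "?L h = G \<bullet> h" by (simp add: G_def inner_vec_def mult_ac)
      also have "\<bar>\<dots>\<bar> \<le> norm G * norm h" by (rule Cauchy_Schwarz_ineq2)
      also have "norm G \<le> sqrt (max C 0) * r0"
      proof -
        have "(norm G)\<^sup>2 = (\<Sum>j\<in>UNIV. (G $ j)\<^sup>2)"
          unfolding power2_norm_eq_inner inner_vec_def by (simp add: power2_eq_square)
        also have "\<dots> = (\<Sum>j\<in>UNIV. (1 - (\<xi> j r0)\<^sup>2) * (D (\<chi> j. \<xi> j r0) $ j)\<^sup>2)"
          by (simp add: G_def power_mult_distrib sin_t[OF r0] cos_t[OF r0])
        also have "\<dots> \<le> C * r0\<^sup>2" by (rule decay[OF r0])
        also have "\<dots> \<le> max C 0 * r0\<^sup>2" by (intro mult_right_mono) auto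
        also have "\<dots> = (sqrt (max C 0) * r0)\<^sup>2" by (simp add: power_mult_distrib)
        finally show ?thesis using \<open>r0 > 0\<close> by (simp add: power2_le_iff_abs_le)
      qed
      finally show ?thesis by (simp add: mult_right_mono)
    qed
    obtain d' where d': "d' > 0" "\<And>r. r \<in> ?I \<Longrightarrow> \<bar>r - r0\<bar> < d' \<Longrightarrow> norm (t r - t r0) < d"
      using t_cont r0 d(1) unfolding continuous_on_iff dist_norm real_norm_def by blast
    have "\<bar>r - r0\<bar> \<le> K * r0 * norm (t r - t r0)" if r: "r \<in> ?I" "\<bar>r - r0\<bar> < d'" for r
    proof -
      have "\<bar>E (t r) - E (t r0) - ?L (t r - t r0)\<bar> \<le> r0 * norm (t r - t r0)"
        using d(2)[OF d'(2)[OF r]] by simp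
      then have "\<bar>r - r0\<bar> \<le> \<bar>?L (t r - t r0)\<bar> + r0 * norm (t r - t r0)"
        unfolding E_t[OF r(1)] E_t[OF r0] by linarith
      also have "\<dots> \<le> sqrt (max C 0) * r0 * norm (t r - t r0) + r0 * norm (t r - t r0)"
        using L[of "t r - t r0"] by linarith
      finally show ?thesis by (simp add: K_def algebra_simps)
    qed
    with d'(1) show ?thesis by blast
  qed
  \<comment> \<open>\<open>arccos\<close> reverses order, so an increasing \<open>\<xi> j\<close>
    gets the sign \<open>-1\<close>; \<open>V\<close> then measures the variation of
    \<open>t\<close>.\<close>
  define s where "s j = (if mono_on ?I (\<xi> j) then -1 else 1 :: real)" for j
  define V where "V r = (\<Sum>j\<in>UNIV. s j * t r $ j)" for r
  have t_mono: "\<bar>t r' $ j - t r $ j\<bar> = s j * t r' $ j - s j * t r $ j"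
    if rr: "r \<in> ?I" "r' \<in> ?I" "r \<le> r'" for r r' j
  proof (cases "mono_on ?I (\<xi> j)")
    case True
    then have "\<xi> j r \<le> \<xi> j r'" using rr by (rule mono_onD)
    then have "arccos (\<xi> j r') \<le> arccos (\<xi> j r)"
      using unit[OF rr(1), of j] unit[OF rr(2), of j] by (intro arccos_le_arccos) (auto simp: abs_le_iff)
    with True show ?thesis by (simp add: s_def t_def)
  next
    case False
    then have "mono_on ?I (\<lambda>r. - \<xi> j r)" using mono[of j] by blast
    from mono_onD[OF this rr] have "\<xi> j r' \<le> \<xi> j r" by simp
    then have "arccos (\<xi> j r) \<le> arccos (\<xi> j r')"
      using unit[OF rr(1), of j] unit[OF rr(2), of j] by (intro arccos_le_arccos) (auto simp: abs_le_iff)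
    with False show ?thesis by (simp add: s_def t_def)
  qed
  have t_V: "norm (t r' - t r) \<le> V r' - V r" if rr: "r \<in> ?I" "r' \<in> ?I" "r \<le> r'" for r r'
  proof -
    have "norm (t r' - t r) \<le> (\<Sum>j\<in>UNIV. \<bar>(t r' - t r) $ j\<bar>)" by (rule norm_le_l1_cart)
    also have "\<dots> = V r' - V r"
      by (simp add: t_mono[OF rr] V_def sum_subtractf)
    finally show ?thesis .
  qed
  have V_bound: "\<bar>V r\<bar> \<le> real CARD('n) * pi" if "r \<in> ?I" for r
  proof -
    have "\<bar>V r\<bar> \<le> (\<Sum>j\<in>UNIV. \<bar>s j * t r $ j\<bar>)" unfolding V_def by (rule sum_abs)
    also have "\<dots> \<le> (\<Sum>j\<in>(UNIV::'n set). pi)"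
    proof (rule sum_mono)
      fix j
      have "0 \<le> t r $ j \<and> t r $ j \<le> pi"
        using unit[OF that, of j] by (simp add: t_def abs_le_iff arccos_lbound arccos_ubound)
      then show "\<bar>s j * t r $ j\<bar> \<le> pi" by (simp add: s_def abs_mult)
    qed
    finally show ?thesis by simp
  qed
  \<comment> \<open>The factor \<open>2\<close> is needed to the left of a point \<open>x\<close>,
    where the slope of \<open>ln\<close> at \<open>a \<ge> x / 2\<close> is at most
    \<open>2 / x\<close>.\<close>
  have increasing: "2 * K * V r - ln r \<le> 2 * K * V r' - ln r'"
    if rr: "r \<in> ?I" "r' \<in> ?I" "r \<le> r'" for r r'
    using rr(3)
  proof (induction rule: Bolzano)
    case (trans a b c)
    then show ?case by linarith
  next
    case (local x)
    then have x: "x \<in> ?I" using rr by auto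
    obtain d where d: "d > 0" "\<And>r. r \<in> ?I \<Longrightarrow> \<bar>r - x\<bar> < d \<Longrightarrow> \<bar>r - x\<bar> \<le> K * x * norm (t r - t x)"
      using local_bound[OF x] by blast
    let ?d = "min d (min (x / 2) (\<epsilon> - x))"
    have "2 * K * V a - ln a \<le> 2 * K * V b - ln b" if ab: "a \<le> x" "x \<le> b" "b - a < ?d" for a b
    proof -
      have aI: "a \<in> ?I" "a \<ge> x / 2" and bI: "b \<in> ?I" using ab x by auto
      have "x - a \<le> K * x * (V x - V a)"
      proof -
        have "x - a \<le> K * x * norm (t a - t x)" using d(2)[OF aI(1)] ab by auto
        also have "\<dots> \<le> K * x * (V x - V a)"
          using t_V[OF aI(1) x ab(1)] K x by (intro mult_left_mono) (auto simp: norm_minus_commute)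
        finally show ?thesis .
      qed
      moreover have "ln x - ln a \<le> (x - a) / a" using aI x by (intro ln_diff_le) auto
      moreover have "(x - a) / a \<le> (x - a) / (x / 2)"
        using aI x ab by (intro divide_left_mono) auto
      moreover have "(x - a) / (x / 2) \<le> 2 * K * (V x - V a)" if "x - a \<le> K * x * (V x - V a)"
        using that x by (simp add: field_simps)
      ultimately have 1: "ln x - ln a \<le> 2 * K * (V x - V a)" by linarith
      have "b - x \<le> K * x * norm (t b - t x)" using d(2)[OF bI] ab by auto
      also have "\<dots> \<le> K * x * (V b - V x)"
        using t_V[OF x bI ab(2)] K x by (intro mult_left_mono) auto
      finally have "(b - x) / x \<le> K * (V b - V x)" using x by (simp add: field_simps)
      moreover have "ln b - ln x \<le> (b - x) / x" using bI x by (intro ln_diff_le) auto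
      moreover have "0 \<le> V b - V x" using t_V[OF x bI ab(2)] norm_ge_zero order_trans by blast
      ultimately have "ln b - ln x \<le> K * (V b - V x)" "0 \<le> K * (V b - V x)" using K by auto
      then have 2: "ln b - ln x \<le> 2 * K * (V b - V x)" by (simp add: algebra_simps)
      from 1 2 show ?thesis by (simp add: algebra_simps)
    qed
    moreover have "?d > 0" using d(1) x by auto
    ultimately show ?case by blast
  qed
  define r1 where "r1 = \<epsilon> / 2"
  have r1: "r1 \<in> ?I" using \<open>\<epsilon> > 0\<close> by (simp add: r1_def)
  \<comment> \<open>Monotonicity bounds \<open>- ln r\<close> by \<open>Q\<close> for all small
    \<open>r\<close>; \<open>exp (- Q - 1)\<close> violates this.\<close>
  define Q where "Q = 2 * K * V r1 - ln r1 + 2 * K * (real CARD('n) * pi)"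
  define r where "r = min r1 (exp (- Q - 1))"
  have r: "r \<in> ?I" "r \<le> r1" using r1 by (auto simp: r_def min_def)
  have "2 * K * V r - ln r \<le> 2 * K * V r1 - ln r1" by (rule increasing[OF r(1) r1 r(2)])
  moreover have "2 * K * (- V r) \<le> 2 * K * (real CARD('n) * pi)"
    using V_bound[OF r(1)] K by (intro mult_left_mono) auto
  ultimately have "- ln r \<le> Q" unfolding Q_def mult_minus_right by linarith
  moreover have "ln r \<le> - Q - 1" using r(1) ln_mono[of r "exp (- Q - 1)"] by (simp add: r_def)
  ultimately show False by linarith
qed

text \<open>A constant sign upgrades a property that holds arbitrarily close to the limit to one
  that holds eventually.\<close>

lemma frequently_trichotomy:
  fixes k :: "real \<Rightarrow> real"
  assumes tri: "(\<forall>\<^sub>F r in F. k r > 0) \<or> (\<forall>\<^sub>F r in F. k r = 0) \<or> (\<forall>\<^sub>F r in F. k r < 0)"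
  shows "\<exists>\<^sub>F r in F. k r \<le> 0 \<Longrightarrow> \<forall>\<^sub>F r in F. k r \<le> 0"
    and "\<exists>\<^sub>F r in F. k r = 0 \<Longrightarrow> \<forall>\<^sub>F r in F. k r = 0"
    and "\<not> (\<forall>\<^sub>F r in F. k r \<le> 0) \<Longrightarrow> \<forall>\<^sub>F r in F. k r > 0"
proof -
  have *: "(\<forall>\<^sub>F r in F. k r > 0) \<Longrightarrow> \<forall>\<^sub>F r in F. \<not> k r \<le> 0"
    "(\<forall>\<^sub>F r in F. k r > 0) \<Longrightarrow> \<forall>\<^sub>F r in F. k r \<noteq> 0"
    "(\<forall>\<^sub>F r in F. k r < 0) \<Longrightarrow> \<forall>\<^sub>F r in F. k r \<noteq> 0"
    "(\<forall>\<^sub>F r in F. k r < 0) \<Longrightarrow> \<forall>\<^sub>F r in F. k r \<le> 0"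
    "(\<forall>\<^sub>F r in F. k r = 0) \<Longrightarrow> \<forall>\<^sub>F r in F. k r \<le> 0"
    by (erule eventually_mono, simp)+
  show "\<exists>\<^sub>F r in F. k r \<le> 0 \<Longrightarrow> \<forall>\<^sub>F r in F. k r \<le> 0"
    using tri * unfolding frequently_def by blast
  show "\<exists>\<^sub>F r in F. k r = 0 \<Longrightarrow> \<forall>\<^sub>F r in F. k r = 0"
    using tri * unfolding frequently_def by blast
  show "\<not> (\<forall>\<^sub>F r in F. k r \<le> 0) \<Longrightarrow> \<forall>\<^sub>F r in F. k r > 0"
    using tri * by blast
qed

text \<open>A tuple of branches chosen coordinatewise may miss the level or leave the cube. By the
  trichotomy it does so for all small \<open>r\<close> or for none; in the latter case
  \<open>no_quadratic_gradient_decay\<close> supplies the hypothesis of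
  \<open>algebraic_lower_bound\<close>.\<close>

lemma branch_gradient_bound:
  fixes f :: "real^'n \<Rightarrow> real" and \<xi> :: "'n \<Rightarrow> real \<Rightarrow> real"
  assumes "\<epsilon> > 0" and f: "polyfun f" "\<And>x. GDERIV f x :> D x" "\<And>j. polyfun (\<lambda>x. D x $ j)"
    and R: "\<And>j. R j \<noteq> 0" and br: "\<And>j. root_branches (R j) \<epsilon> (\<Xi> j)" "\<And>j. \<xi> j \<in> \<Xi> j"
  shows "\<exists>\<delta>>0. \<forall>\<^sub>F r in at_right 0. f (\<chi> j. \<xi> j r) = r \<longrightarrow> (\<forall>j. \<bar>\<xi> j r\<bar> \<le> 1) \<longrightarrow>
    r powr (2 - \<delta>) \<le> (\<Sum>j\<in>UNIV. (1 - (\<xi> j r)\<^sup>2) * (D (\<chi> j. \<xi> j r) $ j)\<^sup>2)"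
proof (cases "\<exists>\<^sub>F r in at_right 0. f (\<chi> j. \<xi> j r) = r \<and> (\<forall>j. \<bar>\<xi> j r\<bar> \<le> 1)")
  case False
  then have "\<forall>\<^sub>F r in at_right 0. \<not> (f (\<chi> j. \<xi> j r) = r \<and> (\<forall>j. \<bar>\<xi> j r\<bar> \<le> 1))"
    by (simp add: frequently_def)
  \<comment> \<open>The implication is vacuous for small \<open>r\<close>, so any exponent
    serves.\<close>
  then show ?thesis by (intro exI[of _ 1] conjI) (auto elim: eventually_mono)
next
  case True
  let ?I = "{0<..<\<epsilon>}" and ?F = "at_right (0::real)"
  have cont: "continuous_on ?I (\<xi> j)" and mono: "mono_on ?I (\<xi> j) \<or> mono_on ?I (\<lambda>r. - \<xi> j r)"
    and root: "\<And>r. r \<in> ?I \<Longrightarrow> bev (R j) (\<xi> j r) r = 0" for j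
    using br unfolding root_branches_def by blast+
  have root': "\<forall>\<^sub>F r in ?F. bev (R j) (\<xi> j r) r = 0" for j
    by (rule eventually_mono[OF eventually_at_right_real[OF \<open>\<epsilon> > 0\<close>]]) (rule root)
  have germ: "(\<forall>\<^sub>F r in ?F. p (\<chi> j. \<xi> j r) - poly c r > 0) \<or> (\<forall>\<^sub>F r in ?F. p (\<chi> j. \<xi> j r) - poly c r = 0)
      \<or> (\<forall>\<^sub>F r in ?F. p (\<chi> j. \<xi> j r) - poly c r < 0)" if p: "polyfun p" for p c
  proof -
    obtain S where S: "S \<noteq> 0" "\<forall>\<^sub>F r in ?F. bev S (p (\<chi> j. \<xi> j r)) r = 0"
      using algebraic_germ[of R \<xi> p, OF R root' p] by blast
    obtain S' where S': "S' \<noteq> 0" "\<And>y r. bev S y r = 0 \<Longrightarrow> bev S' (y - poly c r) r = 0"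
      using exists_shift_relation[OF S(1), of c] by blast
    have "continuous_on ?I (\<lambda>r. p (\<chi> j. \<xi> j r) - poly c r)"
      using cont by (intro continuous_intros polyfun_continuous_on_compose[OF p]) auto
    moreover have "\<forall>\<^sub>F r in ?F. bev S' (p (\<chi> j. \<xi> j r) - poly c r) r = 0"
      using S(2) by (rule eventually_mono) (rule S'(2))
    ultimately show ?thesis using algebraic_trichotomy[OF \<open>\<epsilon> > 0\<close> _ S'(1)] by blast
  qed
  define x where "x r = (\<chi> j. \<xi> j r)" for r
  define k where "k y = (\<Sum>j\<in>UNIV. (1 - (y $ j)\<^sup>2) * (D y $ j)\<^sup>2)" for y
  have k: "polyfun k"
    unfolding k_def by (intro polyfun_sum polyfun_mult polyfun_diff polyfun_const polyfun_power polyfun_var f)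
  have level: "\<forall>\<^sub>F r in ?F. f (x r) = r"
  proof -
    \<comment> \<open>\<open>[:0, 1:]\<close> is the polynomial \<open>r\<close>: the germ of
      \<open>f - r\<close> vanishes infinitely often near \<open>0\<close>, hence
      eventually.\<close>
    have "\<exists>\<^sub>F r in ?F. f (x r) - poly [:0, 1:] r = 0"
      using True by (rule frequently_elim1) (simp add: x_def)
    from frequently_trichotomy(2)[OF germ[OF f(1)] this[unfolded x_def]]
    show ?thesis by (simp add: x_def)
  qed
  have unit: "\<forall>\<^sub>F r in ?F. \<bar>\<xi> j r\<bar> \<le> 1" for j
  proof -
    have "\<exists>\<^sub>F r in ?F. ((x r $ j)\<^sup>2) - poly 1 r \<le> 0"
      using True by (rule frequently_elim1) (auto simp: x_def abs_square_le_1)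
    from frequently_trichotomy(1)[OF germ[OF polyfun_power[OF polyfun_var]] this[unfolded x_def]]
    have "\<forall>\<^sub>F r in ?F. ((x r $ j)\<^sup>2) - poly 1 r \<le> 0" by (simp add: x_def)
    then show ?thesis by (rule eventually_mono) (simp add: x_def abs_square_le_1)
  qed
  have large: "\<forall>\<^sub>F r in ?F. k (x r) > C * r\<^sup>2" for C
  proof -
    have "\<not> (\<forall>\<^sub>F r in ?F. k (x r) \<le> C * r\<^sup>2)"
    proof
      assume "\<forall>\<^sub>F r in ?F. k (x r) \<le> C * r\<^sup>2"
      then have "\<forall>\<^sub>F r in ?F. k (x r) \<le> C * r\<^sup>2 \<and> f (x r) = r \<and> (\<forall>j. \<bar>\<xi> j r\<bar> \<le> 1) \<and> r \<in> ?I"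
        using level eventually_ball_finite[of "UNIV :: 'n set" "\<lambda>r j. \<bar>\<xi> j r\<bar> \<le> 1"] unit
          eventually_at_right_real[OF \<open>\<epsilon> > 0\<close>] by (simp add: eventually_conj)
      then obtain \<epsilon>' where \<epsilon>': "\<epsilon>' > 0" and all: "\<And>r. r \<in> {0<..<\<epsilon>'} \<Longrightarrow>
          k (x r) \<le> C * r\<^sup>2 \<and> f (x r) = r \<and> (\<forall>j. \<bar>\<xi> j r\<bar> \<le> 1) \<and> r \<in> ?I"
        using eventually_at_right_0E by blast
      have sub: "{0<..<\<epsilon>'} \<subseteq> ?I" using all by blast
      show False
      proof (rule no_quadratic_gradient_decay[OF \<epsilon>' f(2), of \<xi> C])
        show "continuous_on {0<..<\<epsilon>'} (\<xi> j)" for j using cont sub by (rule continuous_on_subset)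
        show "mono_on {0<..<\<epsilon>'} (\<xi> j) \<or> mono_on {0<..<\<epsilon>'} (\<lambda>r. - \<xi> j r)" for j
          using mono[of j] mono_on_subset[OF _ sub] by blast
      qed (use all in \<open>simp_all add: x_def k_def\<close>)
    qed
    then have "\<not> (\<forall>\<^sub>F r in ?F. k (\<chi> j. \<xi> j r) - poly [:0, 0, C:] r \<le> 0)"
      by (simp add: x_def power2_eq_square algebra_simps)
    then have "\<forall>\<^sub>F r in ?F. k (\<chi> j. \<xi> j r) - poly [:0, 0, C:] r > 0"
      by (rule frequently_trichotomy(3)[OF germ[OF k]])
    then show ?thesis by (rule eventually_mono) (simp add: x_def power2_eq_square algebra_simps)
  qed
  obtain S where "S \<noteq> 0" "\<forall>\<^sub>F r in ?F. bev S (k (x r)) r = 0"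
    using algebraic_germ[of R \<xi> k, OF R root' k] unfolding x_def by blast
  from algebraic_lower_bound[OF this large] obtain \<delta> where
    "\<delta> > 0" "\<forall>\<^sub>F r in ?F. r powr (2 - \<delta>) \<le> k (x r)" by blast
  then show ?thesis by (intro exI[of _ \<delta>] conjI) (auto simp: k_def x_def elim: eventually_mono)
qed

text \<open>A second block of variables with squares \<open>1 - x_j^2\<close> turns the cube into
  the compact zero set of \<open>G\<close> and the weights into squares, so
  \<open>algebraic_minimizer\<close> applies without inequality constraints.\<close>

theorem cube_Lojasiewicz:
  fixes f :: "real^'n \<Rightarrow> real"
  assumes f: "polyfun f" and D: "\<And>x. GDERIV f x :> D x" "\<And>j. polyfun (\<lambda>x. D x $ j)"
  shows "\<exists>\<delta>>0. \<forall>\<^sub>F r in at_right 0. \<forall>u. (\<forall>j. \<bar>u $ j\<bar> \<le> 1) \<longrightarrow> f u = r \<longrightarrow>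
    r powr (2 - \<delta>) \<le> (\<Sum>j\<in>UNIV. (1 - (u $ j)\<^sup>2) * (D u $ j)\<^sup>2)"
proof -
  define U where "U x = (\<chi> j. x $ Inl j)" for x :: "real^('n + 'n)"
  define F where "F x = f (U x)" for x
  define G where "G x = (\<Sum>j\<in>UNIV. ((x $ Inl j)\<^sup>2 + (x $ Inr j)\<^sup>2 - 1)\<^sup>2)" for x :: "real^('n + 'n)"
  define H where "H x = (\<Sum>j\<in>UNIV. (x $ Inr j)\<^sup>2 * (D (U x) $ j)\<^sup>2)" for x :: "real^('n + 'n)"
  define k where "k u = (\<Sum>j\<in>UNIV. (1 - (u $ j)\<^sup>2) * (D u $ j)\<^sup>2)" for u
  have U: "polyfun (\<lambda>x. U x $ j)" for j by (auto simp: U_def)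
  have F: "polyfun F" unfolding F_def by (rule polyfun_compose[OF f U])
  have G: "polyfun G" unfolding G_def
    by (intro polyfun_sum polyfun_power polyfun_diff polyfun_add polyfun_const polyfun_var)
  have H: "polyfun H" unfolding H_def
    by (intro polyfun_sum polyfun_mult polyfun_power polyfun_var polyfun_compose[OF D(2) U])
  have "bounded {x. G x \<le> 1}"
  proof (rule boundedI)
    fix x assume "x \<in> {x. G x \<le> 1}"
    then have "G x \<le> 1" by simp
    have comp: "(x $ Inl j)\<^sup>2 + (x $ Inr j)\<^sup>2 \<le> 2" for j
    proof -
      have "((x $ Inl j)\<^sup>2 + (x $ Inr j)\<^sup>2 - 1)\<^sup>2 \<le> G x"
        unfolding G_def by (rule member_le_sum) auto
      with \<open>G x \<le> 1\<close> have "((x $ Inl j)\<^sup>2 + (x $ Inr j)\<^sup>2 - 1)\<^sup>2 \<le> 1" by linarith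
      then show ?thesis by (simp add: abs_square_le_1 abs_le_iff)
    qed
    have "\<bar>x $ i\<bar> \<le> 2" for i
    proof -
      have "(x $ i)\<^sup>2 \<le> 2\<^sup>2"
      proof (cases i)
        case (Inl j)
        have "(x $ Inl j)\<^sup>2 \<le> 2" using comp[of j] zero_le_power2[of "x $ Inr j"] by linarith
        then show ?thesis unfolding Inl by simp
      next
        case (Inr j)
        have "(x $ Inr j)\<^sup>2 \<le> 2" using comp[of j] zero_le_power2[of "x $ Inl j"] by linarith
        then show ?thesis unfolding Inr by simp
      qed
      then show ?thesis using abs_le_square_iff[of "x $ i" 2] by simp
    qed
    then have "(\<Sum>i\<in>UNIV. \<bar>x $ i\<bar>) \<le> (\<Sum>i\<in>(UNIV :: ('n + 'n) set). 2)" by (intro sum_mono)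
    with norm_le_l1_cart[of x] show "norm x \<le> (\<Sum>i\<in>(UNIV :: ('n + 'n) set). 2)" by linarith
  qed
  note bdd = this
  have nonneg: "0 \<le> G x" "0 \<le> H x" for x by (auto simp: G_def H_def intro!: sum_nonneg)
  obtain R where R: "\<And>j. R j \<noteq> 0"
    "\<And>r x0. F x0 = r \<Longrightarrow> G x0 = 0 \<Longrightarrow> \<exists>x. F x = r \<and> G x = 0 \<and> (\<forall>j. bev (R j) (x $ j) r = 0) \<and>
      (\<forall>x'. F x' = r \<longrightarrow> G x' = 0 \<longrightarrow> H x \<le> H x')"
    by (rule algebraic_minimizer[OF F G H nonneg bdd]) blast
  have G0: "G x = 0 \<longleftrightarrow> (\<forall>j. (x $ Inr j)\<^sup>2 = 1 - (x $ Inl j)\<^sup>2)" for x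
  proof -
    have "G x = 0 \<longleftrightarrow> (\<forall>j. (x $ Inl j)\<^sup>2 + (x $ Inr j)\<^sup>2 - 1 = 0)"
      unfolding G_def by (subst sum_nonneg_eq_0_iff) auto
    then show ?thesis by (simp add: algebra_simps)
  qed
  have Hk: "H x = k (U x)" if "G x = 0" for x
    using that unfolding G0 H_def k_def by (simp add: U_def)
  \<comment> \<open>A point of the cube is lifted by the square roots of its weights; the minimizer
    on its level then takes its place.\<close>
  have reduce: "\<exists>u'. f u' = f u \<and> (\<forall>j. \<bar>u' $ j\<bar> \<le> 1) \<and> (\<forall>j. bev (R (Inl j)) (u' $ j) (f u) = 0) \<and> k u' \<le> k u"
    if u: "\<forall>j. \<bar>u $ j\<bar> \<le> 1" for u
  proof -
    define x0 where "x0 = (\<chi> i. case i of Inl j \<Rightarrow> u $ j | Inr j \<Rightarrow> sqrt (1 - (u $ j)\<^sup>2))"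
    have Ux0: "U x0 = u" by (simp add: U_def x0_def vec_eq_iff)
    have Gx0: "G x0 = 0" unfolding G0 using u by (simp add: x0_def abs_square_le_1)
    obtain x where x: "F x = f u" "G x = 0" "\<And>j. bev (R j) (x $ j) (f u) = 0" "H x \<le> H x0"
      using R(2)[of x0 "f u"] Gx0 Ux0 by (auto simp: F_def)
    have "\<bar>U x $ j\<bar> \<le> 1" for j
      using x(2) zero_le_power2[of "x $ Inr j"] unfolding G0 by (simp add: U_def abs_square_le_1)
    then show ?thesis
      using x Hk[OF x(2)] Hk[OF Gx0] Ux0 by (intro exI[of _ "U x"]) (auto simp: F_def U_def)
  qed
  have "\<forall>j. \<exists>\<epsilon>>0. \<exists>\<Xi>. root_branches (R (Inl j)) \<epsilon> \<Xi>" for j :: 'n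
    using exists_root_branches R(1) by blast
  then obtain e where e: "\<And>j::'n. e j > 0" "\<And>j. \<exists>\<Xi>. root_branches (R (Inl j)) (e j) \<Xi>" by metis
  define \<epsilon> where "\<epsilon> = Min (range e)"
  have "\<epsilon> > 0" unfolding \<epsilon>_def using e(1) by (subst Min_gr_iff) auto
  have "\<epsilon> \<le> e j" for j by (simp add: \<epsilon>_def)
  then have "\<forall>j. \<exists>\<Xi>. root_branches (R (Inl j)) \<epsilon> \<Xi>" using e(2) root_branches_shrink by blast
  then obtain \<Xi> where \<Xi>: "\<And>j. root_branches (R (Inl j)) \<epsilon> (\<Xi> j)" by metis
  \<comment> \<open>The tuple of branches through the minimizer may change with \<open>r\<close>;
    finiteness of the set of tuples still allows a common exponent.\<close>
  define \<Sigma> where "\<Sigma> = PiE (UNIV :: 'n set) \<Xi>"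
  have fin: "finite \<Sigma>" unfolding \<Sigma>_def using \<Xi> by (intro finite_PiE) (auto simp: root_branches_def)
  have mem\<Sigma>: "\<sigma> \<in> \<Sigma> \<longleftrightarrow> (\<forall>j. \<sigma> j \<in> \<Xi> j)" for \<sigma> by (auto simp: \<Sigma>_def)
  have "\<forall>\<sigma>\<in>\<Sigma>. \<exists>\<delta>>0. \<forall>\<^sub>F r in at_right 0. f (\<chi> j. \<sigma> j r) = r \<longrightarrow> (\<forall>j. \<bar>\<sigma> j r\<bar> \<le> 1) \<longrightarrow>
      r powr (2 - \<delta>) \<le> k (\<chi> j. \<sigma> j r)"
  proof
    fix \<sigma> assume "\<sigma> \<in> \<Sigma>"
    then have "\<And>j. \<sigma> j \<in> \<Xi> j" by (simp add: mem\<Sigma>)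
    from branch_gradient_bound[OF \<open>\<epsilon> > 0\<close> f D R(1) \<Xi> this]
    show "\<exists>\<delta>>0. \<forall>\<^sub>F r in at_right 0. f (\<chi> j. \<sigma> j r) = r \<longrightarrow> (\<forall>j. \<bar>\<sigma> j r\<bar> \<le> 1) \<longrightarrow>
      r powr (2 - \<delta>) \<le> k (\<chi> j. \<sigma> j r)" by (simp add: k_def)
  qed
  then obtain d where d: "\<And>\<sigma>. \<sigma> \<in> \<Sigma> \<Longrightarrow> d \<sigma> > 0"
    "\<And>\<sigma>. \<sigma> \<in> \<Sigma> \<Longrightarrow> \<forall>\<^sub>F r in at_right 0. f (\<chi> j. \<sigma> j r) = r \<longrightarrow> (\<forall>j. \<bar>\<sigma> j r\<bar> \<le> 1) \<longrightarrow>
      r powr (2 - d \<sigma>) \<le> k (\<chi> j. \<sigma> j r)"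
    unfolding bchoice_iff by blast
  \<comment> \<open>The \<open>1\<close> keeps the minimum defined when there are no tuples. A
    smaller \<delta> weakens the bound because \<open>r < 1\<close>.\<close>
  define \<delta> where "\<delta> = Min (insert 1 (d ` \<Sigma>))"
  have \<delta>: "\<delta> > 0" "\<And>\<sigma>. \<sigma> \<in> \<Sigma> \<Longrightarrow> \<delta> \<le> d \<sigma>"
    unfolding \<delta>_def using fin d(1) by auto
  have "\<forall>\<^sub>F r in at_right 0. (\<forall>\<sigma>\<in>\<Sigma>. f (\<chi> j. \<sigma> j r) = r \<longrightarrow> (\<forall>j. \<bar>\<sigma> j r\<bar> \<le> 1) \<longrightarrow>
      r powr (2 - d \<sigma>) \<le> k (\<chi> j. \<sigma> j r)) \<and> r \<in> {0<..<min 1 \<epsilon>}"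
    by (intro eventually_conj eventually_ball_finite fin ballI d(2) eventually_at_right_real)
      (use \<open>\<epsilon> > 0\<close> in auto)
  then have "\<forall>\<^sub>F r in at_right 0. \<forall>u. (\<forall>j. \<bar>u $ j\<bar> \<le> 1) \<longrightarrow> f u = r \<longrightarrow> r powr (2 - \<delta>) \<le> k u"
  proof (rule eventually_mono, intro allI impI)
    fix r u
    assume r: "(\<forall>\<sigma>\<in>\<Sigma>. f (\<chi> j. \<sigma> j r) = r \<longrightarrow> (\<forall>j. \<bar>\<sigma> j r\<bar> \<le> 1) \<longrightarrow>
      r powr (2 - d \<sigma>) \<le> k (\<chi> j. \<sigma> j r)) \<and> r \<in> {0<..<min 1 \<epsilon>}"
      and u: "\<forall>j. \<bar>u $ j\<bar> \<le> 1" "f u = r"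
    obtain u' where u': "f u' = r" "\<And>j. \<bar>u' $ j\<bar> \<le> 1" "\<And>j. bev (R (Inl j)) (u' $ j) r = 0" "k u' \<le> k u"
      using reduce[OF u(1)] u(2) by auto
    have "\<exists>\<xi>\<in>\<Xi> j. u' $ j = \<xi> r" for j
      using \<Xi>[of j] u'(3)[of j] r unfolding root_branches_def by auto
    then obtain \<sigma> where \<sigma>: "\<And>j. \<sigma> j \<in> \<Xi> j" "\<And>j. u' $ j = \<sigma> j r" by metis
    have u'_eq: "(\<chi> j. \<sigma> j r) = u'" by (simp add: vec_eq_iff \<sigma>(2))
    have \<sigma>\<Sigma>: "\<sigma> \<in> \<Sigma>" using \<sigma>(1) by (simp add: mem\<Sigma>)
    with r have "f (\<chi> j. \<sigma> j r) = r \<longrightarrow> (\<forall>j. \<bar>\<sigma> j r\<bar> \<le> 1) \<longrightarrow> r powr (2 - d \<sigma>) \<le> k (\<chi> j. \<sigma> j r)" by blast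
    then have "r powr (2 - d \<sigma>) \<le> k u'" using u'(1,2) by (simp add: u'_eq flip: \<sigma>(2))
    moreover have "r powr (2 - \<delta>) \<le> r powr (2 - d \<sigma>)"
      using \<delta>(2)[OF \<sigma>\<Sigma>] r by (intro powr_mono') auto
    ultimately show "r powr (2 - \<delta>) \<le> k u" using u'(4) by linarith
  qed
  with \<delta>(1) show ?thesis unfolding k_def by blast
qed

text \<open>The affine chart from the cube scales the partial derivatives by the half-widths
  \<open>w\<close>, which turns the weights \<open>1 - u_j^2\<close> exactly into
  \<open>(x_j - a_j) * (b_j - x_j)\<close>.\<close>

theorem box_Lojasiewicz:
  fixes f :: "real^'n \<Rightarrow> real"
  assumes f: "polyfun f" and D: "\<And>x. GDERIV f x :> D x" "\<And>j. polyfun (\<lambda>x. D x $ j)"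
  shows "\<exists>\<delta>>0. \<exists>\<epsilon>>0. \<forall>x\<in>cbox a b. v < f x \<longrightarrow> f x < v + \<epsilon> \<longrightarrow>
    (f x - v) powr (2 - \<delta>) \<le> (\<Sum>j\<in>UNIV. (x $ j - a $ j) * (b $ j - x $ j) * (D x $ j)\<^sup>2)"
proof -
  define c where "c = (\<chi> j. (a $ j + b $ j) / 2)"
  define w where "w = (\<chi> j. (b $ j - a $ j) / 2)"
  define A where "A u = (\<chi> j. c $ j + w $ j * u $ j)" for u
  define F where "F u = f (A u) - v" for u
  have A: "polyfun (\<lambda>u. A u $ j)" for j
    unfolding A_def vec_lambda_beta by (intro polyfun_add polyfun_mult polyfun_const polyfun_var)
  have F: "polyfun F" unfolding F_def by (intro polyfun_diff polyfun_const polyfun_compose[OF f A])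
  have A_der: "(A has_derivative (\<lambda>h. \<chi> j. w $ j * h $ j)) (at u)" for u
  proof (subst has_derivative_componentwise_within, intro ballI)
    fix i :: "real^'n" assume "i \<in> Basis"
    then obtain j where i: "i = axis j 1" by (auto simp: Basis_vec_def)
    have "((\<lambda>x::real^'n. x $ j) has_derivative (\<lambda>h. h $ j)) (at u)"
      by (rule bounded_linear_imp_has_derivative[OF bounded_linear_vec_nth])
    then have "((\<lambda>x::real^'n. c $ j + w $ j * x $ j) has_derivative (\<lambda>h. w $ j * h $ j)) (at u)"
      by (auto intro!: derivative_eq_intros)
    then show "((\<lambda>x. A x \<bullet> i) has_derivative (\<lambda>h. (\<chi> j. w $ j * h $ j) \<bullet> i)) (at u)"
      by (simp add: i inner_axis A_def)
  qed
  define DF where "DF u = (\<chi> j. w $ j * D (A u) $ j)" for u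
  have DF: "GDERIV F u :> DF u" for u
  proof -
    have "(F has_derivative (\<lambda>h. (\<chi> j. w $ j * h $ j) \<bullet> D (A u) - 0)) (at u)"
      unfolding F_def
      by (intro has_derivative_diff has_derivative_const)
        (rule has_derivative_compose[OF A_der, of f, OF D(1)[unfolded gderiv_def]])
    also have "(\<lambda>h. (\<chi> j. w $ j * h $ j) \<bullet> D (A u) - 0) = (\<lambda>h. h \<bullet> DF u)"
      by (simp add: fun_eq_iff DF_def inner_vec_def mult_ac)
    finally show ?thesis by (simp add: gderiv_def)
  qed
  have "polyfun (\<lambda>u. DF u $ j)" for j
    by (simp add: DF_def) (intro polyfun_mult polyfun_const polyfun_compose[OF D(2) A])
  from cube_Lojasiewicz[OF F DF this] obtain \<delta> where \<delta>: "\<delta> > 0"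
    "\<forall>\<^sub>F r in at_right 0. \<forall>u. (\<forall>j. \<bar>u $ j\<bar> \<le> 1) \<longrightarrow> F u = r \<longrightarrow>
      r powr (2 - \<delta>) \<le> (\<Sum>j\<in>UNIV. (1 - (u $ j)\<^sup>2) * (DF u $ j)\<^sup>2)" by blast
  obtain \<epsilon> where \<epsilon>: "\<epsilon> > 0" "\<And>r. r \<in> {0<..<\<epsilon>} \<Longrightarrow> \<forall>u. (\<forall>j. \<bar>u $ j\<bar> \<le> 1) \<longrightarrow> F u = r \<longrightarrow>
      r powr (2 - \<delta>) \<le> (\<Sum>j\<in>UNIV. (1 - (u $ j)\<^sup>2) * (DF u $ j)\<^sup>2)"
    using eventually_at_right_0E[OF \<delta>(2)] by blast
  have "(f x - v) powr (2 - \<delta>) \<le> (\<Sum>j\<in>UNIV. (x $ j - a $ j) * (b $ j - x $ j) * (D x $ j)\<^sup>2)"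
    if x: "x \<in> cbox a b" "v < f x" "f x < v + \<epsilon>" for x
  proof -
    \<comment> \<open>On a degenerate edge division by zero gives \<open>u $ j = 0\<close>, which is
      admissible and is still mapped to \<open>x $ j\<close>.\<close>
    define u where "u = (\<chi> j. (x $ j - c $ j) / w $ j)"
    have xj: "a $ j \<le> x $ j" "x $ j \<le> b $ j" for j using x(1) by (auto simp: mem_box_cart)
    have wu: "w $ j * u $ j = x $ j - c $ j" for j
    proof (cases "w $ j = 0")
      case True
      then have "a $ j = b $ j" by (simp add: w_def)
      then show ?thesis using True xj[of j] by (simp add: c_def)
    qed (simp add: u_def)
    then have Au: "A u = x" by (simp add: A_def vec_eq_iff)
    have "\<bar>u $ j\<bar> \<le> 1" for j
    proof (cases "w $ j = 0")
      case False
      then have "w $ j > 0" using xj[of j] by (simp add: w_def)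
      moreover have "\<bar>x $ j - c $ j\<bar> \<le> w $ j" using xj[of j] by (simp add: c_def w_def abs_le_iff field_simps)
      ultimately show ?thesis by (simp add: u_def abs_divide)
    qed (simp add: u_def)
    moreover have "F u = f x - v" by (simp add: F_def Au)
    ultimately have "(f x - v) powr (2 - \<delta>) \<le> (\<Sum>j\<in>UNIV. (1 - (u $ j)\<^sup>2) * (DF u $ j)\<^sup>2)"
      using \<epsilon>(2)[of "f x - v"] x by auto
    also have "\<dots> = (\<Sum>j\<in>UNIV. (x $ j - a $ j) * (b $ j - x $ j) * (D x $ j)\<^sup>2)"
    proof (rule sum.cong[OF refl])
      fix j
      have "(1 - (u $ j)\<^sup>2) * (DF u $ j)\<^sup>2 = ((w $ j)\<^sup>2 - (w $ j * u $ j)\<^sup>2) * (D x $ j)\<^sup>2"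
        by (simp add: DF_def Au power_mult_distrib algebra_simps)
      also have "(w $ j)\<^sup>2 - (w $ j * u $ j)\<^sup>2 = (x $ j - a $ j) * (b $ j - x $ j)"
        unfolding wu by (simp add: c_def w_def power2_eq_square field_simps)
      finally show "(1 - (u $ j)\<^sup>2) * (DF u $ j)\<^sup>2 = (x $ j - a $ j) * (b $ j - x $ j) * (D x $ j)\<^sup>2" .
    qed
    finally show ?thesis .
  qed
  with \<delta>(1) \<epsilon>(1) show ?thesis by blast
qed

section \<open>Convergence of the sweeps\<close>

text \<open>The induction carries a bound on the values as well, which the product case
  requires.\<close>

lemma polyfun_Lipschitz_on_bounded:
  fixes S :: "(real^'n) set"
  assumes "polyfun p" "bounded S"
  shows "\<exists>L\<ge>0. \<forall>x\<in>S. \<forall>y\<in>S. \<bar>p x - p y\<bar> \<le> L * norm (x - y)"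
proof -
  obtain M where M: "\<And>x. x \<in> S \<Longrightarrow> norm x \<le> M" using assms(2) by (auto simp: bounded_iff)
  from assms(1) have "\<exists>L\<ge>0. \<exists>B\<ge>0. (\<forall>x\<in>S. \<forall>y\<in>S. \<bar>p x - p y\<bar> \<le> L * norm (x - y)) \<and> (\<forall>x\<in>S. \<bar>p x\<bar> \<le> B)"
  proof (induction rule: polyfun_induct)
    case (const c)
    show ?case by (rule exI[of _ 0], simp, rule exI[of _ "\<bar>c\<bar>"], simp)
  next
    case (var j)
    have "\<bar>x $ j\<bar> \<le> \<bar>M\<bar>" if "x \<in> S" for x
      using component_le_norm_cart[of x j] M[OF that] by linarith
    moreover have "\<bar>x $ j - y $ j\<bar> \<le> 1 * norm (x - y)" for x y :: "real^'n"
      using component_le_norm_cart[of "x - y" j] by simp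
    ultimately show ?case
      by (intro exI[of _ 1]) (simp, rule exI[of _ "\<bar>M\<bar>"], simp)
  next
    case (add f g)
    then obtain L1 B1 L2 B2 where *: "L1 \<ge> 0" "B1 \<ge> 0" "L2 \<ge> 0" "B2 \<ge> 0"
      "\<And>x y. x \<in> S \<Longrightarrow> y \<in> S \<Longrightarrow> \<bar>f x - f y\<bar> \<le> L1 * norm (x - y)" "\<And>x. x \<in> S \<Longrightarrow> \<bar>f x\<bar> \<le> B1"
      "\<And>x y. x \<in> S \<Longrightarrow> y \<in> S \<Longrightarrow> \<bar>g x - g y\<bar> \<le> L2 * norm (x - y)" "\<And>x. x \<in> S \<Longrightarrow> \<bar>g x\<bar> \<le> B2"
      by metis
    have Lip: "\<bar>f x + g x - (f y + g y)\<bar> \<le> (L1 + L2) * norm (x - y)" if "x \<in> S" "y \<in> S" for x y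
      using *(5)[OF that] *(7)[OF that] unfolding distrib_right by linarith
    have bound: "\<bar>f x + g x\<bar> \<le> B1 + B2" if "x \<in> S" for x
      using *(6)[OF that] *(8)[OF that] by linarith
    show ?case
      by (rule exI[of _ "L1 + L2"], rule conjI, use * in simp, rule exI[of _ "B1 + B2"])
        (use * Lip bound in auto)
  next
    case (mult f g)
    then obtain L1 B1 L2 B2 where *: "L1 \<ge> 0" "B1 \<ge> 0" "L2 \<ge> 0" "B2 \<ge> 0"
      "\<And>x y. x \<in> S \<Longrightarrow> y \<in> S \<Longrightarrow> \<bar>f x - f y\<bar> \<le> L1 * norm (x - y)" "\<And>x. x \<in> S \<Longrightarrow> \<bar>f x\<bar> \<le> B1"
      "\<And>x y. x \<in> S \<Longrightarrow> y \<in> S \<Longrightarrow> \<bar>g x - g y\<bar> \<le> L2 * norm (x - y)" "\<And>x. x \<in> S \<Longrightarrow> \<bar>g x\<bar> \<le> B2"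
      by metis
    have Lip: "\<bar>f x * g x - f y * g y\<bar> \<le> (B1 * L2 + B2 * L1) * norm (x - y)" if xy: "x \<in> S" "y \<in> S" for x y
    proof -
      have "f x * g x - f y * g y = f x * (g x - g y) + g y * (f x - f y)" by (simp add: algebra_simps)
      then have "\<bar>f x * g x - f y * g y\<bar> \<le> \<bar>f x\<bar> * \<bar>g x - g y\<bar> + \<bar>g y\<bar> * \<bar>f x - f y\<bar>"
        by (metis abs_mult abs_triangle_ineq)
      also have "\<dots> \<le> B1 * (L2 * norm (x - y)) + B2 * (L1 * norm (x - y))"
        using * xy by (intro add_mono mult_mono) auto
      finally show ?thesis by (simp add: algebra_simps)
    qed
    have bound: "\<bar>f x * g x\<bar> \<le> B1 * B2" if "x \<in> S" for x
      unfolding abs_mult using * that by (intro mult_mono) auto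
    show ?case
      by (rule exI[of _ "B1 * L2 + B2 * L1"], rule conjI, use * in simp, rule exI[of _ "B1 * B2"])
        (use * Lip bound in auto)
  qed
  then show ?thesis by blast
qed

lemma polyfun_vector_Lipschitz_on_bounded:
  fixes D :: "real^'n \<Rightarrow> real^'m"
  assumes "\<And>j. polyfun (\<lambda>x. D x $ j)" "bounded S"
  shows "\<exists>L\<ge>0. \<forall>x\<in>S. \<forall>y\<in>S. norm (D x - D y) \<le> L * norm (x - y)"
proof -
  have "\<forall>j. \<exists>L\<ge>0. \<forall>x\<in>S. \<forall>y\<in>S. \<bar>D x $ j - D y $ j\<bar> \<le> L * norm (x - y)"
    using polyfun_Lipschitz_on_bounded[OF assms(1) assms(2)] by blast
  then obtain L where L: "\<And>j. L j \<ge> 0" "\<And>j x y. x \<in> S \<Longrightarrow> y \<in> S \<Longrightarrow> \<bar>D x $ j - D y $ j\<bar> \<le> L j * norm (x - y)"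
    by metis
  have "norm (D x - D y) \<le> (\<Sum>j\<in>UNIV. L j) * norm (x - y)" if "x \<in> S" "y \<in> S" for x y
  proof -
    have "norm (D x - D y) \<le> (\<Sum>j\<in>UNIV. \<bar>(D x - D y) $ j\<bar>)" by (rule norm_le_l1_cart)
    also have "\<dots> \<le> (\<Sum>j\<in>UNIV. L j * norm (x - y))" using L(2)[OF that] by (intro sum_mono) simp
    finally show ?thesis by (simp add: sum_distrib_right)
  qed
  moreover have "(\<Sum>j\<in>UNIV. L j) \<ge> 0" using L(1) by (intro sum_nonneg)
  ultimately show ?thesis by blast
qed

text \<open>The mean value theorem gives the constant \<open>L\<close> instead of the sharp
  \<open>L / 2\<close>; this only enlarges the backtracking threshold to
  \<open>2 * L + \<alpha>\<close>.\<close>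

lemma gradient_descent_inequality:
  assumes D: "\<And>x. GDERIV f x :> D x" and S: "convex S" "x \<in> S" "y \<in> S"
    and L: "L \<ge> 0" "\<And>x y. x \<in> S \<Longrightarrow> y \<in> S \<Longrightarrow> norm (D x - D y) \<le> L * norm (x - y)"
  shows "f y \<le> f x + D x \<bullet> (y - x) + L * (norm (y - x))\<^sup>2"
proof -
  define p where "p t = x + t *\<^sub>R (y - x)" for t
  have "((\<lambda>t. f (p t)) has_real_derivative (y - x) \<bullet> D (p t)) (at t)" for t
  proof -
    have "(p has_derivative (\<lambda>h. h *\<^sub>R (y - x))) (at t)"
      unfolding p_def by (auto intro!: derivative_eq_intros)
    from has_derivative_compose[OF this D[unfolded gderiv_def]] show ?thesis
      unfolding has_field_derivative_def by (simp add: mult_commute_abs)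
  qed
  then obtain t where t: "0 < t" "t < 1" "f (p 1) - f (p 0) = (1 - 0) * ((y - x) \<bullet> D (p t))"
    using MVT2[of 0 1 "\<lambda>t. f (p t)" "\<lambda>t. (y - x) \<bullet> D (p t)"] by auto
  have "p t = (1 - t) *\<^sub>R x + t *\<^sub>R y" by (simp add: p_def algebra_simps)
  then have pS: "p t \<in> S" using S t convexD[of S x y "1 - t" t] by simp
  have "f y - f x = (y - x) \<bullet> D (p t)" using t(3) by (simp add: p_def)
  also have "\<dots> = D x \<bullet> (y - x) + (D (p t) - D x) \<bullet> (y - x)"
    unfolding inner_diff_left[of "D (p t)"] by (simp add: inner_commute)
  also have "(D (p t) - D x) \<bullet> (y - x) \<le> norm (D (p t) - D x) * norm (y - x)"
    by (rule norm_cauchy_schwarz)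
  also have "\<dots> \<le> (L * norm (p t - x)) * norm (y - x)"
    using L(2)[OF pS S(2)] by (intro mult_right_mono) auto
  also have "\<dots> \<le> (L * norm (y - x)) * norm (y - x)"
    using t L(1) by (intro mult_right_mono mult_left_mono) (auto simp: p_def mult_left_le_one_le)
  finally show ?thesis by (simp add: power2_eq_square mult.assoc)
qed

text \<open>Uniqueness of derivatives identifies the gradient asserted to exist in
  \<open>block_step\<close> with the block part of the full gradient, zero elsewhere.\<close>

lemma GDERIV_upd_blk:
  fixes f :: "real^'n \<Rightarrow> real"
  assumes "GDERIV f w :> G" "GDERIV (\<lambda>x. f (upd_blk blk i w x)) w :> G'"
  shows "G' $ j = (if blk j = i then G $ j else 0)"
proof -
  have upd: "upd_blk blk i w w = w" by (simp add: upd_blk_def vec_eq_iff)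
  have "(upd_blk blk i w has_derivative (\<lambda>h. \<chi> j. if blk j = i then h $ j else 0)) (at w)"
  proof (subst has_derivative_componentwise_within, intro ballI)
    fix e :: "real^'n" assume "e \<in> Basis"
    then obtain j where e: "e = axis j 1" by (auto simp: Basis_vec_def)
    have "((\<lambda>x::real^'n. x $ j) has_derivative (\<lambda>h. h $ j)) (at w)"
      by (rule bounded_linear_imp_has_derivative[OF bounded_linear_vec_nth])
    then show "((\<lambda>x. upd_blk blk i w x \<bullet> e) has_derivative
        (\<lambda>h. (\<chi> j. if blk j = i then h $ j else 0) \<bullet> e)) (at w)"
      by (cases "blk j = i") (simp_all add: e inner_axis upd_blk_def)
  qed
  from has_derivative_compose[OF this, of f] assms(1)
  have "((\<lambda>x. f (upd_blk blk i w x)) has_derivative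
      (\<lambda>h. (\<chi> j. if blk j = i then h $ j else 0) \<bullet> G)) (at w)"
    by (simp add: gderiv_def upd)
  from has_derivative_unique[OF this assms(2)[unfolded gderiv_def]]
  have "(\<chi> k. if blk k = i then axis j 1 $ k else 0) \<bullet> G = axis j 1 \<bullet> G'" by meson
  also have "(\<chi> k. if blk k = i then axis j (1::real) $ k else 0) = (if blk j = i then axis j 1 else 0)"
    by (auto simp: vec_eq_iff axis_def)
  finally show ?thesis by (simp add: inner_axis' split: if_splits)
qed

text \<open>The projection inequality, tested at a point of the box that differs from the projection
  in one coordinate.\<close>

lemma closest_point_cbox_component:
  fixes a b :: "real^'n"
  assumes "cbox a b \<noteq> {}" "y \<in> {a $ j..b $ j}"
  shows "(x $ j - closest_point (cbox a b) x $ j) * (y - closest_point (cbox a b) x $ j) \<le> 0"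
proof -
  define p where "p = closest_point (cbox a b) x"
  have p: "p \<in> cbox a b" unfolding p_def using assms(1) by (intro closest_point_in_set) auto
  define v where "v = (\<chi> k. if k = j then y else p $ k)"
  have "v \<in> cbox a b" using p assms(2) by (auto simp: v_def mem_box_cart)
  then have "(x - p) \<bullet> (v - p) \<le> 0"
    unfolding p_def by (intro closest_point_dot convex_box) auto
  moreover have "v - p = axis j (y - p $ j)" by (auto simp: v_def vec_eq_iff axis_def)
  ultimately show ?thesis by (simp add: inner_axis p_def)
qed

text \<open>The test succeeds once the trial constant reaches \<open>2 * L + \<alpha>\<close>, so
  backtracking overshoots by at most one factor \<beta>. The final inequality is that of the
  projection in one coordinate, scaled by \<open>c\<close>.\<close>

lemma block_step_properties:
  fixes f :: "real^'n \<Rightarrow> real"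
  assumes D: "\<And>x. GDERIV f x :> D x"
    and L: "L \<ge> 0" "\<And>x y. x \<in> cbox a b \<Longrightarrow> y \<in> cbox a b \<Longrightarrow> norm (D x - D y) \<le> L * norm (x - y)"
    and pos: "\<alpha> > 0" "\<beta> > 1" "c0 > 0" and w: "w \<in> cbox a b"
    and step: "block_step f (cbox a b) blk \<alpha> \<beta> c0 i w w'"
  shows "w' \<in> cbox a b" and "\<And>j. blk j \<noteq> i \<Longrightarrow> w' $ j = w $ j"
    and "f w' + \<alpha> / 2 * (norm (w' - w))\<^sup>2 \<le> f w"
    and "\<exists>c>0. c \<le> max c0 (\<beta> * (2 * L + \<alpha>)) \<and> (\<forall>j y. blk j = i \<longrightarrow> y \<in> {a $ j..b $ j} \<longrightarrow>
      0 \<le> (c * (w' $ j - w $ j) + D w $ j) * (y - w' $ j))"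
proof -
  let ?Z = "cbox a b"
  obtain G k where G: "GDERIV (\<lambda>x. f (upd_blk blk i w x)) w :> G"
    and k: "let cand = (\<lambda>c. upd_blk blk i w (closest_point ?Z (w - (1 / c) *\<^sub>R G)));
             ok = (\<lambda>c. f (cand c) + \<alpha> / 2 * (norm (cand c - w))\<^sup>2
                        \<le> f w + G \<bullet> (cand c - w) + c / 2 * (norm (cand c - w))\<^sup>2)
         in ok (\<beta> ^ k * c0) \<and> (\<forall>k'<k. \<not> ok (\<beta> ^ k' * c0)) \<and> w' = cand (\<beta> ^ k * c0)"
    using step unfolding block_step_def Let_def by blast
  define p where "p c = closest_point ?Z (w - (1 / c) *\<^sub>R G)" for c
  define ok where "ok c \<longleftrightarrow> f (p c) + \<alpha> / 2 * (norm (p c - w))\<^sup>2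
      \<le> f w + G \<bullet> (p c - w) + c / 2 * (norm (p c - w))\<^sup>2" for c
  have G_eq: "G $ j = (if blk j = i then D w $ j else 0)" for j
    by (rule GDERIV_upd_blk[OF D G])
  have ne: "?Z \<noteq> {}" using w by blast
  have pZ: "p c \<in> ?Z" for c unfolding p_def using ne by (intro closest_point_in_set) auto
  have proj: "(w $ j - G $ j / c - p c $ j) * (y - p c $ j) \<le> 0" if "y \<in> {a $ j..b $ j}" for c j y
    using closest_point_cbox_component[OF ne that, of "w - (1 / c) *\<^sub>R G"] by (simp add: p_def)
  have wj: "w $ j \<in> {a $ j..b $ j}" for j using w by (auto simp: mem_box_cart)
  \<comment> \<open>Outside the block \<open>G\<close> vanishes, and testing with
    \<open>y = w $ j\<close> shows that the projection onto the whole box leaves the coordinate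
    alone. So it agrees with the blockwise candidate.\<close>
  have off: "p c $ j = w $ j" if "blk j \<noteq> i" for c j
  proof -
    have "(w $ j - p c $ j) * (w $ j - p c $ j) \<le> 0"
      using proj[OF wj, of j c] that by (simp add: G_eq)
    then show ?thesis by (metis eq_iff_diff_eq_0 mult_eq_0_iff order_antisym zero_le_square)
  qed
  have cand: "upd_blk blk i w (closest_point ?Z (w - (1 / c) *\<^sub>R G)) = p c" for c
    using off by (auto simp: upd_blk_def vec_eq_iff p_def[symmetric])
  have k_ok: "ok (\<beta> ^ k * c0)" and k_min: "\<And>k'. k' < k \<Longrightarrow> \<not> ok (\<beta> ^ k' * c0)"
    and w': "w' = p (\<beta> ^ k * c0)"
    using k unfolding Let_def cand ok_def by auto
  define c where "c = \<beta> ^ k * c0"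
  have c: "c > 0" using pos by (simp add: c_def)
  have w'c: "w' = p c" by (simp add: w' c_def)
  show "w' \<in> ?Z" unfolding w' by (rule pZ)
  show "\<And>j. blk j \<noteq> i \<Longrightarrow> w' $ j = w $ j" unfolding w' by (rule off)
  have inner_G: "G \<bullet> (p c - w) = D w \<bullet> (p c - w)" for c
    unfolding inner_vec_def by (rule sum.cong) (auto simp: G_eq off)
  \<comment> \<open>Tested at \<open>w\<close>, the projection inequality yields a decrease
    \<open>- c * (norm (p c - w))\<^sup>2\<close>, which outweighs the term \<open>c / 2\<close> of
    the acceptance test.\<close>
  have "((w - (1 / c) *\<^sub>R G) - p c) \<bullet> (w - p c) \<le> 0"
    unfolding p_def using w by (intro closest_point_dot convex_box) auto
  then have "(norm (p c - w))\<^sup>2 + (1 / c) * (G \<bullet> (p c - w)) \<le> 0"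
    by (simp add: power2_norm_eq_inner inner_diff_left inner_diff_right inner_commute algebra_simps)
  then have "c * ((norm (p c - w))\<^sup>2 + (1 / c) * (G \<bullet> (p c - w))) \<le> 0"
    using c by (simp add: mult_le_0_iff)
  then have "G \<bullet> (p c - w) \<le> - c * (norm (p c - w))\<^sup>2" using c by (simp add: algebra_simps)
  moreover have "0 \<le> c / 2 * (norm (p c - w))\<^sup>2" using c by simp
  ultimately show "f w' + \<alpha> / 2 * (norm (w' - w))\<^sup>2 \<le> f w"
    using k_ok unfolding w'c ok_def c_def[symmetric] by (simp add: algebra_simps)
  have "c \<le> max c0 (\<beta> * (2 * L + \<alpha>))"
  proof (cases k)
    case 0
    then show ?thesis by (simp add: c_def)
  next
    case (Suc k')
    \<comment> \<open>The last rejected trial.\<close>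
    define c' where "c' = \<beta> ^ k' * c0"
    have "\<not> ok c'" unfolding c'_def by (rule k_min) (simp add: Suc)
    moreover have "ok c'" if c': "2 * L + \<alpha> \<le> c'"
    proof -
      have "f (p c') \<le> f w + D w \<bullet> (p c' - w) + L * (norm (p c' - w))\<^sup>2"
        by (rule gradient_descent_inequality[OF D convex_box(1) w pZ L])
      moreover have "L * (norm (p c' - w))\<^sup>2 + \<alpha> / 2 * (norm (p c' - w))\<^sup>2 \<le> c' / 2 * (norm (p c' - w))\<^sup>2"
        unfolding distrib_right[symmetric] using c' by (intro mult_right_mono) auto
      ultimately show ?thesis unfolding ok_def inner_G by linarith
    qed
    ultimately have "c' \<le> 2 * L + \<alpha>" by linarith
    then have "\<beta> * c' \<le> \<beta> * (2 * L + \<alpha>)" using pos by (intro mult_left_mono) auto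
    then show ?thesis by (simp add: c_def c'_def Suc mult.assoc)
  qed
  moreover have "0 \<le> (c * (w' $ j - w $ j) + D w $ j) * (y - w' $ j)" if "blk j = i" "y \<in> {a $ j..b $ j}" for j y
  proof -
    have "(w $ j - D w $ j / c - w' $ j) * (y - w' $ j) \<le> 0"
      using proj[OF that(2), of c] that(1) by (simp add: G_eq w'c)
    then have "c * ((w $ j - D w $ j / c - w' $ j) * (y - w' $ j)) \<le> 0"
      using c by (simp add: mult_le_0_iff)
    also have "c * ((w $ j - D w $ j / c - w' $ j) * (y - w' $ j))
        = (c * w $ j - D w $ j - c * w' $ j) * (y - w' $ j)"
      using c by (simp add: algebra_simps)
    finally show ?thesis by (simp add: algebra_simps)
  qed
  ultimately show "\<exists>c>0. c \<le> max c0 (\<beta> * (2 * L + \<alpha>)) \<and> (\<forall>j y. blk j = i \<longrightarrow> y \<in> {a $ j..b $ j} \<longrightarrow>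
      0 \<le> (c * (w' $ j - w $ j) + D w $ j) * (y - w' $ j))"
    using c by blast
qed

text \<open>\<open>d\<close> is the sum of the block step lengths and thus bounds the distance from
  \<open>z'\<close> to every intermediate point. As a coordinate moves only in its own block step,
  the inequality of that step still holds at \<open>z'\<close>.\<close>

lemma primal_sweep_properties:
  fixes f :: "real^'n \<Rightarrow> real" and blk :: "'n \<Rightarrow> nat"
  assumes D: "\<And>x. GDERIV f x :> D x"
    and L: "L \<ge> 0" "\<And>x y. x \<in> cbox a b \<Longrightarrow> y \<in> cbox a b \<Longrightarrow> norm (D x - D y) \<le> L * norm (x - y)"
    and blk: "\<And>j. blk j < P"
    and pos: "\<And>i. i < P \<Longrightarrow> \<alpha> i \<ge> \<alpha>0" "\<alpha>0 > 0" "\<beta> > 1" "\<And>i. i < P \<Longrightarrow> c0 i > 0"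
    and Cm: "\<And>i. i < P \<Longrightarrow> max (c0 i) (\<beta> * (2 * L + \<alpha> i)) \<le> Cm"
    and z: "z \<in> cbox a b" and sweep: "primal_sweep f (cbox a b) blk P \<alpha> \<beta> c0 z z'"
  shows "\<exists>d\<ge>0. z' \<in> cbox a b \<and> norm (z' - z) \<le> d \<and> \<alpha>0 / 2 * d\<^sup>2 \<le> real P * (f z - f z') \<and>
    (\<forall>j. \<exists>c>0. \<exists>w\<in>cbox a b. c \<le> Cm \<and> norm (z' - w) \<le> d \<and>
      (\<forall>y\<in>{a $ j..b $ j}. 0 \<le> (c * (z' $ j - w $ j) + D w $ j) * (y - z' $ j)))"
proof -
  let ?Z = "cbox a b"
  obtain w where w0: "w 0 = z" and step: "\<And>i. i < P \<Longrightarrow> block_step f ?Z blk (\<alpha> i) \<beta> (c0 i) i (w i) (w (Suc i))"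
    and wP: "z' = w P"
    using sweep unfolding primal_sweep_def by blast
  have \<alpha>: "\<alpha> i > 0" if "i < P" for i using pos(1)[OF that] pos(2) by linarith
  have wZ: "i \<le> P \<Longrightarrow> w i \<in> ?Z" for i
  proof (induction i)
    case (Suc i)
    then have i: "i < P" "w i \<in> ?Z" by auto
    show ?case
      by (rule block_step_properties(1)[OF D L(1) _ \<alpha>[OF i(1)] pos(3) pos(4)[OF i(1)] i(2) step[OF i(1)]])
        (rule L(2))
  qed (use w0 z in simp)
  have bs: "\<And>j. blk j \<noteq> i \<Longrightarrow> w (Suc i) $ j = w i $ j"
    "f (w (Suc i)) + \<alpha> i / 2 * (norm (w (Suc i) - w i))\<^sup>2 \<le> f (w i)"
    "\<exists>c>0. c \<le> max (c0 i) (\<beta> * (2 * L + \<alpha> i)) \<and> (\<forall>j y. blk j = i \<longrightarrow> y \<in> {a $ j..b $ j} \<longrightarrow>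
      0 \<le> (c * (w (Suc i) $ j - w i $ j) + D (w i) $ j) * (y - w (Suc i) $ j))" if i: "i < P" for i
  proof -
    note bs' = block_step_properties[OF D L(1) _ \<alpha>[OF i] pos(3) pos(4)[OF i] wZ[OF less_imp_le[OF i]] step[OF i]]
    show "\<And>j. blk j \<noteq> i \<Longrightarrow> w (Suc i) $ j = w i $ j" by (rule bs'(2)[OF L(2)])
    show "f (w (Suc i)) + \<alpha> i / 2 * (norm (w (Suc i) - w i))\<^sup>2 \<le> f (w i)" by (rule bs'(3)[OF L(2)])
    show "\<exists>c>0. c \<le> max (c0 i) (\<beta> * (2 * L + \<alpha> i)) \<and> (\<forall>j y. blk j = i \<longrightarrow> y \<in> {a $ j..b $ j} \<longrightarrow>
      0 \<le> (c * (w (Suc i) $ j - w i $ j) + D (w i) $ j) * (y - w (Suc i) $ j))" by (rule bs'(4)[OF L(2)])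
  qed
  define n where "n i = norm (w (Suc i) - w i)" for i
  define d where "d = (\<Sum>i<P. n i)"
  have d: "d \<ge> 0" unfolding d_def n_def by (intro sum_nonneg) auto
  have tail: "norm (w P - w i) \<le> d" if "i \<le> P" for i
  proof -
    have "norm (w P - w i) = norm (\<Sum>k\<in>{i..<P}. w (Suc k) - w k)"
      using that by (simp add: sum_Suc_diff')
    also have "\<dots> \<le> (\<Sum>k\<in>{i..<P}. n k)" unfolding n_def by (rule norm_sum)
    also have "\<dots> \<le> d" unfolding d_def by (rule sum_mono2) (auto simp: n_def)
    finally show ?thesis .
  qed
  have "\<alpha>0 / 2 * (n i)\<^sup>2 \<le> f (w i) - f (w (Suc i))" if "i < P" for i
  proof -
    have "\<alpha>0 / 2 * (n i)\<^sup>2 \<le> \<alpha> i / 2 * (n i)\<^sup>2" using pos(1)[OF that] by (intro mult_right_mono) auto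
    with bs(2)[OF that] show ?thesis by (simp add: n_def)
  qed
  then have "(\<Sum>i<P. \<alpha>0 / 2 * (n i)\<^sup>2) \<le> (\<Sum>i<P. f (w i) - f (w (Suc i)))" by (intro sum_mono) simp
  also have "\<dots> = f z - f z'"
    using sum_lessThan_telescope'[of "\<lambda>i. f (w i)" P] by (simp add: w0 wP)
  finally have descent: "\<alpha>0 / 2 * (\<Sum>i<P. (n i)\<^sup>2) \<le> f z - f z'" by (simp add: sum_distrib_left)
  \<comment> \<open>Cauchy-Schwarz over the blocks is the origin of the factor
    \<open>real P\<close>.\<close>
  have "d\<^sup>2 \<le> real P * (\<Sum>i<P. (n i)\<^sup>2)"
    unfolding d_def using sum_squared_le_sum_of_squares[of n "{..<P}"] by (simp add: mult.commute)
  then have "\<alpha>0 / 2 * d\<^sup>2 \<le> \<alpha>0 / 2 * (real P * (\<Sum>i<P. (n i)\<^sup>2))"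
    using pos(2) by (intro mult_left_mono) auto
  also have "\<dots> = real P * (\<alpha>0 / 2 * (\<Sum>i<P. (n i)\<^sup>2))" by simp
  also have "\<dots> \<le> real P * (f z - f z')" by (intro mult_left_mono descent) simp
  finally have 1: "\<alpha>0 / 2 * d\<^sup>2 \<le> real P * (f z - f z')" .
  have 2: "\<exists>c>0. \<exists>v\<in>?Z. c \<le> Cm \<and> norm (z' - v) \<le> d \<and>
      (\<forall>y\<in>{a $ j..b $ j}. 0 \<le> (c * (z' $ j - v $ j) + D v $ j) * (y - z' $ j))" for j
  proof -
    define i where "i = blk j"
    have i: "i < P" using blk by (simp add: i_def)
    have later: "k \<le> P \<Longrightarrow> Suc i \<le> k \<Longrightarrow> w k $ j = w (Suc i) $ j" for k
    proof (induction k)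
      case (Suc k)
      show ?case
      proof (cases "k = i")
        case False
        then have "w (Suc k) $ j = w k $ j" using bs(1)[of k j] Suc.prems by (simp add: i_def)
        with Suc False show ?thesis by simp
      qed simp
    qed simp
    have z'j: "z' $ j = w (Suc i) $ j" unfolding wP using later[of P] i by simp
    obtain c where c: "c > 0" "c \<le> max (c0 i) (\<beta> * (2 * L + \<alpha> i))"
      "\<And>j y. blk j = i \<Longrightarrow> y \<in> {a $ j..b $ j} \<Longrightarrow> 0 \<le> (c * (w (Suc i) $ j - w i $ j) + D (w i) $ j) * (y - w (Suc i) $ j)"
      using bs(3)[OF i] by auto
    have "c \<le> Cm" using c(2) Cm[OF i] by linarith
    moreover have "norm (z' - w i) \<le> d" unfolding wP using tail[of i] i by simp
    moreover have "w i \<in> ?Z" using wZ i by simp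
    moreover have "0 \<le> (c * (z' $ j - w i $ j) + D (w i) $ j) * (y - z' $ j)" if "y \<in> {a $ j..b $ j}" for y
      unfolding z'j by (rule c(3)[OF i_def[symmetric] that])
    ultimately show ?thesis using c(1) by blast
  qed
  have "z' \<in> ?Z" "norm (z' - z) \<le> d" unfolding wP using wZ[of P] tail[of 0] w0 by auto
  with d 1 2 show ?thesis by blast
qed

section \<open>Finite length and the limit point\<close>

lemma powr_concave_diff:
  fixes x y s :: real
  assumes "0 < y" "y \<le> x" "0 < s" "s \<le> 1"
  shows "s * x powr (s - 1) * (x - y) \<le> x powr s - y powr s"
proof (cases "y = x")
  case False
  then have "y < x" using assms(2) by simp
  have der: "((\<lambda>t. t powr s) has_real_derivative s * t powr (s - 1)) (at t)" if "y \<le> t" for t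
    using that assms(1) by (intro has_real_derivative_powr) simp
  obtain t where t: "y < t" "t < x" "x powr s - y powr s = (x - y) * (s * t powr (s - 1))"
    using MVT2[OF \<open>y < x\<close>, of "\<lambda>t. t powr s" "\<lambda>t. s * t powr (s - 1)"] der by blast
  have "x powr (s - 1) \<le> t powr (s - 1)" using t assms by (intro powr_mono2') auto
  then have "s * x powr (s - 1) * (x - y) \<le> s * t powr (s - 1) * (x - y)"
    using assms \<open>y < x\<close> by (intro mult_right_mono mult_left_mono) auto
  then show ?thesis using t(3) by (simp add: mult_ac)
qed simp

text \<open>With \<open>\<phi> r = (2 / \<delta>) r powr (\<delta> / 2)\<close>, concavity turns the gradient inequality into
  \<open>d (l + 1)\<^sup>2 \<le> M d l (\<phi> (r (l + 1)) - \<phi> (r (l + 2)))\<close>, and the arithmetic-geometric mean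
  inequality makes the right-hand side telescope.\<close>

lemma finite_length:
  fixes r d :: "nat \<Rightarrow> real"
  assumes r: "\<And>l. 0 \<le> r l" "r \<longlonglongrightarrow> 0" and d: "\<And>l. 0 \<le> d l"
    and \<kappa>: "\<kappa> > 0" "\<And>l. \<kappa> * (d l)\<^sup>2 \<le> r l - r (Suc l)"
    and KL: "0 < \<delta>" "\<delta> \<le> 1" "\<epsilon> > 0" "K > 0"
      "\<And>l. 0 < r (Suc l) \<Longrightarrow> r (Suc l) < \<epsilon> \<Longrightarrow> r (Suc l) powr (2 - \<delta>) \<le> K * (d l)\<^sup>2"
  shows "summable d"
proof (cases "\<exists>N. r N = 0")
  case True
  then obtain N where N: "r N = 0" by blast
  \<comment> \<open>Once the limit value is attained, \<open>r\<close> stays at \<open>0\<close> and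
    the descent inequality makes all later steps vanish.\<close>
  have "r (N + n) = 0" for n
  proof (induction n)
    case (Suc n)
    have "0 \<le> \<kappa> * (d (N + n))\<^sup>2" using \<kappa>(1) by simp
    with \<kappa>(2)[of "N + n"] r(1)[of "Suc (N + n)"] Suc show ?case by simp
  qed (simp add: N)
  then have "\<kappa> * (d (n + N))\<^sup>2 \<le> 0" for n
    using \<kappa>(2)[of "n + N"] by (metis add.commute add_Suc_right diff_zero)
  then have "d (n + N) = 0" for n using \<kappa>(1) by (simp add: mult_le_0_iff)
  then have "summable (\<lambda>n. d (n + N))" by simp
  then show ?thesis by (simp add: summable_iff_shift)
next
  case False
  then have pos: "r l > 0" for l using r(1)[of l] by (metis less_eq_real_def)
  obtain N where N: "\<And>l. l \<ge> N \<Longrightarrow> r l < \<epsilon>"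
    using order_tendstoD(2)[OF r(2) KL(3)] by (auto simp: eventually_sequentially)
  \<comment> \<open>Then \<open>2 * (1 - s) = 2 - \<delta>\<close>: the gradient inequality becomes
    a bound on \<open>x powr (1 - s)\<close> after taking roots.\<close>
  define s where "s = \<delta> / 2"
  have s: "0 < s" "s \<le> 1" using KL by (auto simp: s_def)
  define \<phi> where "\<phi> l = r (Suc l) powr s / s" for l
  define M where "M = sqrt K / \<kappa>"
  have M: "M > 0" using KL(4) \<kappa>(1) by (simp add: M_def)
  have step: "2 * d (Suc l) \<le> d l + M * (\<phi> l - \<phi> (Suc l))" if "l \<ge> N" for l
  proof -
    define x where "x = r (Suc l)"
    define y where "y = r (Suc (Suc l))"
    have xy: "0 < x" "0 < y" "y \<le> x"
    proof -
      have "0 \<le> \<kappa> * (d (Suc l))\<^sup>2" using \<kappa>(1) by simp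
      with \<kappa>(2)[of "Suc l"] show "y \<le> x" by (simp add: x_def y_def)
    qed (auto simp: x_def y_def pos)
    have "(x powr (1 - s))\<^sup>2 = x powr (2 - \<delta>)"
      using xy by (simp add: powr_power s_def algebra_simps)
    also have "\<dots> \<le> K * (d l)\<^sup>2" unfolding x_def using N[of "Suc l"] that by (intro KL(5) pos) simp
    also have "\<dots> = (sqrt K * d l)\<^sup>2" using KL(4) by (simp add: power_mult_distrib)
    finally have grad: "x powr (1 - s) \<le> sqrt K * d l"
      using KL(4) d[of l] by (simp add: power2_le_iff_abs_le)
    have "s * x powr (s - 1) * (x - y) \<le> s * (\<phi> l - \<phi> (Suc l))"
      using powr_concave_diff[OF xy(2,3) s] s(1) by (simp add: \<phi>_def x_def y_def field_simps)
    then have conc: "x powr (s - 1) * (x - y) \<le> \<phi> l - \<phi> (Suc l)" using s(1) by (simp add: mult.assoc)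
    then have \<Delta>: "0 \<le> \<phi> l - \<phi> (Suc l)" using xy by (meson diff_ge_0_iff_ge mult_nonneg_nonneg order_trans powr_ge_zero)
    have "x - y = x powr (1 - s) * (x powr (s - 1) * (x - y))"
      using xy by (simp add: powr_add[symmetric] mult.assoc[symmetric])
    also have "\<dots> \<le> (sqrt K * d l) * (\<phi> l - \<phi> (Suc l))"
      using grad conc xy d[of l] KL(4) by (intro mult_mono) auto
    finally have "\<kappa> * (d (Suc l))\<^sup>2 \<le> (sqrt K * d l) * (\<phi> l - \<phi> (Suc l))"
      using \<kappa>(2)[of "Suc l"] by (simp add: x_def y_def)
    then have sq: "(d (Suc l))\<^sup>2 \<le> d l * (M * (\<phi> l - \<phi> (Suc l)))"
      using \<kappa>(1) by (simp add: M_def field_simps)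
    define A where "A = M * (\<phi> l - \<phi> (Suc l))"
    have A: "A \<ge> 0" using M \<Delta> by (simp add: A_def)
    have "0 \<le> (d l - A)\<^sup>2" by simp
    then have "4 * (d l * A) \<le> (d l + A)\<^sup>2" by (simp add: power2_eq_square algebra_simps)
    then have "(2 * d (Suc l))\<^sup>2 \<le> (d l + A)\<^sup>2" using sq by (simp add: A_def power_mult_distrib)
    then have "2 * d (Suc l) \<le> d l + A" by (rule power2_le_imp_le) (use A d[of l] in simp)
    then show ?thesis by (simp add: A_def)
  qed
  \<comment> \<open>The extra \<open>d (N + n)\<close> on the left is carried along to absorb the
    \<open>d l\<close> on the right of \<open>step\<close>.\<close>
  have sum_bound: "(\<Sum>i<n. d (i + Suc N)) + d (N + n) \<le> d N + M * (\<phi> N - \<phi> (N + n))" for n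
  proof (induction n)
    case (Suc n)
    have "d (n + Suc N) + d (N + Suc n) - d (N + n) \<le> M * (\<phi> (N + n) - \<phi> (N + Suc n))"
      using step[of "N + n"] by (simp add: add.commute)
    with Suc show ?case by (simp add: algebra_simps)
  qed simp
  have "(\<Sum>i<n. d (i + Suc N)) \<le> d N + M * \<phi> N" for n
  proof -
    have "0 \<le> M * \<phi> (N + n)" using M s(1) by (simp add: \<phi>_def)
    with sum_bound[of n] d[of "N + n"] show ?thesis by (simp add: algebra_simps)
  qed
  then have "summable (\<lambda>i. d (i + Suc N))"
    by (intro summableI_nonneg_bounded) (auto intro: d)
  then show ?thesis using summable_iff_shift[of d "Suc N"] by simp
qed

theorem polynomial_sweeps_converge:
  fixes f :: "real^'n \<Rightarrow> real" and blk :: "'n \<Rightarrow> nat"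
  assumes f: "polyfun f" and blk: "\<And>j. blk j < P"
    and pos: "\<And>i. i < P \<Longrightarrow> \<alpha> i > 0" "\<beta> > 1" "\<And>i. i < P \<Longrightarrow> c0 i > 0"
    and z0: "z 0 \<in> cbox a b"
    and sweep: "\<And>l. primal_sweep f (cbox a b) blk P \<alpha> \<beta> c0 (z l) (z (Suc l))"
  shows "\<exists>x\<in>cbox a b. z \<longlonglongrightarrow> x \<and> (\<exists>G. GDERIV f x :> G \<and> - G \<in> normal_cone (cbox a b) x)"
proof -
  let ?Z = "cbox a b"
  obtain D where D: "\<And>x. GDERIV f x :> D x" "\<And>j. polyfun (\<lambda>x. D x $ j)"
    using polyfun_GDERIV[OF f] by blast
  obtain L where L: "L \<ge> 0" "\<And>x y. x \<in> ?Z \<Longrightarrow> y \<in> ?Z \<Longrightarrow> norm (D x - D y) \<le> L * norm (x - y)"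
    using polyfun_vector_Lipschitz_on_bounded[OF D(2) bounded_cbox] by blast
  have P: "P > 0" using blk[of undefined] by simp
  define \<alpha>0 where "\<alpha>0 = Min (\<alpha> ` {..<P})"
  have \<alpha>0: "\<alpha>0 > 0" "\<And>i. i < P \<Longrightarrow> \<alpha>0 \<le> \<alpha> i"
    unfolding \<alpha>0_def using P pos(1) by (auto simp: Min_gr_iff lessThan_empty_iff)
  define Cm where "Cm = Max ((\<lambda>i. max (c0 i) (\<beta> * (2 * L + \<alpha> i))) ` {..<P})"
  have Cm: "max (c0 i) (\<beta> * (2 * L + \<alpha> i)) \<le> Cm" if "i < P" for i
    unfolding Cm_def using that by (intro Max_ge) auto
  have Cm_pos: "Cm > 0" using Cm[OF P] pos(3)[OF P] by linarith
  have props: "\<exists>d\<ge>0. z (Suc l) \<in> ?Z \<and> norm (z (Suc l) - z l) \<le> d \<and>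
      \<alpha>0 / 2 * d\<^sup>2 \<le> real P * (f (z l) - f (z (Suc l))) \<and>
      (\<forall>j. \<exists>c>0. \<exists>w\<in>?Z. c \<le> Cm \<and> norm (z (Suc l) - w) \<le> d \<and>
        (\<forall>y\<in>{a $ j..b $ j}. 0 \<le> (c * (z (Suc l) $ j - w $ j) + D w $ j) * (y - z (Suc l) $ j)))"
    if zl: "z l \<in> ?Z" for l
    by (rule primal_sweep_properties[OF D(1) L(1) _ blk \<alpha>0(2) \<alpha>0(1) pos(2,3) Cm zl sweep]) (rule L(2))
  have zZ: "z l \<in> ?Z" for l by (induction l) (use z0 props in blast)+
  from props[OF zZ] obtain d where d: "\<And>l. d l \<ge> 0" "\<And>l. norm (z (Suc l) - z l) \<le> d l"
    "\<And>l. \<alpha>0 / 2 * (d l)\<^sup>2 \<le> real P * (f (z l) - f (z (Suc l)))"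
    and res: "\<And>l j. \<exists>c>0. \<exists>w\<in>?Z. c \<le> Cm \<and> norm (z (Suc l) - w) \<le> d l \<and>
        (\<forall>y\<in>{a $ j..b $ j}. 0 \<le> (c * (z (Suc l) $ j - w $ j) + D w $ j) * (y - z (Suc l) $ j))"
    by metis
  define \<kappa> where "\<kappa> = \<alpha>0 / (2 * real P)"
  have \<kappa>: "\<kappa> > 0" using \<alpha>0(1) P by (simp add: \<kappa>_def)
  have descent: "\<kappa> * (d l)\<^sup>2 \<le> f (z l) - f (z (Suc l))" for l
    using d(3)[of l] P by (simp add: \<kappa>_def field_simps)
  have "decseq (\<lambda>l. f (z l))"
  proof (rule decseq_SucI)
    fix l
    have "0 \<le> \<kappa> * (d l)\<^sup>2" using \<kappa> by simp
    with descent[of l] show "f (z (Suc l)) \<le> f (z l)" by linarith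
  qed
  moreover obtain B where "\<And>x. x \<in> ?Z \<Longrightarrow> B \<le> f x"
    using continuous_attains_inf[OF compact_cbox _ polyfun_continuous_on[OF f]] z0 by blast
  then have "\<And>l. B \<le> f (z l)" using zZ by blast
  ultimately obtain v where v: "(\<lambda>l. f (z l)) \<longlonglongrightarrow> v" "\<And>l. v \<le> f (z l)"
    using decseq_convergent by metis
  obtain \<delta> \<epsilon> where Loj: "\<delta> > 0" "\<epsilon> > 0" "\<And>x. x \<in> ?Z \<Longrightarrow> v < f x \<Longrightarrow> f x < v + \<epsilon> \<Longrightarrow>
      (f x - v) powr (2 - \<delta>) \<le> (\<Sum>j\<in>UNIV. (x $ j - a $ j) * (b $ j - x $ j) * (D x $ j)\<^sup>2)"
    using box_Lojasiewicz[OF f D] by blast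
  \<comment> \<open>An interior coordinate has
    \<open>\<bar>D x $ j\<bar> \<le> (Cm + L) * d l\<close> and weight at most
    \<open>(b $ j - a $ j)\<^sup>2\<close>; the \<open>1\<close> keeps \<open>K\<close> positive for
    a degenerate box.\<close>
  define K where "K = (\<Sum>j\<in>(UNIV::'n set). ((b $ j - a $ j) * (Cm + L))\<^sup>2) + 1"
  have K: "K > 0" unfolding K_def by (intro add_nonneg_pos sum_nonneg) auto
  have grad: "(\<Sum>j\<in>UNIV. (z (Suc l) $ j - a $ j) * (b $ j - z (Suc l) $ j) * (D (z (Suc l)) $ j)\<^sup>2)
      \<le> K * (d l)\<^sup>2" for l
  proof -
    define x where "x = z (Suc l)"
    have "(x $ j - a $ j) * (b $ j - x $ j) * (D x $ j)\<^sup>2 \<le> ((b $ j - a $ j) * (Cm + L))\<^sup>2 * (d l)\<^sup>2" for j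
    proof -
      have x: "x \<in> ?Z" "a $ j \<le> x $ j" "x $ j \<le> b $ j"
        using zZ[of "Suc l"] by (auto simp: x_def mem_box_cart)
      show ?thesis
      proof (cases "x $ j = a $ j \<or> x $ j = b $ j")
        case True
        then have "(x $ j - a $ j) * (b $ j - x $ j) * (D x $ j)\<^sup>2 = 0" by auto
        also have "\<dots> \<le> ((b $ j - a $ j) * (Cm + L))\<^sup>2 * (d l)\<^sup>2" by simp
        finally show ?thesis .
      next
        case False
        obtain c w where c: "c > 0" "c \<le> Cm" and w: "w \<in> ?Z" "norm (x - w) \<le> d l"
          and opt: "\<And>y. y \<in> {a $ j..b $ j} \<Longrightarrow> 0 \<le> (c * (x $ j - w $ j) + D w $ j) * (y - x $ j)"
          using res[of l j] unfolding x_def by blast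
        \<comment> \<open>Strictly between the bounds, testing with both ends gives both signs, so
          the factor is zero.\<close>
        have "c * (x $ j - w $ j) + D w $ j = 0"
          using opt[of "a $ j"] opt[of "b $ j"] x False
          by (auto simp: zero_le_mult_iff)
        then have "\<bar>D w $ j\<bar> = c * \<bar>x $ j - w $ j\<bar>"
          using c(1) by (metis abs_minus_cancel abs_mult abs_of_pos add_eq_0_iff)
        also have "\<dots> \<le> Cm * d l"
          using c component_le_norm_cart[of "x - w" j] w(2) by (intro mult_mono) auto
        finally have "\<bar>D w $ j\<bar> \<le> Cm * d l" .
        moreover have "\<bar>D x $ j - D w $ j\<bar> \<le> L * d l"
        proof -
          have "\<bar>D x $ j - D w $ j\<bar> \<le> norm (D x - D w)" using component_le_norm_cart[of "D x - D w" j] by simp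
          also have "\<dots> \<le> L * norm (x - w)" by (rule L(2)[OF x(1) w(1)])
          also have "\<dots> \<le> L * d l" using w(2) L(1) by (intro mult_left_mono)
          finally show ?thesis .
        qed
        ultimately have "\<bar>D x $ j\<bar> \<le> (Cm + L) * d l" unfolding distrib_right by linarith
        then have "(D x $ j)\<^sup>2 \<le> ((Cm + L) * d l)\<^sup>2" by (metis abs_ge_zero power2_abs power_mono)
        moreover have "(x $ j - a $ j) * (b $ j - x $ j) \<le> (b $ j - a $ j) * (b $ j - a $ j)"
          using x by (intro mult_mono) auto
        ultimately have "(x $ j - a $ j) * (b $ j - x $ j) * (D x $ j)\<^sup>2
            \<le> (b $ j - a $ j) * (b $ j - a $ j) * ((Cm + L) * d l)\<^sup>2"
          using x by (intro mult_mono) auto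
        then show ?thesis by (simp add: power2_eq_square mult_ac)
      qed
    qed
    then have "(\<Sum>j\<in>UNIV. (x $ j - a $ j) * (b $ j - x $ j) * (D x $ j)\<^sup>2)
        \<le> (\<Sum>j\<in>UNIV. ((b $ j - a $ j) * (Cm + L))\<^sup>2 * (d l)\<^sup>2)" by (intro sum_mono)
    also have "\<dots> \<le> K * (d l)\<^sup>2" unfolding K_def distrib_right sum_distrib_right by simp
    finally show ?thesis by (simp add: x_def)
  qed
  have "summable d"
  \<comment> \<open>\<open>finite_length\<close> asks for an exponent at most \<open>1\<close>.
    Lowering \<delta> is harmless while \<open>f - v < 1\<close>, hence the \<open>1\<close> beside
    \<epsilon>.\<close>
  proof (rule finite_length[where r = "\<lambda>l. f (z l) - v" and \<kappa> = \<kappa> and \<delta> = "min \<delta> 1" and \<epsilon> = "min \<epsilon> 1" and K = K])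
    show "(\<lambda>l. f (z l) - v) \<longlonglongrightarrow> 0" using v(1) by (simp add: LIM_zero)
    fix l assume r: "0 < f (z (Suc l)) - v" "f (z (Suc l)) - v < min \<epsilon> 1"
    have "(f (z (Suc l)) - v) powr (2 - min \<delta> 1) \<le> (f (z (Suc l)) - v) powr (2 - \<delta>)"
      using r by (intro powr_mono') auto
    also have "\<dots> \<le> K * (d l)\<^sup>2" using Loj(3)[OF zZ[of "Suc l"]] r grad[of l] by simp
    finally show "(f (z (Suc l)) - v) powr (2 - min \<delta> 1) \<le> K * (d l)\<^sup>2" .
  qed (use v d \<kappa> descent Loj K in auto)
  then have d_lim: "d \<longlonglongrightarrow> 0" by (rule summable_LIMSEQ_zero)
  have "summable (\<lambda>l. z (Suc l) - z l)"
    by (rule summable_comparison_test'[OF \<open>summable d\<close>]) (rule d(2))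
  then have "convergent (\<lambda>n. \<Sum>l<n. z (Suc l) - z l)" by (simp add: summable_iff_convergent)
  then obtain y where "(\<lambda>n. z n - z 0) \<longlonglongrightarrow> y" by (auto simp: convergent_def sum_lessThan_telescope)
  from tendsto_add[OF this tendsto_const[of "z 0"]] have lim: "z \<longlonglongrightarrow> y + z 0" by simp
  define x where "x = y + z 0"
  have lim: "z \<longlonglongrightarrow> x" using lim by (simp add: x_def)
  have xZ: "x \<in> ?Z"
    by (rule closed_sequentially[OF closed_cbox _ lim]) (rule zZ)
  have crit: "0 \<le> D x $ j * (t - x $ j)" if t: "t \<in> {a $ j..b $ j}" for j t
  proof -
    obtain c w where c: "\<And>l. c l > 0" "\<And>l. c l \<le> Cm" and w: "\<And>l. norm (z (Suc l) - w l) \<le> d l"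
      and opt: "\<And>l. 0 \<le> (c l * (z (Suc l) $ j - w l $ j) + D (w l) $ j) * (t - z (Suc l) $ j)"
      using res[of _ j] t by metis
    have zS: "(\<lambda>l. z (Suc l)) \<longlonglongrightarrow> x" using lim by (rule LIMSEQ_Suc)
    have "(\<lambda>l. z (Suc l) - w l) \<longlonglongrightarrow> 0"
      by (rule Lim_null_comparison[OF _ d_lim]) (use w in auto)
    from tendsto_diff[OF zS this] have w_lim: "w \<longlonglongrightarrow> x" by simp
    \<comment> \<open>The constants \<open>c l\<close> need not converge; their bound
      \<open>Cm\<close> suffices.\<close>
    have "(\<lambda>l. c l * (z (Suc l) $ j - w l $ j)) \<longlonglongrightarrow> 0"
    proof (rule Lim_null_comparison)
      show "(\<lambda>l. Cm * d l) \<longlonglongrightarrow> 0" using tendsto_mult_left[OF d_lim, of Cm] by simp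
      have "norm (c l * (z (Suc l) $ j - w l $ j)) \<le> Cm * d l" for l
      proof -
        have "\<bar>z (Suc l) $ j - w l $ j\<bar> \<le> d l"
          using component_le_norm_cart[of "z (Suc l) - w l" j] w[of l] by simp
        then have "c l * \<bar>z (Suc l) $ j - w l $ j\<bar> \<le> Cm * d l"
          using c[of l] Cm_pos by (intro mult_mono) auto
        then show ?thesis using c(1)[of l] by (simp add: abs_mult)
      qed
      then show "\<forall>\<^sub>F l in sequentially. norm (c l * (z (Suc l) $ j - w l $ j)) \<le> Cm * d l" by simp
    qed
    then have "(\<lambda>l. (c l * (z (Suc l) $ j - w l $ j) + D (w l) $ j) * (t - z (Suc l) $ j))
        \<longlonglongrightarrow> (0 + D x $ j) * (t - x $ j)"
      by (intro tendsto_mult tendsto_add tendsto_diff tendsto_const tendsto_vec_nth zS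
          tendsto_polyfun[OF D(2) w_lim])
    from tendsto_lowerbound[OF this always_eventually[OF allI[OF opt]]] show ?thesis by simp
  qed
  \<comment> \<open>A box is a product, so the one-coordinate inequalities add up to the normal cone
    condition.\<close>
  have "- D x \<in> normal_cone ?Z x"
    unfolding normal_cone_def
  proof (intro CollectI conjI ballI xZ)
    fix y assume "y \<in> ?Z"
    then have "0 \<le> (\<Sum>j\<in>UNIV. D x $ j * (y $ j - x $ j))"
      by (intro sum_nonneg crit) (auto simp: mem_box_cart)
    then show "- D x \<bullet> (y - x) \<le> 0" by (simp add: inner_vec_def sum_negf)
  qed
  with xZ lim D(1) show ?thesis by blast
qed

section \<open>Application to the augmented Lagrangian\<close>

lemma polyfun_aug_lag:
  assumes "\<forall>i<P. polyfun (J i)" "\<forall>k<m. polyfun (Q k)" "\<forall>i<P. \<forall>r<q i. polyfun (g i r)"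
  shows "polyfun (aug_lag P m q J Q g T rho muQ mug s)"
proof -
  have "polyfun (\<lambda>z. (\<Sum>i<P. J i z)
     + (\<Sum>k<m. (muQ k + rho / 2 * Q k z) * Q k z)
     + (\<Sum>i<P. \<Sum>r<q i. (mug i r + rho / 2 * (g i r z + T i r \<bullet> s)) * (g i r z + T i r \<bullet> s)))"
    using assms by (intro polyfun_add polyfun_sum polyfun_mult polyfun_const) auto
  then show ?thesis unfolding aug_lag_def[abs_def] .
qed

theorem mainTheorem5:
  fixes P m :: nat and q :: "nat \<Rightarrow> nat" and blk :: "'n::finite \<Rightarrow> nat"
    and a b :: "real^'n"
    and J :: "nat \<Rightarrow> real^'n \<Rightarrow> real" and Q :: "nat \<Rightarrow> real^'n \<Rightarrow> real"
    and g :: "nat \<Rightarrow> nat \<Rightarrow> real^'n \<Rightarrow> real" and T :: "nat \<Rightarrow> nat \<Rightarrow> real^'p::finite"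
    and S :: "(real^'p) set" and s :: "real^'p"
    and muQ :: "nat \<Rightarrow> real" and mug :: "nat \<Rightarrow> nat \<Rightarrow> real"
    and rho beta :: real and alpha c0 :: "nat \<Rightarrow> real"
    and z :: "nat \<Rightarrow> real^'n"
  assumes "P \<ge> 1" and "CARD('n) \<ge> 2"
    and "\<forall>j. blk j < P"
    and "\<forall>j. a $ j \<le> b $ j"
    and "\<forall>i<P. poly_deg_ge2 (J i) \<and> dep_block blk i (J i)"
    and "\<forall>k<m. polyfun (Q k)"
    and "\<forall>i<P. \<forall>r<q i. polyfun (g i r) \<and> dep_block blk i (g i r)"
    and "s \<in> S" and "rho > 0"
    and "\<forall>i<P. alpha i > 0" and "beta > 1" and "\<forall>i<P. c0 i > 0"
    and "z 0 \<in> cbox a b"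
    and "\<forall>l. primal_sweep (aug_lag P m q J Q g T rho muQ mug s) (cbox a b) blk P
                alpha beta c0 (z l) (z (Suc l))"
  shows "\<exists>zinf \<in> cbox a b. z \<longlonglongrightarrow> zinf \<and>
           (\<exists>D. GDERIV (aug_lag P m q J Q g T rho muQ mug s) zinf :> D
                \<and> - D \<in> normal_cone (cbox a b) zinf)"
proof (rule polynomial_sweeps_converge[where blk = blk and P = P and \<alpha> = alpha and \<beta> = beta and ?c0.0 = c0])
  show "polyfun (aug_lag P m q J Q g T rho muQ mug s)"
    using assms(5-7) by (intro polyfun_aug_lag) (auto simp: poly_deg_ge2_def)
qed (use assms in auto)

end
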